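(* For any extended simple processes $A$ and $B$: $A\sqsubseteq_s B$ (trace inclusion for the compressed symbolic semantics) if and only if $A\sqsubseteq_d^2 B$ (trace inclusion for the reduced symbolic semantics with second-order satisfaction of dependency constraints).
   Context: **Terms and processes.** Fix pairwise disjoint infinite sets $\mathcal X$ (first-order variables), $\mathcal W$ (handles), a set $\mathcal N$ of names, a finite signature $\Sigma$ (constants allowed) and an equational theory $\mathsf E$ with induced congruence $=_{\mathsf E}$ on terms. $\mathcal T(S)$ is the set of terms built from $S$ using $\Sigma$; messages are in $\mathcal T(\mathcal N\cup\mathcal X)$, recipes in $\mathcal T(\mathcal W)$; ground means in $\mathcal T(\mathcal N)$. Fix a set $\mathcal C$ of channels. Basic processes on $c\in\mathcal C$: $P,Q::=0\mid \mathtt{if}\ u=v\ \mathtt{then}\ P\ \mathtt{else}\ Q\mid \mathtt{in}(c,x).P\mid \mathtt{out}(c,u).P$ with $u,v$ messages and $x\in\mathcal X$ (bound by the input); all actions are on the same channel $c$. A simple process $\mathcal P$ is a multiset of basic processes on pairwise distinct channels, null processes being removed. A frame $\Phi$ is a substitution with $\mathrm{dom}(\Phi)\subseteq\mathcal W$ and image in $\mathcal T(\mathcal N\cup\mathcal X)$, written $\{w\triangleright u,\dots\}$. An extended simple process is a pair $(\mathcal P;\Phi)$ of a simple process and a frame; all extended simple processes are closed: no free variables in $\mathcal P$, ground image of $\Phi$. Static equivalence $\Phi\sim\Phi'$ of closed frames: $\mathrm{dom}(\Phi)=\mathrm{dom}(\Phi')$ and for all $M,N\in\mathcal T(\mathrm{dom}(\Phi))$: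 $M\Phi=_{\mathsf E}N\Phi\Leftrightarrow M\Phi'=_{\mathsf E}N\Phi'$. **Constraint systems.** Fix a set $\mathcal X^2$ of second-order variables (standing for recipes); $\mathrm{fv}^1,\mathrm{fv}^2$ denote free first-order (in $\mathcal X\cup\mathcal W$) and second-order variables. A constraint system $(\Phi;\mathcal S)$ is a frame with a set $\mathcal S$ of constraints of the forms $D\vdash^?_X x$, $u=^?v$, $u\neq^?v$ ($D\subseteq\mathcal W$, $X\in\mathcal X^2$, $x\in\mathcal X$, $u,v$ messages). All constraint systems $\mathcal K=(\Phi;\mathcal S)$ are well-formed: each $x\in\mathrm{fv}^1(\mathcal K)\cap\mathcal X$ and each $X\in\mathrm{fv}^2(\mathcal K)$ occurs in a unique constraint $D\vdash^?_Xx$ of $\mathcal S$ (write $D_{\mathcal K}(X)=D$), and the relation "$x$ depends on $y$ iff $\mathcal S$ contains $D\vdash^?_Xx$ with $y\in\mathrm{fv}^1(\Phi(D))$" is acyclic. A solution is a substitution $\theta$ with $\mathrm{dom}(\theta)=\mathrm{fv}^2(\mathcal K)$ and $X\theta\in\mathcal T(D_{\mathcal K}(X))$ for all $X$, such that there is a ground substitution $\lambda$ with domain $\mathrm{fv}^1(\mathcal K)\cap\mathcal X$ satisfying $(X\theta)(\Phi\lambda)=_{\mathsf E}x\lambda$ for each $D\vdash^?_Xx$, $u\lambda=_{\mathsf E}v\lambda$ for each $u=^?v$, and $u\lambda\neq_{\mathsf E}v\lambda$ for each $u\neq^?v$. $\mathrm{Sol}(\mathcal K)$ is the set of solutions; $\lambda$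 is unique modulo $\mathsf E$ and denoted $\lambda_\theta$. **Compressed symbolic semantics.** A symbolic process is $(\mathcal P;\Phi;\mathcal S)$ with $(\Phi;\mathcal S)$ a constraint system and $\mathrm{fv}^1(\mathcal P)\subseteq\mathrm{fv}^1(\mathcal S)\cap\mathcal X$. For basic $P$: $(\mathtt{in}(c,y).P;\Phi;\mathcal S)\overset{\mathtt{in}(c,X)}{\longmapsto}(P\{y\mapsto x\};\Phi;\mathcal S\cup\{\mathrm{dom}(\Phi)\vdash^?_Xx\})$, $X,x$ fresh; $(\mathtt{out}(c,u).P;\Phi;\mathcal S)\overset{\mathtt{out}(c,w)}{\longmapsto}(P;\Phi\cup\{w\triangleright u\};\mathcal S)$, $w$ fresh; $(\mathtt{if}\ u=v\ \mathtt{then}\ P\ \mathtt{else}\ Q;\Phi;\mathcal S)\overset{\tau}{\longmapsto}(P;\Phi;\mathcal S\cup\{u=^?v\})$ and $\overset{\tau}{\longmapsto}(Q;\Phi;\mathcal S\cup\{u\neq^?v\})$. Focused relations $\longmapsto_\ell$, $\ell\in\{i^+,i^*,o^*\}$, are the least with ($K,K',K''$ symbolic basic processes): (In) $K\overset{\mathtt{in}(c,X)}{\longmapsto}K'$ and $K'\overset{\mathrm{tr}}{\longmapsto}_{i^*}K''$ give $K\overset{\mathtt{in}(c,X)\cdot\mathrm{tr}}{\longmapsto}_\ell K''$ for $\ell\in\{i^*,i^+\}$; (Out) $K\overset{\mathtt{out}(c,w)}{\longmapsto}K'$ and $K'\overset{\mathrm{tr}}{\longmapsto}_{o^*}K''$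 give $K\overset{\mathtt{out}(c,w)\cdot\mathrm{tr}}{\longmapsto}_\ell K''$ for $\ell\in\{i^*,o^*\}$; (Tau) $K\overset{\tau}{\longmapsto}K'$ and $K'\overset{\mathrm{tr}}{\longmapsto}_\ell K''$ give $K\overset{\mathrm{tr}}{\longmapsto}_\ell K''$ for any $\ell$; (Proper) $(P;\Phi;\mathcal S)\overset{\epsilon}{\longmapsto}_{o^*}(P;\Phi;\mathcal S)$ if $P=0$ or $P=\mathtt{in}(c,x).P'$; (Improper) $(0;\Phi;\mathcal S)\overset{\epsilon}{\longmapsto}_{i^*}(\bot;\Phi;\mathcal S)$, $\bot$ a special symbol. $\longmapsto_{\mathrm c}$ is the least reflexive (label $\epsilon$) transitive (labels concatenate) relation such that if $(Q;\Phi;\mathcal S)\overset{\mathrm{tr}}{\longmapsto}_{i^+}(Q';\Phi';\mathcal S')$ then $(\{Q\}\uplus\mathcal P;\Phi;\mathcal S)\overset{\mathrm{tr}}{\longmapsto}_{\mathrm c}(\{Q'\}\uplus\mathcal P;\Phi';\mathcal S')$ when $Q'\neq\bot$, and $\overset{\mathrm{tr}}{\longmapsto}_{\mathrm c}(\varnothing;\Phi';\mathcal S')$ when $Q'=\bot$. **Symbolic inclusion.** For $A=(\mathcal P;\Phi)$, $B=(\mathcal Q;\Psi)$: $A\sqsubseteq_sB$ iff whenever $(\mathcal P;\Phi;\varnothing)\overset{\mathrm{tr}}{\longmapsto}_{\mathrm c}(\mathcal P';\Phi';\mathcal S_A)$ and $\theta\in\mathrm{Sol}(\Phi';\mathcal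 S_A)$, there is $(\mathcal Q;\Psi;\varnothing)\overset{\mathrm{tr}}{\longmapsto}_{\mathrm c}(\mathcal Q';\Psi';\mathcal S_B)$ with $\theta\in\mathrm{Sol}(\Psi';\mathcal S_B)$ and $\Phi'\lambda^A_\theta\sim\Psi'\lambda^B_\theta$, where $\lambda^A_\theta,\lambda^B_\theta$ are the substitutions associated to $\theta$ in the respective systems. **Dependency constraints and reduced semantics.** A dependency constraint is $\vec X\ltimes\vec w$ with $\vec X$ a vector over $\mathcal X^2$, $\vec w$ a vector over $\mathcal W$. $\theta\models\vec X\ltimes\vec w$ iff $\vec w$ is empty or there are $X_i\in\vec X$, $w_j\in\vec w$ with $w_j\in\mathrm{fv}^1(X_i\theta)$. A dependency constraint system $\mathcal K$ is a constraint system possibly also containing dependency constraints; $\mathcal K^\circ$ is $\mathcal K$ without them (required well-formed), and $\lambda_\theta$ refers to $\mathcal K^\circ$. $\mathrm{Sol}^2(\mathcal K)$ is the set of $\theta\in\mathrm{Sol}(\mathcal K^\circ)$ satisfying every dependency constraint of $\mathcal K$. Write $\mathtt{io}_c(\vec X,\vec w)$ for the block $\mathtt{in}(c,X_1)\cdots\mathtt{in}(c,X_\ell)\cdot\mathtt{out}(c,w_1)\cdots\mathtt{out}(c,w_k)$. Fix a (strict) total order $\prec$ on $\mathcal C$. For $\mathrm{tr}=\mathtt{io}_{c_1}(\vec X_1,\vec w_1)\cdots\mathtt{io}_{c_n}(\vec X_n,\vec w_n)$ and a channel $c$: if there is $k\le n$ with $c\prec c_k$ and $c_i\prec c$ for all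 $k<i\le n$, then $\mathrm{dep}(\mathrm{tr},c)$ is the set of handles occurring in $\vec w_k,\dots,\vec w_n$; otherwise $\mathrm{dep}(\mathrm{tr},c)=\varnothing$. $\longmapsto_d$ is the least reflexive relation such that if $(\mathcal P;\Phi;\varnothing)\overset{\mathrm{tr}}{\longmapsto}_d(\mathcal P';\Phi';\mathcal S')$ and $(\mathcal P';\Phi';\mathcal S')\overset{\mathtt{io}_c(\vec X,\vec w)}{\longmapsto}_{\mathrm c}(\mathcal P'';\Phi'';\mathcal S'')$ (one block, with at least one input) then $(\mathcal P;\Phi;\varnothing)\overset{\mathrm{tr}\cdot\mathtt{io}_c(\vec X,\vec w)}{\longmapsto}_d(\mathcal P'';\Phi'';\mathcal S''\cup\{\vec X\ltimes\mathrm{dep}(\mathrm{tr},c)\})$. $A\sqsubseteq_d^2B$ is defined exactly as $A\sqsubseteq_sB$ with $\longmapsto_d$ in place of $\longmapsto_{\mathrm c}$ and $\mathrm{Sol}^2$ in place of $\mathrm{Sol}$. *)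

theory Defs
  imports Main "HOL-Library.Multiset" "HOL-Library.Infinite_Typeclass"
begin

section \<open>Terms and equational theories\<close>

text \<open>First-order variables, handles and names are the elements of three type parameters; the
  constructors of \<open>atom\<close> make them pairwise disjoint. A signature is a set of symbols with their
  arities, and \<open>terms \<Sigma> S\<close> is the set of terms built over the atoms in \<open>S\<close>.\<close>

datatype ('x, 'w, 'n) atom = Var 'x | Handle 'w | Name 'n

datatype (atoms: 'a, 'f) trm = Atom 'a | App 'f "('a, 'f) trm list"

type_synonym ('f, 'x, 'w, 'n) tm = "(('x, 'w, 'n) atom, 'f) trm"

inductive_set "terms" :: "('f \<times> nat) set \<Rightarrow> 'a set \<Rightarrow> ('a, 'f) trm set"
  for \<Sigma> :: "('f \<times> nat) set" and S :: "'a set" where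
  "a \<in> S \<Longrightarrow> Atom a \<in> terms \<Sigma> S"
| "(f, length ts) \<in> \<Sigma> \<Longrightarrow> (\<And>t. t \<in> set ts \<Longrightarrow> t \<in> terms \<Sigma> S) \<Longrightarrow> App f ts \<in> terms \<Sigma> S"

definition messages :: "('f \<times> nat) set \<Rightarrow> ('f, 'x, 'w, 'n) tm set" where
  "messages \<Sigma> = terms \<Sigma> (range Name \<union> range Var)"

definition ground_terms :: "('f \<times> nat) set \<Rightarrow> ('f, 'x, 'w, 'n) tm set" where
  "ground_terms \<Sigma> = terms \<Sigma> (range Name)"

definition recipes :: "('f \<times> nat) set \<Rightarrow> 'w set \<Rightarrow> ('f, 'x, 'w, 'n) tm set" where
  "recipes \<Sigma> D = terms \<Sigma> (Handle ` D)"

definition tvars :: "('f, 'x, 'w, 'n) tm \<Rightarrow> 'x set" where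
  "tvars t = {x. Var x \<in> atoms t}"

definition thandles :: "('f, 'x, 'w, 'n) tm \<Rightarrow> 'w set" where
  "thandles t = {w. Handle w \<in> atoms t}"

primrec tsubst :: "('a \<Rightarrow> ('a, 'f) trm) \<Rightarrow> ('a, 'f) trm \<Rightarrow> ('a, 'f) trm" where
  "tsubst \<sigma> (Atom a) = \<sigma> a"
| "tsubst \<sigma> (App f ts) = App f (map (tsubst \<sigma>) ts)"

text \<open>Substitutions are partial maps; elements outside the domain are left unchanged.\<close>

definition vsubst :: "('x \<rightharpoonup> ('f, 'x, 'w, 'n) tm) \<Rightarrow> ('f, 'x, 'w, 'n) tm \<Rightarrow> ('f, 'x, 'w, 'n) tm" where
  "vsubst \<sigma> = tsubst (\<lambda>a. case a of
      Var x \<Rightarrow> (case \<sigma> x of Some t \<Rightarrow> t | None \<Rightarrow> Atom a)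
    | _ \<Rightarrow> Atom a)"

definition hsubst :: "('w \<rightharpoonup> ('f, 'x, 'w, 'n) tm) \<Rightarrow> ('f, 'x, 'w, 'n) tm \<Rightarrow> ('f, 'x, 'w, 'n) tm" where
  "hsubst \<Phi> = tsubst (\<lambda>a. case a of
      Handle w \<Rightarrow> (case \<Phi> w of Some t \<Rightarrow> t | None \<Rightarrow> Atom a)
    | _ \<Rightarrow> Atom a)"

text \<open>An equational theory is given by a set of equations between messages; equations without
  names are the usual special case.\<close>

type_synonym ('f, 'x, 'w, 'n) equations = "(('f, 'x, 'w, 'n) tm \<times> ('f, 'x, 'w, 'n) tm) set"

definition equational_theory :: "('f \<times> nat) set \<Rightarrow> ('f, 'x, 'w, 'n) equations \<Rightarrow> bool" where
  "equational_theory \<Sigma> E \<longleftrightarrow> E \<subseteq> messages \<Sigma> \<times> messages \<Sigma>"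

inductive eqE :: "('f \<times> nat) set \<Rightarrow> ('f, 'x, 'w, 'n) equations \<Rightarrow>
    ('f, 'x, 'w, 'n) tm \<Rightarrow> ('f, 'x, 'w, 'n) tm \<Rightarrow> bool"
  for \<Sigma> :: "('f \<times> nat) set" and E :: "('f, 'x, 'w, 'n) equations" where
  ax: "(u, v) \<in> E \<Longrightarrow> ran \<sigma> \<subseteq> terms \<Sigma> UNIV \<Longrightarrow> eqE \<Sigma> E (vsubst \<sigma> u) (vsubst \<sigma> v)"
| refl: "t \<in> terms \<Sigma> UNIV \<Longrightarrow> eqE \<Sigma> E t t"
| sym: "eqE \<Sigma> E s t \<Longrightarrow> eqE \<Sigma> E t s"
| trans: "eqE \<Sigma> E s t \<Longrightarrow> eqE \<Sigma> E t u \<Longrightarrow> eqE \<Sigma> E s u"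
| cong: "(f, length ss) \<in> \<Sigma> \<Longrightarrow> list_all2 (eqE \<Sigma> E) ss ts \<Longrightarrow> eqE \<Sigma> E (App f ss) (App f ts)"


section \<open>Processes and frames\<close>

datatype ('f, 'x, 'w, 'n, 'c) proc =
    Null
  | Cond "('f, 'x, 'w, 'n) tm" "('f, 'x, 'w, 'n) tm" "('f, 'x, 'w, 'n, 'c) proc" "('f, 'x, 'w, 'n, 'c) proc"
  | Input 'c 'x "('f, 'x, 'w, 'n, 'c) proc"
  | Output 'c "('f, 'x, 'w, 'n) tm" "('f, 'x, 'w, 'n, 'c) proc"

primrec basic :: "('f \<times> nat) set \<Rightarrow> 'c \<Rightarrow> ('f, 'x, 'w, 'n, 'c) proc \<Rightarrow> bool" where
  "basic \<Sigma> c Null = True"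
| "basic \<Sigma> c (Cond u v P Q) = (u \<in> messages \<Sigma> \<and> v \<in> messages \<Sigma> \<and> basic \<Sigma> c P \<and> basic \<Sigma> c Q)"
| "basic \<Sigma> c (Input d x P) = (d = c \<and> basic \<Sigma> c P)"
| "basic \<Sigma> c (Output d u P) = (d = c \<and> u \<in> messages \<Sigma> \<and> basic \<Sigma> c P)"

primrec pfv :: "('f, 'x, 'w, 'n, 'c) proc \<Rightarrow> 'x set" where
  "pfv Null = {}"
| "pfv (Cond u v P Q) = tvars u \<union> tvars v \<union> pfv P \<union> pfv Q"
| "pfv (Input c x P) = pfv P - {x}"
| "pfv (Output c u P) = tvars u \<union> pfv P"

primrec pvars :: "('f, 'x, 'w, 'n, 'c) proc \<Rightarrow> 'x set" where
  "pvars Null = {}"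
| "pvars (Cond u v P Q) = tvars u \<union> tvars v \<union> pvars P \<union> pvars Q"
| "pvars (Input c x P) = insert x (pvars P)"
| "pvars (Output c u P) = tvars u \<union> pvars P"

text \<open>Renaming of the free occurrences of \<open>y\<close> to \<open>x\<close>. It is only used for \<open>x\<close> outside \<open>pvars P\<close>,
  so that no inner input can capture \<open>x\<close>.\<close>

primrec prename :: "'x \<Rightarrow> 'x \<Rightarrow> ('f, 'x, 'w, 'n, 'c) proc \<Rightarrow> ('f, 'x, 'w, 'n, 'c) proc" where
  "prename y x Null = Null"
| "prename y x (Cond u v P Q) =
     Cond (vsubst [y \<mapsto> Atom (Var x)] u) (vsubst [y \<mapsto> Atom (Var x)] v) (prename y x P) (prename y x Q)"
| "prename y x (Input c z P) = Input c z (if z = y then P else prename y x P)"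
| "prename y x (Output c u P) = Output c (vsubst [y \<mapsto> Atom (Var x)] u) (prename y x P)"

text \<open>The list \<open>cs\<close> assigns pairwise distinct channels to the elements of the multiset (a
  process without inputs and outputs is a basic process on every channel).\<close>

definition simple_process :: "('f \<times> nat) set \<Rightarrow> ('f, 'x, 'w, 'n, 'c) proc multiset \<Rightarrow> bool" where
  "simple_process \<Sigma> \<P> \<longleftrightarrow> Null \<notin># \<P> \<and>
     (\<exists>cs Ps. \<P> = mset Ps \<and> distinct cs \<and> list_all2 (basic \<Sigma>) cs Ps)"

type_synonym ('f, 'x, 'w, 'n) frame = "'w \<rightharpoonup> ('f, 'x, 'w, 'n) tm"

definition frame :: "('f \<times> nat) set \<Rightarrow> ('f, 'x, 'w, 'n) frame \<Rightarrow> bool" where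
  "frame \<Sigma> \<Phi> \<longleftrightarrow> finite (dom \<Phi>) \<and> ran \<Phi> \<subseteq> messages \<Sigma>"

definition inst_frame :: "('x \<rightharpoonup> ('f, 'x, 'w, 'n) tm) \<Rightarrow> ('f, 'x, 'w, 'n) frame \<Rightarrow> ('f, 'x, 'w, 'n) frame" where
  "inst_frame \<sigma> \<Phi> = (\<lambda>w. map_option (vsubst \<sigma>) (\<Phi> w))"

type_synonym ('f, 'x, 'w, 'n, 'c) ext_proc =
  "('f, 'x, 'w, 'n, 'c) proc multiset \<times> ('f, 'x, 'w, 'n) frame"

definition ext_simple_process :: "('f \<times> nat) set \<Rightarrow> ('f, 'x, 'w, 'n, 'c) ext_proc \<Rightarrow> bool" where
  "ext_simple_process \<Sigma> A \<longleftrightarrow> (case A of (\<P>, \<Phi>) \<Rightarrow>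
     simple_process \<Sigma> \<P> \<and> frame \<Sigma> \<Phi> \<and>
     (\<forall>P \<in># \<P>. pfv P = {}) \<and> ran \<Phi> \<subseteq> ground_terms \<Sigma>)"

definition static_equiv :: "('f \<times> nat) set \<Rightarrow> ('f, 'x, 'w, 'n) equations \<Rightarrow>
    ('f, 'x, 'w, 'n) frame \<Rightarrow> ('f, 'x, 'w, 'n) frame \<Rightarrow> bool" where
  "static_equiv \<Sigma> E \<Phi> \<Psi> \<longleftrightarrow> dom \<Phi> = dom \<Psi> \<and>
     (\<forall>M \<in> recipes \<Sigma> (dom \<Phi>). \<forall>N \<in> recipes \<Sigma> (dom \<Phi>).
        eqE \<Sigma> E (hsubst \<Phi> M) (hsubst \<Phi> N) \<longleftrightarrow> eqE \<Sigma> E (hsubst \<Psi> M) (hsubst \<Psi> N))"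


section \<open>Constraint systems\<close>

text \<open>\<open>Ded D X x\<close> is the deducibility constraint on \<open>x\<close> with recipe variable \<open>X\<close> over the handles
  \<open>D\<close>. The last constructor is the dependency constraint; its right-hand side matters only as a
  set of handles.\<close>

datatype ('f, 'x, 'w, 'n, 'y) constr =
    Ded "'w set" 'y 'x
  | Eq "('f, 'x, 'w, 'n) tm" "('f, 'x, 'w, 'n) tm"
  | Neq "('f, 'x, 'w, 'n) tm" "('f, 'x, 'w, 'n) tm"
  | Dep "'y list" "'w set"

primrec cvars :: "('f, 'x, 'w, 'n, 'y) constr \<Rightarrow> 'x set" where
  "cvars (Ded D X x) = {x}"
| "cvars (Eq u v) = tvars u \<union> tvars v"
| "cvars (Neq u v) = tvars u \<union> tvars v"
| "cvars (Dep Xs W) = {}"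

primrec chandles :: "('f, 'x, 'w, 'n, 'y) constr \<Rightarrow> 'w set" where
  "chandles (Ded D X x) = D"
| "chandles (Eq u v) = thandles u \<union> thandles v"
| "chandles (Neq u v) = thandles u \<union> thandles v"
| "chandles (Dep Xs W) = W"

primrec cvars2 :: "('f, 'x, 'w, 'n, 'y) constr \<Rightarrow> 'y set" where
  "cvars2 (Ded D X x) = {X}"
| "cvars2 (Eq u v) = {}"
| "cvars2 (Neq u v) = {}"
| "cvars2 (Dep Xs W) = set Xs"

definition fvars :: "('f, 'x, 'w, 'n) frame \<Rightarrow> ('f, 'x, 'w, 'n, 'y) constr set \<Rightarrow> 'x set" where
  "fvars \<Phi> S = (\<Union>u \<in> ran \<Phi>. tvars u) \<union> (\<Union>k \<in> S. cvars k)"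

definition fvars2 :: "('f, 'x, 'w, 'n, 'y) constr set \<Rightarrow> 'y set" where
  "fvars2 S = (\<Union>k \<in> S. cvars2 k)"

definition depends :: "('f, 'x, 'w, 'n) frame \<Rightarrow> ('f, 'x, 'w, 'n, 'y) constr set \<Rightarrow> ('x \<times> 'x) set" where
  "depends \<Phi> S = {(x, y). \<exists>D X. Ded D X x \<in> S \<and> (\<exists>w \<in> D. \<exists>u. \<Phi> w = Some u \<and> y \<in> tvars u)}"

text \<open>Removal of the dependency constraints.\<close>

definition strip :: "('f, 'x, 'w, 'n, 'y) constr set \<Rightarrow> ('f, 'x, 'w, 'n, 'y) constr set" where
  "strip S = {k \<in> S. \<forall>Xs W. k \<noteq> Dep Xs W}"

definition well_formed :: "('f, 'x, 'w, 'n) frame \<Rightarrow> ('f, 'x, 'w, 'n, 'y) constr set \<Rightarrow> bool" where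
  "well_formed \<Phi> S \<longleftrightarrow>
     (\<forall>x \<in> fvars \<Phi> S. \<exists>!k. k \<in> S \<and> (\<exists>D X. k = Ded D X x)) \<and>
     (\<forall>X \<in> fvars2 S. \<exists>!k. k \<in> S \<and> (\<exists>D x. k = Ded D X x)) \<and>
     acyclic (depends \<Phi> S)"

text \<open>\<open>first_order_sol \<Sigma> E \<Phi> S \<theta> \<lambda>\<close>: the ground substitution \<open>\<lambda>\<close> witnesses that \<open>\<theta>\<close>
  is a solution.\<close>

definition first_order_sol :: "('f \<times> nat) set \<Rightarrow> ('f, 'x, 'w, 'n) equations \<Rightarrow>
    ('f, 'x, 'w, 'n) frame \<Rightarrow> ('f, 'x, 'w, 'n, 'y) constr set \<Rightarrow>
    ('y \<rightharpoonup> ('f, 'x, 'w, 'n) tm) \<Rightarrow> ('x \<rightharpoonup> ('f, 'x, 'w, 'n) tm) \<Rightarrow> bool" where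
  "first_order_sol \<Sigma> E \<Phi> S \<theta> l \<longleftrightarrow>
     dom l = fvars \<Phi> S \<and> ran l \<subseteq> ground_terms \<Sigma> \<and>
     (\<forall>D X x. Ded D X x \<in> S \<longrightarrow>
        eqE \<Sigma> E (hsubst (inst_frame l \<Phi>) (the (\<theta> X))) (vsubst l (Atom (Var x)))) \<and>
     (\<forall>u v. Eq u v \<in> S \<longrightarrow> eqE \<Sigma> E (vsubst l u) (vsubst l v)) \<and>
     (\<forall>u v. Neq u v \<in> S \<longrightarrow> \<not> eqE \<Sigma> E (vsubst l u) (vsubst l v))"

definition Sol :: "('f \<times> nat) set \<Rightarrow> ('f, 'x, 'w, 'n) equations \<Rightarrow>
    ('f, 'x, 'w, 'n) frame \<Rightarrow> ('f, 'x, 'w, 'n, 'y) constr set \<Rightarrow>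
    ('y \<rightharpoonup> ('f, 'x, 'w, 'n) tm) set" where
  "Sol \<Sigma> E \<Phi> S = {\<theta>. dom \<theta> = fvars2 S \<and>
     (\<forall>D X x. Ded D X x \<in> S \<longrightarrow> the (\<theta> X) \<in> recipes \<Sigma> D) \<and>
     (\<exists>l. first_order_sol \<Sigma> E \<Phi> S \<theta> l)}"

text \<open>The first-order substitution associated to a solution; it is unique only modulo \<open>eqE\<close>, which
  static equivalence does not distinguish.\<close>

definition lambda_of :: "('f \<times> nat) set \<Rightarrow> ('f, 'x, 'w, 'n) equations \<Rightarrow>
    ('f, 'x, 'w, 'n) frame \<Rightarrow> ('f, 'x, 'w, 'n, 'y) constr set \<Rightarrow>
    ('y \<rightharpoonup> ('f, 'x, 'w, 'n) tm) \<Rightarrow> ('x \<rightharpoonup> ('f, 'x, 'w, 'n) tm)" where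
  "lambda_of \<Sigma> E \<Phi> S \<theta> = (SOME l. first_order_sol \<Sigma> E \<Phi> S \<theta> l)"

definition sat_dep :: "('y \<rightharpoonup> ('f, 'x, 'w, 'n) tm) \<Rightarrow> 'y list \<Rightarrow> 'w set \<Rightarrow> bool" where
  "sat_dep \<theta> Xs W \<longleftrightarrow> W = {} \<or> (\<exists>X \<in> set Xs. \<exists>w \<in> W. w \<in> thandles (the (\<theta> X)))"

definition Sol2 :: "('f \<times> nat) set \<Rightarrow> ('f, 'x, 'w, 'n) equations \<Rightarrow>
    ('f, 'x, 'w, 'n) frame \<Rightarrow> ('f, 'x, 'w, 'n, 'y) constr set \<Rightarrow>
    ('y \<rightharpoonup> ('f, 'x, 'w, 'n) tm) set" where
  "Sol2 \<Sigma> E \<Phi> S = {\<theta> \<in> Sol \<Sigma> E \<Phi> (strip S). \<forall>Xs W. Dep Xs W \<in> S \<longrightarrow> sat_dep \<theta> Xs W}"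


section \<open>Compressed symbolic semantics\<close>

datatype ('c, 'y, 'w) label = In 'c 'y | Out 'c 'w | Tau

type_synonym ('p, 'f, 'x, 'w, 'n, 'y) sym = "'p \<times> ('f, 'x, 'w, 'n) frame \<times> ('f, 'x, 'w, 'n, 'y) constr set"

text \<open>Freshness of \<open>x\<close> also covers the bound variables of the process, see \<open>prename\<close>.\<close>

inductive sym_step :: "(('f, 'x, 'w, 'n, 'c) proc, 'f, 'x, 'w, 'n, 'y) sym \<Rightarrow> ('c, 'y, 'w) label \<Rightarrow>
    (('f, 'x, 'w, 'n, 'c) proc, 'f, 'x, 'w, 'n, 'y) sym \<Rightarrow> bool" where
  "x \<notin> pvars (Input c y P) \<union> fvars \<Phi> S \<Longrightarrow> X \<notin> fvars2 S \<Longrightarrow>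
     sym_step (Input c y P, \<Phi>, S) (In c X) (prename y x P, \<Phi>, S \<union> {Ded (dom \<Phi>) X x})"
| "w \<notin> dom \<Phi> \<union> (\<Union>k \<in> S. chandles k) \<Longrightarrow>
     sym_step (Output c u P, \<Phi>, S) (Out c w) (P, \<Phi>(w \<mapsto> u), S)"
| "sym_step (Cond u v P Q, \<Phi>, S) Tau (P, \<Phi>, S \<union> {Eq u v})"
| "sym_step (Cond u v P Q, \<Phi>, S) Tau (Q, \<Phi>, S \<union> {Neq u v})"

datatype focus = IPlus | IStar | OStar

text \<open>The target process \<open>None\<close> is the special symbol \<open>\<bottom>\<close> of an improper block.\<close>

inductive focused :: "focus \<Rightarrow> (('f, 'x, 'w, 'n, 'c) proc, 'f, 'x, 'w, 'n, 'y) sym \<Rightarrow>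
    ('c, 'y, 'w) label list \<Rightarrow> (('f, 'x, 'w, 'n, 'c) proc option, 'f, 'x, 'w, 'n, 'y) sym \<Rightarrow> bool" where
  In: "sym_step K (In c X) K' \<Longrightarrow> focused IStar K' tr K'' \<Longrightarrow> f \<in> {IStar, IPlus} \<Longrightarrow>
     focused f K (In c X # tr) K''"
| Out: "sym_step K (Out c w) K' \<Longrightarrow> focused OStar K' tr K'' \<Longrightarrow> f \<in> {IStar, OStar} \<Longrightarrow>
     focused f K (Out c w # tr) K''"
| Tau: "sym_step K Tau K' \<Longrightarrow> focused f K' tr K'' \<Longrightarrow> focused f K tr K''"
| Proper: "P = Null \<or> (\<exists>c x P'. P = Input c x P') \<Longrightarrow>
     focused OStar (P, \<Phi>, S) [] (Some P, \<Phi>, S)"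
| Improper: "focused IStar (Null, \<Phi>, S) [] (None, \<Phi>, S)"

inductive compressed :: "(('f, 'x, 'w, 'n, 'c) proc multiset, 'f, 'x, 'w, 'n, 'y) sym \<Rightarrow>
    ('c, 'y, 'w) label list \<Rightarrow> (('f, 'x, 'w, 'n, 'c) proc multiset, 'f, 'x, 'w, 'n, 'y) sym \<Rightarrow> bool" where
  refl: "compressed K [] K"
| trans: "compressed K tr K' \<Longrightarrow> compressed K' tr' K'' \<Longrightarrow> compressed K (tr @ tr') K''"
| proper: "focused IPlus (Q, \<Phi>, S) tr (Some Q', \<Phi>', S') \<Longrightarrow>
     compressed ({#Q#} + \<P>, \<Phi>, S) tr ((if Q' = Null then {#} else {#Q'#}) + \<P>, \<Phi>', S')"
| improper: "focused IPlus (Q, \<Phi>, S) tr (None, \<Phi>', S') \<Longrightarrow>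
     compressed ({#Q#} + \<P>, \<Phi>, S) tr ({#}, \<Phi>', S')"


section \<open>Reduced symbolic semantics\<close>

type_synonym ('c, 'y, 'w) block = "'c \<times> 'y list \<times> 'w list"

fun io :: "('c, 'y, 'w) block \<Rightarrow> ('c, 'y, 'w) label list" where
  "io (c, Xs, ws) = map (In c) Xs @ map (Out c) ws"

text \<open>There is at most one index \<open>k\<close> as below, and \<open>dep bs c\<close> is empty when there is none.\<close>

definition dep :: "('c::linorder, 'y, 'w) block list \<Rightarrow> 'c \<Rightarrow> 'w set" where
  "dep bs c = {w. \<exists>k < length bs. c < fst (bs ! k) \<and>
      (\<forall>i. k < i \<and> i < length bs \<longrightarrow> fst (bs ! i) < c) \<and>
      (\<exists>i. k \<le> i \<and> i < length bs \<and> w \<in> set (snd (snd (bs ! i))))}"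

inductive reduced_blocks :: "(('f, 'x, 'w, 'n, 'c::linorder) proc multiset, 'f, 'x, 'w, 'n, 'y) sym \<Rightarrow>
    ('c, 'y, 'w) block list \<Rightarrow> (('f, 'x, 'w, 'n, 'c) proc multiset, 'f, 'x, 'w, 'n, 'y) sym \<Rightarrow> bool" where
  refl: "reduced_blocks K [] K"
| step: "reduced_blocks (\<P>, \<Phi>, {}) bs (\<P>', \<Phi>', S') \<Longrightarrow>
     compressed (\<P>', \<Phi>', S') (io (c, Xs, ws)) (\<P>'', \<Phi>'', S'') \<Longrightarrow> Xs \<noteq> [] \<Longrightarrow>
     reduced_blocks (\<P>, \<Phi>, {}) (bs @ [(c, Xs, ws)]) (\<P>'', \<Phi>'', S'' \<union> {Dep Xs (dep bs c)})"

text \<open>A block without outputs empties the process, hence can only come last; so the decomposition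
  of a trace into blocks is unique.\<close>

definition reduced :: "(('f, 'x, 'w, 'n, 'c::linorder) proc multiset, 'f, 'x, 'w, 'n, 'y) sym \<Rightarrow>
    ('c, 'y, 'w) label list \<Rightarrow> (('f, 'x, 'w, 'n, 'c) proc multiset, 'f, 'x, 'w, 'n, 'y) sym \<Rightarrow> bool" where
  "reduced K tr K' \<longleftrightarrow> (\<exists>bs. tr = concat (map io bs) \<and> reduced_blocks K bs K')"


section \<open>Trace inclusions\<close>

text \<open>The associated first-order substitutions always refer to the system without dependency
  constraints; in the compressed semantics there are none and \<open>strip\<close> is the identity.\<close>

definition trace_inclusion ::
  "('f \<times> nat) set \<Rightarrow> ('f, 'x, 'w, 'n) equations \<Rightarrow>
   ((('f, 'x, 'w, 'n, 'c) proc multiset, 'f, 'x, 'w, 'n, 'y) sym \<Rightarrow> ('c, 'y, 'w) label list \<Rightarrow>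
     (('f, 'x, 'w, 'n, 'c) proc multiset, 'f, 'x, 'w, 'n, 'y) sym \<Rightarrow> bool) \<Rightarrow>
   (('f, 'x, 'w, 'n) frame \<Rightarrow> ('f, 'x, 'w, 'n, 'y) constr set \<Rightarrow> ('y \<rightharpoonup> ('f, 'x, 'w, 'n) tm) set) \<Rightarrow>
   ('f, 'x, 'w, 'n, 'c) ext_proc \<Rightarrow> ('f, 'x, 'w, 'n, 'c) ext_proc \<Rightarrow> bool" where
  "trace_inclusion \<Sigma> E step sol A B \<longleftrightarrow> (case (A, B) of ((\<P>, \<Phi>), (\<Q>, \<Psi>)) \<Rightarrow>
     \<forall>tr \<P>' \<Phi>' S\<^sub>A \<theta>. step (\<P>, \<Phi>, {}) tr (\<P>', \<Phi>', S\<^sub>A) \<and> \<theta> \<in> sol \<Phi>' S\<^sub>A \<longrightarrow>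
       (\<exists>\<Q>' \<Psi>' S\<^sub>B. step (\<Q>, \<Psi>, {}) tr (\<Q>', \<Psi>', S\<^sub>B) \<and> \<theta> \<in> sol \<Psi>' S\<^sub>B \<and>
          static_equiv \<Sigma> E (inst_frame (lambda_of \<Sigma> E \<Phi>' (strip S\<^sub>A) \<theta>) \<Phi>')
                           (inst_frame (lambda_of \<Sigma> E \<Psi>' (strip S\<^sub>B) \<theta>) \<Psi>')))"

text \<open>The phantom argument of type \<open>'y itself\<close> fixes the type of second-order variables.\<close>

definition symbolic_inclusion :: "'y itself \<Rightarrow> ('f \<times> nat) set \<Rightarrow> ('f, 'x, 'w, 'n) equations \<Rightarrow>
    ('f, 'x, 'w, 'n, 'c) ext_proc \<Rightarrow> ('f, 'x, 'w, 'n, 'c) ext_proc \<Rightarrow> bool" where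
  "symbolic_inclusion _ \<Sigma> E = trace_inclusion \<Sigma> E
     (compressed :: (('f, 'x, 'w, 'n, 'c) proc multiset, 'f, 'x, 'w, 'n, 'y) sym \<Rightarrow> _) (Sol \<Sigma> E)"

definition reduced_inclusion :: "'y itself \<Rightarrow> ('f \<times> nat) set \<Rightarrow> ('f, 'x, 'w, 'n) equations \<Rightarrow>
    ('f, 'x, 'w, 'n, 'c::linorder) ext_proc \<Rightarrow> ('f, 'x, 'w, 'n, 'c) ext_proc \<Rightarrow> bool" where
  "reduced_inclusion _ \<Sigma> E = trace_inclusion \<Sigma> E
     (reduced :: (('f, 'x, 'w, 'n, 'c) proc multiset, 'f, 'x, 'w, 'n, 'y) sym \<Rightarrow> _) (Sol2 \<Sigma> E)"

section \<open>Well-formedness is preserved\<close>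

text \<open>Symbolic processes and their constraint systems are required to be well-formed. The
  definitions above do not impose this separately, since it holds for every system reachable from
  an extended simple process.\<close>

definition symbolic_process :: "(('f, 'x, 'w, 'n, 'c) proc multiset, 'f, 'x, 'w, 'n, 'y) sym \<Rightarrow> bool" where
  "symbolic_process K \<longleftrightarrow> (case K of (\<P>, \<Phi>, S) \<Rightarrow>
     well_formed \<Phi> (strip S) \<and> (\<forall>P \<in># \<P>. pfv P \<subseteq> (\<Union>k \<in> strip S. cvars k)))"

lemma tvars_Atom [simp]: "tvars (Atom a) = {x. a = Var x}"
  by (auto simp: tvars_def)

lemma tvars_App [simp]: "tvars (App g ts) = (\<Union>t \<in> set ts. tvars t)"
  by (auto simp: tvars_def)

lemma tvars_rename: "tvars (vsubst [y \<mapsto> Atom (Var x)] t) \<subseteq> insert x (tvars t - {y})"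
  by (induction t) (auto simp: vsubst_def split: atom.splits if_splits)

lemma pfv_prename: "pfv (prename y x P) \<subseteq> insert x (pfv P - {y})"
proof (induction P)
  case (Cond u v P Q)
  then show ?case using tvars_rename[of y x u] tvars_rename[of y x v] by auto
next
  case (Output c u P)
  then show ?case using tvars_rename[of y x u] by auto
qed auto

lemma strip_simps [simp]:
  "strip {} = {}"
  "strip (insert (Ded D X x) S) = insert (Ded D X x) (strip S)"
  "strip (insert (Eq u v) S) = insert (Eq u v) (strip S)"
  "strip (insert (Neq u v) S) = insert (Neq u v) (strip S)"
  "strip (insert (Dep Xs W) S) = strip S"
  by (auto simp: strip_def)

lemma acyclic_fresh:
  assumes "acyclic R" "x \<notin> Range R" "x \<notin> Y"
  shows "acyclic (R \<union> {x} \<times> Y)"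
proof -
  have *: "a = x \<or> (a, b) \<in> R\<^sup>+" if "(a, b) \<in> (R \<union> {x} \<times> Y)\<^sup>+" for a b
    using that
  proof (induction rule: trancl_induct)
    case (base b)
    then show ?case by auto
  next
    case (step b c)
    have "b \<noteq> x"
    proof -
      have "b \<in> Range (R \<union> {x} \<times> Y)"
        using step.hyps(1) by (metis Range.intros trancl_range)
      then show ?thesis using assms by auto
    qed
    then show ?case using step by (auto intro: trancl_into_trancl)
  qed
  have "x \<notin> Range ((R \<union> {x} \<times> Y)\<^sup>+)"
    unfolding trancl_range using assms by auto
  then show ?thesis
    using * assms(1) unfolding acyclic_def by blast
qed

definition wf_sym :: "(('f, 'x, 'w, 'n, 'c) proc, 'f, 'x, 'w, 'n, 'y) sym \<Rightarrow> bool" where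
  "wf_sym K \<longleftrightarrow> (case K of (P, \<Phi>, S) \<Rightarrow>
     well_formed \<Phi> (strip S) \<and> pfv P \<subseteq> (\<Union>k \<in> strip S. cvars k))"

lemma sym_step_mono:
  assumes "sym_step K a K'"
  shows "snd (snd K) \<subseteq> snd (snd K')"
  using assms by cases auto

lemma well_formed_Eq:
  assumes "well_formed \<Phi> S" "k = Eq u v \<or> k = Neq u v" "tvars u \<union> tvars v \<subseteq> (\<Union>k \<in> S. cvars k)"
  shows "well_formed \<Phi> (insert k S)"
proof -
  have "fvars \<Phi> (insert k S) = fvars \<Phi> S" "fvars2 (insert k S) = fvars2 S"
    "depends \<Phi> (insert k S) = depends \<Phi> S"
    using assms(2,3) by (force simp: fvars_def fvars2_def depends_def)+
  moreover have "l \<in> insert k S \<and> (\<exists>D X. l = Ded D X x) \<longleftrightarrow> l \<in> S \<and> (\<exists>D X. l = Ded D X x)"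
    "l \<in> insert k S \<and> (\<exists>D x. l = Ded D X x) \<longleftrightarrow> l \<in> S \<and> (\<exists>D x. l = Ded D X x)" for l x X
    using assms(2) by auto
  ultimately show ?thesis
    using assms(1) unfolding well_formed_def by simp
qed

lemma sym_step_wf:
  assumes "sym_step K a K'" "wf_sym K"
  shows "wf_sym K'"
  using assms(1)
proof cases
  case (1 x c y P \<Phi> S X)
  let ?S = "strip S" and ?k = "Ded (dom \<Phi>) X x"
  have wf: "well_formed \<Phi> ?S" and fv: "pfv P - {y} \<subseteq> (\<Union>k \<in> ?S. cvars k)"
    using assms(2) 1 by (auto simp: wf_sym_def)
  have x: "x \<notin> fvars \<Phi> ?S" and X: "X \<notin> fvars2 ?S"
    using 1 by (auto simp: fvars_def fvars2_def strip_def)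
  have fvs: "fvars \<Phi> (insert ?k ?S) = insert x (fvars \<Phi> ?S)" "fvars2 (insert ?k ?S) = insert X (fvars2 ?S)"
    by (auto simp: fvars_def fvars2_def)
  have new: "Ded D Y x \<notin> ?S" "Ded D X z \<notin> ?S" for D Y z
    using x X by (force simp: fvars_def fvars2_def)+
  have u1: "\<exists>!k. k \<in> insert ?k ?S \<and> (\<exists>D X. k = Ded D X z)" if "z \<in> insert x (fvars \<Phi> ?S)" for z
  proof (cases "z = x")
    case True
    then show ?thesis using new by (intro ex1I[of _ ?k]) auto
  next
    case False
    then have "\<exists>!k. k \<in> ?S \<and> (\<exists>D X. k = Ded D X z)"
      using wf that by (simp add: well_formed_def)
    moreover have "k \<in> insert ?k ?S \<and> (\<exists>D X. k = Ded D X z) \<longleftrightarrow> k \<in> ?S \<and> (\<exists>D X. k = Ded D X z)" for k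
      using False by auto
    ultimately show ?thesis by simp
  qed
  have u2: "\<exists>!k. k \<in> insert ?k ?S \<and> (\<exists>D x. k = Ded D Z x)" if "Z \<in> insert X (fvars2 ?S)" for Z
  proof (cases "Z = X")
    case True
    then show ?thesis using new by (intro ex1I[of _ ?k]) auto
  next
    case False
    then have "\<exists>!k. k \<in> ?S \<and> (\<exists>D x. k = Ded D Z x)"
      using wf that by (simp add: well_formed_def)
    moreover have "k \<in> insert ?k ?S \<and> (\<exists>D x. k = Ded D Z x) \<longleftrightarrow> k \<in> ?S \<and> (\<exists>D x. k = Ded D Z x)" for k
      using False by auto
    ultimately show ?thesis by simp
  qed
  have "depends \<Phi> (insert ?k ?S) = depends \<Phi> ?S \<union> {x} \<times> (\<Union>u \<in> ran \<Phi>. tvars u)"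
    by (auto simp: depends_def ran_def)
  moreover have "acyclic \<dots>"
    using wf x by (intro acyclic_fresh) (auto simp: well_formed_def depends_def fvars_def intro: ranI)
  ultimately have "well_formed \<Phi> (insert ?k ?S)"
    unfolding well_formed_def fvs using u1 u2 by auto
  moreover have "pfv (prename y x P) \<subseteq> insert x (\<Union>k \<in> ?S. cvars k)"
    using pfv_prename[of y x P] fv by blast
  ultimately show ?thesis using 1 by (simp add: wf_sym_def)
next
  case (2 w \<Phi> S c u P)
  let ?S = "strip S"
  have wf: "well_formed \<Phi> ?S" and fv: "tvars u \<union> pfv P \<subseteq> (\<Union>k \<in> ?S. cvars k)"
    using assms(2) 2 by (auto simp: wf_sym_def)
  have "w \<notin> dom \<Phi>" using 2 by auto
  then have ran: "ran (\<Phi>(w \<mapsto> u)) = insert u (ran \<Phi>)"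
    by (simp add: domIff)
  have "fvars (\<Phi>(w \<mapsto> u)) ?S = fvars \<Phi> ?S"
    unfolding fvars_def ran using fv by auto
  moreover have "depends (\<Phi>(w \<mapsto> u)) ?S = depends \<Phi> ?S"
  proof -
    have D: "w \<notin> D" if "Ded D X x \<in> ?S" for D X x
      using that 2 by (force simp: strip_def)
    have *: "(\<exists>v \<in> D. \<exists>t. (\<Phi>(w \<mapsto> u)) v = Some t \<and> y \<in> tvars t) \<longleftrightarrow>
        (\<exists>v \<in> D. \<exists>t. \<Phi> v = Some t \<and> y \<in> tvars t)" if "w \<notin> D" for D y
      using that by (intro bex_cong) auto
    have "(Ded D X x \<in> ?S \<and> (\<exists>v \<in> D. \<exists>t. (\<Phi>(w \<mapsto> u)) v = Some t \<and> y \<in> tvars t)) \<longleftrightarrow>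
        (Ded D X x \<in> ?S \<and> (\<exists>v \<in> D. \<exists>t. \<Phi> v = Some t \<and> y \<in> tvars t))" for D X x y
      by (rule conj_cong[OF HOL.refl *[OF D]])
    then show ?thesis by (simp only: depends_def)
  qed
  ultimately have "well_formed (\<Phi>(w \<mapsto> u)) ?S"
    using wf unfolding well_formed_def by simp
  then show ?thesis using 2 fv by (simp add: wf_sym_def)
next
  case (3 u v P Q \<Phi> S)
  then show ?thesis using assms(2) well_formed_Eq[of \<Phi> "strip S" "Eq u v" u v]
    by (auto simp: wf_sym_def)
next
  case (4 u v P Q \<Phi> S)
  then show ?thesis using assms(2) well_formed_Eq[of \<Phi> "strip S" "Neq u v" u v]
    by (auto simp: wf_sym_def)
qed

lemma focused_wf:
  assumes "focused f K tr K'" "wf_sym K"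
  shows "snd (snd K) \<subseteq> snd (snd K') \<and> well_formed (fst (snd K')) (strip (snd (snd K'))) \<and>
    (\<forall>P. fst K' = Some P \<longrightarrow> pfv P \<subseteq> (\<Union>k \<in> strip (snd (snd K')). cvars k))"
  using assms
proof (induction rule: focused.induct)
  case (In K c X K' tr K'' f)
  note IH = In.IH[OF sym_step_wf[OF In.hyps(1) In.prems]]
  show ?case using IH order_trans[OF sym_step_mono[OF In.hyps(1)] conjunct1[OF IH]] by simp
next
  case (Out K c w K' tr K'' f)
  note IH = Out.IH[OF sym_step_wf[OF Out.hyps(1) Out.prems]]
  show ?case using IH order_trans[OF sym_step_mono[OF Out.hyps(1)] conjunct1[OF IH]] by simp
next
  case (Tau K K' f tr K'')
  note IH = Tau.IH[OF sym_step_wf[OF Tau.hyps(1) Tau.prems]]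
  show ?case using IH order_trans[OF sym_step_mono[OF Tau.hyps(1)] conjunct1[OF IH]] by simp
qed (auto simp: wf_sym_def)

lemma compressed_symbolic_process:
  assumes "compressed K tr K'" "symbolic_process K"
  shows "symbolic_process K'"
  using assms
proof (induction rule: compressed.induct)
  case (proper Q \<Phi> S tr Q' \<Phi>' S' \<P>)
  then have "wf_sym (Q, \<Phi>, S)"
    by (simp add: wf_sym_def symbolic_process_def)
  from focused_wf[OF proper.hyps this]
  have "S \<subseteq> S'" "well_formed \<Phi>' (strip S')" "pfv Q' \<subseteq> (\<Union>k \<in> strip S'. cvars k)"
    by auto
  moreover from \<open>S \<subseteq> S'\<close> have "(\<Union>k \<in> strip S. cvars k) \<subseteq> (\<Union>k \<in> strip S'. cvars k)"
    by (auto simp: strip_def)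
  ultimately show ?case
    using proper.prems by (force simp: symbolic_process_def)
next
  case (improper Q \<Phi> S tr \<Phi>' S' \<P>)
  then have "wf_sym (Q, \<Phi>, S)"
    by (simp add: wf_sym_def symbolic_process_def)
  from focused_wf[OF improper.hyps this] show ?case
    by (simp add: symbolic_process_def)
qed blast+

lemma reduced_symbolic_process:
  assumes "reduced K tr K'" "symbolic_process K"
  shows "symbolic_process K'"
proof -
  obtain bs where "reduced_blocks K bs K'"
    using assms(1) by (auto simp: reduced_def)
  then show ?thesis
    using assms(2)
  proof (induction rule: reduced_blocks.induct)
    case (step \<P> \<Phi> bs \<P>' \<Phi>' S' c Xs ws \<P>'' \<Phi>'' S'')
    then have "symbolic_process (\<P>'', \<Phi>'', S'')"
      using compressed_symbolic_process by blast
    then show ?case by (simp add: symbolic_process_def)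
  qed
qed

lemma ext_simple_symbolic_process:
  fixes \<P> :: "('f, 'x, 'w, 'n, 'c) proc multiset"
  assumes "ext_simple_process \<Sigma> (\<P>, \<Phi>)"
  shows "symbolic_process (\<P>, \<Phi>, {})"
proof -
  have "atoms t \<subseteq> S" if "t \<in> terms \<Sigma> S"
    for t :: "('f, 'x, 'w, 'n) tm" and S :: "('x, 'w, 'n) atom set"
    using that by induction auto
  then have "tvars t = {}" if "t \<in> ground_terms \<Sigma>" for t :: "('f, 'x, 'w, 'n) tm"
    using that by (fastforce simp: ground_terms_def tvars_def)
  then have "\<forall>u \<in> ran \<Phi>. tvars u = {}"
    using assms by (fastforce simp: ext_simple_process_def)
  then show ?thesis
    using assms
    by (simp add: symbolic_process_def ext_simple_process_def well_formed_def fvars_def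
        fvars2_def depends_def acyclic_def)
qed

end

theory Submission
  imports Defs "HOL-Library.List_Lexorder"
begin

text \<open>For a fixed assignment of recipes, an execution of a simple process is deterministic: choosing for
  every first-order variable literally the term computed by its recipe turns symbolic executions
  with a solution into ground executions. There, two adjacent blocks on different channels commute
  when neither uses the outputs of the other. Among the permutations of an execution of \<open>A\<close>, the one
  whose list of channels is lexicographically minimal satisfies all dependency constraints; it is
  matched by \<open>B\<close>, and permuted back. An improper block can only come last. It is moved to
  the left past the blocks of this permutation that follow it, and the resulting shorter execution of \<open>B\<close>
  is combined with the one without the improper block, which is possible by determinism.\<close>

section \<open>Terms\<close>

text \<open>Symbolic executions cannot be permuted as they stand. Reordering blocks changes the
  handle sets recorded in the deducibility constraints and the freshly chosen first-order variables,
  and a solution fixes \<open>\<lambda>\<close> only modulo the equational theory. After the passage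
  to literal ground terms, a configuration is a function of the block list and
  \<open>\<theta>\<close>, so executions can be compared, reordered and merged by plain equality;
  the difference to \<open>lambda_of\<close> is invisible to static equivalence. Dependency
  constraints also depend on nothing but the block list and \<open>\<theta>\<close>: a matching
  execution of \<open>B\<close> over the same blocks satisfies them as soon as that of
  \<open>A\<close> does, so they only restrict which executions of \<open>A\<close> have to be
  matched. The obstacle is the improper block \<open>b\<close>. Once it is anticipated to the end of
  \<open>p\<close>, nothing can follow it, so \<open>p @ b # s\<close> is not an execution, and
  permutation alone does not reach the original trace. Hence the inclusion is applied twice, to
  \<open>p @ [b]\<close> and to \<open>p @ s\<close>: the first shows that \<open>B\<close> can
  execute \<open>b\<close> after \<open>p\<close>, the second provides the remaining blocks and the
  static equivalence.\<close>

lemma atoms_terms: "t \<in> terms \<Sigma> S \<Longrightarrow> atoms t \<subseteq> S"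
  by (induction rule: terms.induct) auto

lemma terms_atoms: "t \<in> terms \<Sigma> S \<Longrightarrow> atoms t \<subseteq> T \<Longrightarrow> t \<in> terms \<Sigma> T"
proof (induction rule: terms.induct)
  case (2 f ts)
  then show ?case by (intro terms.intros) auto
qed (auto intro: terms.intros)

lemma terms_UNIV: "t \<in> terms \<Sigma> S \<Longrightarrow> t \<in> terms \<Sigma> UNIV"
  by (rule terms_atoms) auto

lemma tsubst_cong: "(\<And>a. a \<in> atoms t \<Longrightarrow> \<sigma> a = \<tau> a) \<Longrightarrow> tsubst \<sigma> t = tsubst \<tau> t"
  by (induction t) auto

lemma tsubst_Atom: "tsubst Atom t = t"
  by (induction t) (auto intro: map_idI)

lemma tsubst_tsubst: "tsubst \<sigma> (tsubst \<tau> t) = tsubst (\<lambda>a. tsubst \<sigma> (\<tau> a)) t"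
  by (induction t) auto

lemma tsubst_terms:
  "t \<in> terms \<Sigma> S \<Longrightarrow> (\<And>a. a \<in> atoms t \<Longrightarrow> \<sigma> a \<in> terms \<Sigma> T) \<Longrightarrow> tsubst \<sigma> t \<in> terms \<Sigma> T"
proof (induction rule: terms.induct)
  case (2 f ts)
  have "tsubst \<sigma> t \<in> terms \<Sigma> T" if "t \<in> set ts" for t
    using that by (intro "2.IH") (auto intro!: "2.prems")
  then show ?case using "2.hyps"(1) by (auto intro!: terms.intros(2))
qed auto

lemma eqE_tsubst:
  "t \<in> terms \<Sigma> S \<Longrightarrow> (\<And>a. a \<in> atoms t \<Longrightarrow> eqE \<Sigma> E (\<sigma> a) (\<tau> a)) \<Longrightarrow>
     eqE \<Sigma> E (tsubst \<sigma> t) (tsubst \<tau> t)"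
proof (induction rule: terms.induct)
  case (2 f ts)
  have "eqE \<Sigma> E (tsubst \<sigma> t) (tsubst \<tau> t)" if "t \<in> set ts" for t
    using that by (intro "2.IH") (auto intro!: "2.prems")
  then show ?case using "2.hyps"(1)
    by (auto intro!: eqE.cong simp: list_all2_conv_all_nth)
qed auto

lemma tvars_iff: "x \<in> tvars t \<longleftrightarrow> Var x \<in> atoms t"
  by (simp add: tvars_def)

lemma thandles_iff: "w \<in> thandles t \<longleftrightarrow> Handle w \<in> atoms t"
  by (simp add: thandles_def)

lemma vsubst_cong: "(\<And>x. x \<in> tvars t \<Longrightarrow> \<sigma> x = \<tau> x) \<Longrightarrow> vsubst \<sigma> t = vsubst \<tau> t"
  unfolding vsubst_def by (rule tsubst_cong) (auto simp: tvars_iff split: atom.splits)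

lemma vsubst_id: "(\<And>x. x \<in> tvars t \<Longrightarrow> \<sigma> x = None) \<Longrightarrow> vsubst \<sigma> t = t"
  unfolding vsubst_def
  by (rule HOL.trans[OF tsubst_cong tsubst_Atom]) (auto simp: tvars_iff split: atom.splits)

lemma vsubst_empty [simp]: "vsubst Map.empty t = t"
  by (rule vsubst_id) auto

lemma hsubst_cong: "(\<And>w. w \<in> thandles t \<Longrightarrow> \<Phi> w = \<Psi> w) \<Longrightarrow> hsubst \<Phi> t = hsubst \<Psi> t"
  unfolding hsubst_def by (rule tsubst_cong) (auto simp: thandles_iff split: atom.splits)

lemma messages_atoms: "t \<in> messages \<Sigma> \<Longrightarrow> atoms t \<subseteq> range Name \<union> range Var"
  unfolding messages_def by (rule atoms_terms)

lemma ground_atoms: "t \<in> ground_terms \<Sigma> \<Longrightarrow> atoms t \<subseteq> range Name"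
  unfolding ground_terms_def by (rule atoms_terms)

lemma recipes_atoms: "t \<in> recipes \<Sigma> D \<Longrightarrow> atoms t \<subseteq> Handle ` D"
  unfolding recipes_def by (rule atoms_terms)

lemma messages_thandles: "t \<in> messages \<Sigma> \<Longrightarrow> thandles t = {}"
  by (auto simp: thandles_iff dest!: messages_atoms)

lemma ground_tvars: "t \<in> ground_terms \<Sigma> \<Longrightarrow> tvars t = {}"
  by (auto simp: tvars_iff dest!: ground_atoms)

lemma ground_messages: "t \<in> ground_terms \<Sigma> \<Longrightarrow> t \<in> messages \<Sigma>"
  using ground_atoms[of t \<Sigma>] unfolding ground_terms_def messages_def
  by (blast intro: terms_atoms)

lemma recipes_thandles: "r \<in> recipes \<Sigma> D \<Longrightarrow> thandles r \<subseteq> D"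
  by (auto simp: thandles_iff dest!: recipes_atoms)

lemma recipes_change:
  assumes "r \<in> recipes \<Sigma> D" "thandles r \<subseteq> D'"
  shows "r \<in> recipes \<Sigma> D'"
proof -
  have "atoms r \<subseteq> Handle ` D'"
    using recipes_atoms[OF assms(1)] assms(2) by (fastforce simp: thandles_iff)
  then show ?thesis using assms(1) unfolding recipes_def by (rule terms_atoms[rotated])
qed

lemma vsubst_messages:
  "t \<in> messages \<Sigma> \<Longrightarrow> ran \<sigma> \<subseteq> messages \<Sigma> \<Longrightarrow> vsubst \<sigma> t \<in> messages \<Sigma>"
  unfolding vsubst_def messages_def
proof (rule tsubst_terms, assumption)
  fix a assume *: "t \<in> terms \<Sigma> (range Name \<union> range Var)" "ran \<sigma> \<subseteq> terms \<Sigma> (range Name \<union> range Var)"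
    "a \<in> atoms t"
  then have "a \<in> range Name \<union> range Var"
    using atoms_terms[OF *(1)] by blast
  then show "(case a of Var x \<Rightarrow> (case \<sigma> x of Some t \<Rightarrow> t | None \<Rightarrow> Atom a) | _ \<Rightarrow> Atom a)
      \<in> terms \<Sigma> (range Name \<union> range Var)"
  proof
    assume "a \<in> range Var"
    then obtain x where "a = Var x" by auto
    then show ?thesis using *(2)
      by (cases "\<sigma> x") (auto intro: terms.intros ranI)
  qed (auto intro!: terms.intros(1))
qed

lemma vsubst_ground:
  assumes "t \<in> messages \<Sigma>" "ran \<sigma> \<subseteq> ground_terms \<Sigma>" "tvars t \<subseteq> dom \<sigma>"
  shows "vsubst \<sigma> t \<in> ground_terms \<Sigma>"
  using assms(1) unfolding vsubst_def messages_def ground_terms_def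
proof (rule tsubst_terms)
  fix a assume a: "a \<in> atoms t"
  then have "a \<in> range Name \<union> range Var"
    using messages_atoms[OF assms(1)] by blast
  then show "(case a of Var x \<Rightarrow> (case \<sigma> x of Some t \<Rightarrow> t | None \<Rightarrow> Atom a) | _ \<Rightarrow> Atom a)
      \<in> terms \<Sigma> (range Name)"
  proof
    assume "a \<in> range Var"
    then obtain x where x: "a = Var x" by auto
    then obtain s where "\<sigma> x = Some s"
      using a assms(3) by (auto simp: tvars_iff)
    then show ?thesis using x assms(2) by (auto simp: ground_terms_def intro: ranI)
  qed (auto intro!: terms.intros(1))
qed

lemma hsubst_ground:
  assumes "r \<in> recipes \<Sigma> (dom \<Phi>)" "ran \<Phi> \<subseteq> ground_terms \<Sigma>"
  shows "hsubst \<Phi> r \<in> ground_terms \<Sigma>"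
  using assms(1) unfolding hsubst_def recipes_def ground_terms_def
proof (rule tsubst_terms)
  fix a assume a: "a \<in> atoms r"
  then obtain w where "a = Handle w" "w \<in> dom \<Phi>"
    using recipes_atoms[OF assms(1)] by blast
  then show "(case a of Handle w \<Rightarrow> (case \<Phi> w of Some t \<Rightarrow> t | None \<Rightarrow> Atom a) | _ \<Rightarrow> Atom a)
      \<in> terms \<Sigma> (range Name)"
    using assms(2) by (auto simp: ground_terms_def intro: ranI)
qed

lemma eqE_vsubst:
  assumes "t \<in> messages \<Sigma>" "\<And>x. x \<in> tvars t \<Longrightarrow> \<exists>s s'. \<sigma> x = Some s \<and> \<tau> x = Some s' \<and> eqE \<Sigma> E s s'"
  shows "eqE \<Sigma> E (vsubst \<sigma> t) (vsubst \<tau> t)"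
  using assms(1) unfolding vsubst_def messages_def
proof (rule eqE_tsubst)
  fix a assume a: "a \<in> atoms t"
  then have "a \<in> range Name \<union> range Var"
    using messages_atoms[OF assms(1)] by blast
  then show "eqE \<Sigma> E (case a of Var x \<Rightarrow> (case \<sigma> x of Some t \<Rightarrow> t | None \<Rightarrow> Atom a) | _ \<Rightarrow> Atom a)
     (case a of Var x \<Rightarrow> (case \<tau> x of Some t \<Rightarrow> t | None \<Rightarrow> Atom a) | _ \<Rightarrow> Atom a)"
  proof
    assume "a \<in> range Var"
    then obtain x where x: "a = Var x" by auto
    then show ?thesis using a assms(2)[of x] by (auto simp: tvars_iff)
  qed (auto intro!: eqE.refl terms.intros)
qed

lemma eqE_hsubst:
  assumes "r \<in> recipes \<Sigma> D" "\<And>w. w \<in> D \<Longrightarrow> \<exists>s s'. \<Phi> w = Some s \<and> \<Psi> w = Some s' \<and> eqE \<Sigma> E s s'"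
  shows "eqE \<Sigma> E (hsubst \<Phi> r) (hsubst \<Psi> r)"
  using assms(1) unfolding hsubst_def recipes_def
proof (rule eqE_tsubst)
  fix a assume a: "a \<in> atoms r"
  then obtain w where "a = Handle w" "w \<in> D"
    using recipes_atoms[OF assms(1)] by blast
  then show "eqE \<Sigma> E (case a of Handle w \<Rightarrow> (case \<Phi> w of Some t \<Rightarrow> t | None \<Rightarrow> Atom a) | _ \<Rightarrow> Atom a)
     (case a of Handle w \<Rightarrow> (case \<Psi> w of Some t \<Rightarrow> t | None \<Rightarrow> Atom a) | _ \<Rightarrow> Atom a)"
    using assms(2)[of w] by auto
qed

lemma vsubst_rename:
  "x \<notin> tvars t \<Longrightarrow> \<sigma> x = Some s \<Longrightarrow> vsubst \<sigma> (vsubst [y \<mapsto> Atom (Var x)] t) = vsubst (\<sigma>(y := \<sigma> x)) t"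
  unfolding vsubst_def tsubst_tsubst
  by (rule tsubst_cong) (auto simp: tvars_iff split: atom.splits option.splits)

lemma vsubst_vsubst_upd:
  assumes "\<And>u. u \<in> ran \<sigma> \<Longrightarrow> tvars u = {}"
  shows "vsubst [y \<mapsto> s] (vsubst (\<sigma>(y := None)) t) = vsubst (\<sigma>(y \<mapsto> s)) t"
proof -
  have "vsubst [y \<mapsto> s] u = u" if "\<sigma> x = Some u" for x u
    using that assms[of u] by (intro vsubst_id) (auto intro: ranI)
  then show ?thesis
    unfolding vsubst_def tsubst_tsubst
    by (intro tsubst_cong) (auto split: atom.splits option.splits)
qed


section \<open>Instantiated processes and blocks\<close>

text \<open>The substitutions that matter have ground images, so no binder can capture anything and
  the clause for \<open>Input\<close> only has to deal with shadowing.\<close>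

fun psubst :: "('x \<rightharpoonup> ('f, 'x, 'w, 'n) tm) \<Rightarrow> ('f, 'x, 'w, 'n, 'c) proc \<Rightarrow> ('f, 'x, 'w, 'n, 'c) proc" where
  "psubst \<sigma> Null = Null"
| "psubst \<sigma> (Cond u v P Q) = Cond (vsubst \<sigma> u) (vsubst \<sigma> v) (psubst \<sigma> P) (psubst \<sigma> Q)"
| "psubst \<sigma> (Input c x P) = Input c x (psubst (\<sigma>(x := None)) P)"
| "psubst \<sigma> (Output c u P) = Output c (vsubst \<sigma> u) (psubst \<sigma> P)"

lemma psubst_cong: "(\<And>x. x \<in> pfv P \<Longrightarrow> \<sigma> x = \<tau> x) \<Longrightarrow> psubst \<sigma> P = psubst \<tau> P"
proof (induction P arbitrary: \<sigma> \<tau>)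
  case (Cond u v P Q)
  have "psubst \<sigma> P = psubst \<tau> P" "psubst \<sigma> Q = psubst \<tau> Q"
    by (rule Cond.IH, simp add: Cond.prems)+
  moreover have "vsubst \<sigma> u = vsubst \<tau> u" "vsubst \<sigma> v = vsubst \<tau> v"
    by (rule vsubst_cong, simp add: Cond.prems)+
  ultimately show ?case by simp
next
  case (Output c u P)
  have "psubst \<sigma> P = psubst \<tau> P"
    by (rule Output.IH) (simp add: Output.prems)
  moreover have "vsubst \<sigma> u = vsubst \<tau> u"
    by (rule vsubst_cong) (simp add: Output.prems)
  ultimately show ?case by simp
next
  case (Input c z P)
  have "psubst (\<sigma>(z := None)) P = psubst (\<tau>(z := None)) P"
    by (rule Input.IH) (simp add: Input.prems)
  then show ?case by simp
qed simp

lemma psubst_empty [simp]: "psubst Map.empty P = P"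
  by (induction P) auto

lemma psubst_Null_iff [simp]: "psubst \<sigma> P = Null \<longleftrightarrow> P = Null"
  by (cases P) auto

lemma pfv_subset_pvars: "pfv P \<subseteq> pvars P"
  by (induction P) auto

text \<open>Freshness of \<open>x\<close> for the bound variables too ensures that no inner
  \<open>Input\<close> removes \<open>x\<close> from the substitution on the way down.\<close>

lemma psubst_prename:
  "x \<notin> pvars P \<Longrightarrow> \<sigma> x = Some s \<Longrightarrow> psubst \<sigma> (prename y x P) = psubst (\<sigma>(y := \<sigma> x)) P"
proof (induction P arbitrary: \<sigma>)
  case (Input c z P)
  show ?case
  proof (cases "z = y")
    case False
    have "psubst (\<sigma>(z := None)) (prename y x P) = psubst ((\<sigma>(z := None))(y := (\<sigma>(z := None)) x)) P"
      by (rule Input.IH) (use Input.prems in auto)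
    also have "(\<sigma>(z := None))(y := (\<sigma>(z := None)) x) = (\<sigma>(y := \<sigma> x))(z := None)"
      using False Input.prems by auto
    finally show ?thesis using False by (simp only: psubst.simps prename.simps if_False)
  qed (simp only: psubst.simps prename.simps if_True simp_thms fun_upd_upd)
qed (auto simp: vsubst_rename)

text \<open>The images of \<open>\<sigma>\<close> are closed, so the outer substitution for
  \<open>y\<close> cannot act inside the terms that the inner one has inserted.\<close>

lemma psubst_psubst_upd:
  "(\<And>u. u \<in> ran \<sigma> \<Longrightarrow> tvars u = {}) \<Longrightarrow>
     psubst [y \<mapsto> s] (psubst (\<sigma>(y := None)) P) = psubst (\<sigma>(y \<mapsto> s)) P"
proof (induction P arbitrary: \<sigma>)
  case (Input c z P)
  show ?case
  proof (cases "z = y")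
    case False
    have "psubst [y \<mapsto> s] (psubst ((\<sigma>(z := None))(y := None)) P) = psubst ((\<sigma>(z := None))(y \<mapsto> s)) P"
      by (rule Input.IH, rule Input.prems) (auto simp: ran_def split: if_splits)
    moreover have "(\<sigma>(z := None))(y := None) = (\<sigma>(y := None))(z := None)"
      "(\<sigma>(z := None))(y \<mapsto> s) = (\<sigma>(y \<mapsto> s))(z := None)" "[y \<mapsto> s](z := None) = [y \<mapsto> s]"
      using False by auto
    ultimately show ?thesis by (simp only: psubst.simps)
  next
    case True
    have "[y \<mapsto> s](y := None) = Map.empty" by auto
    then show ?thesis using True by (simp only: psubst.simps fun_upd_upd psubst_empty)
  qed
qed (simp_all add: vsubst_vsubst_upd)

text \<open>Bridge between the two forms of an input: a ground execution replaces the bound variable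
  \<open>y\<close> by the received term at once, whereas a symbolic step renames \<open>y\<close> to
  a fresh \<open>x\<close> and leaves the value of \<open>x\<close> to the substitution.\<close>

lemma psubst_input_step:
  assumes "x \<notin> pvars P" "\<And>u. u \<in> ran \<sigma> \<Longrightarrow> tvars u = {}"
  shows "psubst [y \<mapsto> s] (psubst (\<sigma>(y := None)) P) = psubst (\<sigma>(x \<mapsto> s)) (prename y x P)"
proof -
  have "psubst (\<sigma>(x \<mapsto> s)) (prename y x P) = psubst (\<sigma>(x \<mapsto> s, y \<mapsto> s)) P"
    using assms(1) by (simp add: psubst_prename)
  \<comment> \<open>Dropping the binding of \<open>x\<close> is harmless because \<open>x\<close>
    does not occur in \<open>P\<close>.\<close>
  also have "\<dots> = psubst (\<sigma>(y \<mapsto> s)) P"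
    using assms(1) pfv_subset_pvars[of P] by (intro psubst_cong) auto
  finally show ?thesis using psubst_psubst_upd[OF assms(2)] by simp
qed

lemma basic_prename: "basic \<Sigma> c P \<Longrightarrow> basic \<Sigma> c (prename y x P)"
proof -
  have "Atom (Var x) \<in> messages \<Sigma>"
    by (auto simp: messages_def intro!: terms.intros(1))
  then have "vsubst [y \<mapsto> Atom (Var x)] u \<in> messages \<Sigma>" if "u \<in> messages \<Sigma>" for u
    using that by (auto intro: vsubst_messages)
  then show "basic \<Sigma> c P \<Longrightarrow> basic \<Sigma> c (prename y x P)"
    by (induction P) auto
qed

text \<open>Since all inputs of a block precede its outputs, the effect of a block on a ground basic
  process depends only on the input terms \<open>ts\<close> and the number of outputs, not on the frame.\<close>

inductive exec_block :: "('f \<times> nat) set \<Rightarrow> ('f, 'x, 'w, 'n) equations \<Rightarrow> focus \<Rightarrow> 'c \<Rightarrow>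
    ('f, 'x, 'w, 'n, 'c) proc \<Rightarrow> ('f, 'x, 'w, 'n) tm list \<Rightarrow> ('f, 'x, 'w, 'n) tm list \<Rightarrow>
    ('f, 'x, 'w, 'n, 'c) proc option \<Rightarrow> bool"
  for \<Sigma> E where
  In: "exec_block \<Sigma> E IStar c (psubst [y \<mapsto> t] P) ts us R \<Longrightarrow> f \<in> {IStar, IPlus} \<Longrightarrow>
     exec_block \<Sigma> E f c (Input c y P) (t # ts) us R"
| Out: "exec_block \<Sigma> E OStar c P [] us R \<Longrightarrow> f \<in> {IStar, OStar} \<Longrightarrow>
     exec_block \<Sigma> E f c (Output c u P) [] (u # us) R"
| Then: "eqE \<Sigma> E u v \<Longrightarrow> exec_block \<Sigma> E f c P ts us R \<Longrightarrow> exec_block \<Sigma> E f c (Cond u v P Q) ts us R"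
| Else: "\<not> eqE \<Sigma> E u v \<Longrightarrow> exec_block \<Sigma> E f c Q ts us R \<Longrightarrow> exec_block \<Sigma> E f c (Cond u v P Q) ts us R"
| Proper: "P = Null \<or> (\<exists>c x P'. P = Input c x P') \<Longrightarrow> exec_block \<Sigma> E OStar c P [] [] (Some P)"
| Improper: "exec_block \<Sigma> E IStar c Null [] [] None"

text \<open>The focus and the shape of the process determine the applicable rule, and the two rules
  for \<open>Cond\<close> exclude each other because the test is decided by \<open>eqE\<close> on
  the terms themselves.\<close>

lemma exec_block_deterministic:
  "exec_block \<Sigma> E f c P ts us R \<Longrightarrow> exec_block \<Sigma> E f c P ts us' R' \<Longrightarrow> length us = length us' \<Longrightarrow> us = us' \<and> R = R'"
proof (induction arbitrary: us' R' rule: exec_block.induct)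
  case (In c y t P ts us R f)
  from In.prems(1) In.hyps(2) show ?case
    by cases (auto dest: In.IH[OF _ In.prems(2)])
next
  case (Out c P us R f u)
  have "us = us'' \<and> R = R'" if "exec_block \<Sigma> E OStar c P [] us'' R'" "us' = u # us''" for us''
    using Out.IH[OF that(1)] Out.prems(2) that(2) by simp
  with Out.prems(1) Out.hyps(2) show ?case
    by cases auto
next
  case (Then u v f c P ts us R Q)
  from Then.prems(1) Then.hyps(1) show ?case
    by cases (auto dest: Then.IH[OF _ Then.prems(2)])
next
  case (Else u v f c Q ts us R P)
  from Else.prems(1) Else.hyps(1) show ?case
    by cases (auto dest: Else.IH[OF _ Else.prems(2)])
next
  case (Proper P c)
  from Proper.prems(1) Proper.hyps Proper.prems(2) show ?case
    by cases auto
next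
  case (Improper c)
  from Improper.prems show ?case
    by cases auto
qed

text \<open>Only \<open>Improper\<close> yields \<open>None\<close>, in focus \<open>IStar\<close>;
  the first output switches to \<open>OStar\<close> for good, where a block can only end by
  \<open>Proper\<close>.\<close>

lemma exec_block_no_output: "exec_block \<Sigma> E f c P ts us R \<Longrightarrow> R = None \<longleftrightarrow> f \<noteq> OStar \<and> us = []"
  by (induction rule: exec_block.induct) auto

section \<open>Symbolic blocks and ground blocks\<close>

text \<open>Finiteness serves the choice of a fresh first-order variable when an input is executed
  symbolically.\<close>

lemma finite_tvars: "finite (tvars t)"
proof -
  have "finite (atoms t)"
    by (induction t) auto
  moreover have "tvars t = Var -` atoms t"
    by (auto simp: tvars_iff)
  ultimately show ?thesis
    by (simp add: finite_vimageI inj_on_def)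
qed

lemma finite_pvars: "finite (pvars P)"
  by (induction P) (auto simp: finite_tvars)

lemma inst_frame_dom [simp]: "dom (inst_frame l \<Phi>) = dom \<Phi>"
  by (auto simp: inst_frame_def)

text \<open>Invariant of reachable systems under a partial run: \<open>l\<close> instantiates
  exactly the variables introduced so far. The handles of constraints lie in
  \<open>dom \<Phi>\<close>, so a handle outside the frame is fresh for \<open>S\<close> as well.
  The last conjunct says that dependency constraints bring in no recipe variables of their own,
  hence solutions have the same domain with and without them.\<close>

definition sym_inv :: "('f \<times> nat) set \<Rightarrow> ('x \<rightharpoonup> ('f, 'x, 'w, 'n) tm) \<Rightarrow> ('f, 'x, 'w, 'n) frame \<Rightarrow>
    ('f, 'x, 'w, 'n, 'y) constr set \<Rightarrow> bool" where
  "sym_inv \<Sigma> l \<Phi> S \<longleftrightarrow>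
     (\<forall>x. x \<in> dom l \<longleftrightarrow> (\<exists>k \<in> S. x \<in> cvars k)) \<and> (\<forall>x t. l x = Some t \<longrightarrow> t \<in> ground_terms \<Sigma>) \<and>
     finite (dom \<Phi>) \<and> (\<forall>w u. \<Phi> w = Some u \<longrightarrow> u \<in> messages \<Sigma> \<and> tvars u \<subseteq> dom l) \<and>
     finite S \<and> (\<forall>k \<in> S. chandles k \<subseteq> dom \<Phi>) \<and>
     (\<forall>u v. Eq u v \<in> S \<or> Neq u v \<in> S \<longrightarrow> u \<in> messages \<Sigma> \<and> v \<in> messages \<Sigma>) \<and>
     fvars2 (strip S) = fvars2 S"

lemma sym_inv_frame:
  "sym_inv \<Sigma> l \<Phi> S \<Longrightarrow> \<Phi> w = Some u \<Longrightarrow> u \<in> messages \<Sigma> \<and> tvars u \<subseteq> dom l"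
  by (simp add: sym_inv_def)

lemma sym_inv_dom: "sym_inv \<Sigma> l \<Phi> S \<Longrightarrow> dom l = (\<Union>k \<in> S. cvars k)"
  by (rule set_eqI) (simp add: sym_inv_def)

lemma sym_inv_handles: "sym_inv \<Sigma> l \<Phi> S \<Longrightarrow> k \<in> S \<Longrightarrow> chandles k \<subseteq> dom \<Phi>"
  by (simp add: sym_inv_def)

lemma sym_inv_fvars:
  assumes "sym_inv \<Sigma> l \<Phi> S"
  shows "fvars \<Phi> S = dom l"
proof -
  have "(\<Union>u \<in> ran \<Phi>. tvars u) \<subseteq> dom l"
    using sym_inv_frame[OF assms] by (force simp: ran_def)
  then show ?thesis
    unfolding fvars_def sym_inv_dom[OF assms] by (rule Un_absorb1)
qed

lemma sym_inv_finite:
  fixes S :: "('f, 'x, 'w, 'n, 'y) constr set"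
  assumes "sym_inv \<Sigma> l \<Phi> S"
  shows "finite (dom l)"
proof -
  have "finite (cvars k)" for k :: "('f, 'x, 'w, 'n, 'y) constr"
    by (cases k) (auto simp: finite_tvars)
  moreover have "finite S"
    using assms by (simp add: sym_inv_def)
  ultimately show ?thesis
    by (simp add: sym_inv_dom[OF assms])
qed

lemma sym_inv_closed: "sym_inv \<Sigma> l \<Phi> S \<Longrightarrow> u \<in> ran l \<Longrightarrow> tvars u = {}"
  unfolding sym_inv_def ran_def using ground_tvars by blast

lemma sym_inv_ran: "sym_inv \<Sigma> l \<Phi> S \<Longrightarrow> ran l \<subseteq> ground_terms \<Sigma>"
  by (auto simp: sym_inv_def ran_def)

lemma fvars2_insert [simp]: "fvars2 (insert k S) = cvars2 k \<union> fvars2 S"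
  by (auto simp: fvars2_def)

lemma sym_inv_inst_frame:
  assumes "sym_inv \<Sigma> l \<Phi> S" "l \<subseteq>\<^sub>m l'"
  shows "inst_frame l' \<Phi> = inst_frame l \<Phi>"
proof
  fix w
  show "inst_frame l' \<Phi> w = inst_frame l \<Phi> w"
  proof (cases "\<Phi> w")
    case (Some u)
    then have "tvars u \<subseteq> dom l"
      using sym_inv_frame[OF assms(1)] by blast
    then have "vsubst l' u = vsubst l u"
      using assms(2) by (intro vsubst_cong) (metis map_le_def subsetD)
    then show ?thesis using Some by (simp add: inst_frame_def)
  qed (simp add: inst_frame_def)
qed

lemma sym_inv_ground:
  assumes "sym_inv \<Sigma> l \<Phi> S"
  shows "ran (inst_frame l \<Phi>) \<subseteq> ground_terms \<Sigma>"
proof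
  fix t assume "t \<in> ran (inst_frame l \<Phi>)"
  then obtain w u where "\<Phi> w = Some u" "t = vsubst l u"
    by (auto simp: inst_frame_def ran_def)
  then show "t \<in> ground_terms \<Sigma>"
    using sym_inv_frame[OF assms, of w u] sym_inv_ran[OF assms] by (simp add: vsubst_ground)
qed

lemma sym_inv_In:
  assumes "sym_inv \<Sigma> l \<Phi> S" "pfv (Input c y P) \<subseteq> dom l" "x \<notin> pvars (Input c y P) \<union> fvars \<Phi> S"
    "X \<notin> fvars2 S" "t \<in> ground_terms \<Sigma>"
  shows "sym_inv \<Sigma> (l(x \<mapsto> t)) \<Phi> (S \<union> {Ded (dom \<Phi>) X x})"
    "l \<subseteq>\<^sub>m l(x \<mapsto> t)" "pfv (prename y x P) \<subseteq> dom (l(x \<mapsto> t))"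
    "psubst [y \<mapsto> t] (psubst (l(y := None)) P) = psubst (l(x \<mapsto> t)) (prename y x P)"
proof -
  have x: "x \<notin> dom l"
    using assms(1,3) by (simp add: sym_inv_fvars)
  show "sym_inv \<Sigma> (l(x \<mapsto> t)) \<Phi> (S \<union> {Ded (dom \<Phi>) X x})"
    using assms(1,5) x unfolding sym_inv_def by (auto simp: subset_insertI2)
  show "l \<subseteq>\<^sub>m l(x \<mapsto> t)"
    using x by (auto simp: map_le_def)
  show "pfv (prename y x P) \<subseteq> dom (l(x \<mapsto> t))"
    using assms(2) pfv_prename[of y x P] by auto
  show "psubst [y \<mapsto> t] (psubst (l(y := None)) P) = psubst (l(x \<mapsto> t)) (prename y x P)"
    by (rule psubst_input_step) (use assms(3) sym_inv_closed[OF assms(1)] in auto)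
qed

lemma sym_inv_Out:
  assumes "sym_inv \<Sigma> l \<Phi> S" "tvars u \<subseteq> dom l" "u \<in> messages \<Sigma>" "w \<notin> dom \<Phi>"
  shows "sym_inv \<Sigma> l (\<Phi>(w \<mapsto> u)) S"
    "inst_frame l (\<Phi>(w \<mapsto> u)) = (inst_frame l \<Phi>)(w \<mapsto> vsubst l u)"
proof -
  show "sym_inv \<Sigma> l (\<Phi>(w \<mapsto> u)) S"
    using assms(1-3) unfolding sym_inv_def by (auto simp: subset_insertI2)
qed (auto simp: inst_frame_def)

lemma sym_inv_Eq:
  assumes "sym_inv \<Sigma> l \<Phi> S" "tvars u \<union> tvars v \<subseteq> dom l" "u \<in> messages \<Sigma>" "v \<in> messages \<Sigma>"
  shows "sym_inv \<Sigma> l \<Phi> (S \<union> {Eq u v})" "sym_inv \<Sigma> l \<Phi> (S \<union> {Neq u v})"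
  using assms unfolding sym_inv_def by (auto simp: messages_thandles)

text \<open>The requirements on a solution that concern single constraints. The conditions on the
  domains of \<open>\<theta>\<close> and \<open>l\<close> are left out because they hold for one
  system only, whereas \<open>sat\<close> has to be followed along a growing run.\<close>

definition sat :: "('f \<times> nat) set \<Rightarrow> ('f, 'x, 'w, 'n) equations \<Rightarrow>
    ('y \<rightharpoonup> ('f, 'x, 'w, 'n) tm) \<Rightarrow> ('x \<rightharpoonup> ('f, 'x, 'w, 'n) tm) \<Rightarrow>
    ('f, 'x, 'w, 'n) frame \<Rightarrow> ('f, 'x, 'w, 'n, 'y) constr set \<Rightarrow> bool" where
  "sat \<Sigma> E \<theta> l \<Phi> S \<longleftrightarrow>
     (\<forall>D X x. Ded D X x \<in> S \<longrightarrow> the (\<theta> X) \<in> recipes \<Sigma> D \<and>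
        eqE \<Sigma> E (hsubst (inst_frame l \<Phi>) (the (\<theta> X))) (vsubst l (Atom (Var x)))) \<and>
     (\<forall>u v. Eq u v \<in> S \<longrightarrow> eqE \<Sigma> E (vsubst l u) (vsubst l v)) \<and>
     (\<forall>u v. Neq u v \<in> S \<longrightarrow> \<not> eqE \<Sigma> E (vsubst l u) (vsubst l v))"

text \<open>Used both for first-order substitutions and for frames. Only one inclusion of domains is
  asked for, so that the substitution of an unfinished run can be compared with that of the complete
  one.\<close>

definition agree :: "('f \<times> nat) set \<Rightarrow> ('f, 'x, 'w, 'n) equations \<Rightarrow>
    ('a \<rightharpoonup> ('f, 'x, 'w, 'n) tm) \<Rightarrow> ('a \<rightharpoonup> ('f, 'x, 'w, 'n) tm) \<Rightarrow> bool" where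
  "agree \<Sigma> E l m \<longleftrightarrow> (\<forall>x s. l x = Some s \<longrightarrow> (\<exists>s'. m x = Some s' \<and> eqE \<Sigma> E s s'))"

lemma agree_vsubst:
  assumes "agree \<Sigma> E l m" "t \<in> messages \<Sigma>" "tvars t \<subseteq> dom l"
  shows "eqE \<Sigma> E (vsubst l t) (vsubst m t)"
  using assms(2) by (rule eqE_vsubst) (use assms in \<open>fastforce simp: agree_def\<close>)

lemma agree_hsubst:
  assumes "agree \<Sigma> E \<Phi> \<Psi>" "r \<in> recipes \<Sigma> (dom \<Phi>)"
  shows "eqE \<Sigma> E (hsubst \<Phi> r) (hsubst \<Psi> r)"
  using assms(2) by (rule eqE_hsubst) (use assms in \<open>fastforce simp: agree_def\<close>)

lemma agree_inst_frame:
  assumes "agree \<Sigma> E l m" "sym_inv \<Sigma> l \<Phi> S" "\<Phi> \<subseteq>\<^sub>m \<Psi>"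
  shows "agree \<Sigma> E (inst_frame l \<Phi>) (inst_frame m \<Psi>)"
  unfolding agree_def
proof (intro allI impI)
  fix w s assume "inst_frame l \<Phi> w = Some s"
  then obtain u where u: "\<Phi> w = Some u" "s = vsubst l u"
    by (auto simp: inst_frame_def)
  then have "u \<in> messages \<Sigma>" "tvars u \<subseteq> dom l"
    using sym_inv_frame[OF assms(2)] by auto
  moreover have "\<Psi> w = Some u"
    using u assms(3) by (auto simp: map_le_def dom_def)
  ultimately show "\<exists>s'. inst_frame m \<Psi> w = Some s' \<and> eqE \<Sigma> E s s'"
    using u agree_vsubst[OF assms(1)] by (auto simp: inst_frame_def)
qed

lemma focused_mono:
  "focused f K tr K' \<Longrightarrow> fst (snd K) \<subseteq>\<^sub>m fst (snd K') \<and> snd (snd K) \<subseteq> snd (snd K')"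
proof (induction rule: focused.induct)
  case (In K c X K' tr K'' f)
  from In.hyps(1) In.IH show ?case by cases auto
next
  case (Out K c w K' tr K'' f)
  from Out.hyps(1) have "fst (snd K) \<subseteq>\<^sub>m fst (snd K') \<and> snd (snd K) \<subseteq> snd (snd K')"
    by cases (auto simp: map_le_def)
  then show ?case using Out.IH by (blast intro: map_le_trans)
next
  case (Tau K K' f tr K'')
  from Tau.hyps(1) Tau.IH show ?case by cases auto
qed auto

text \<open>The substitution \<open>m\<close> is the one of a given solution. The block is executed with a
  substitution \<open>l'\<close> that agrees with \<open>m\<close> modulo the equational theory, but takes every input to be
  literally the term computed by its recipe.\<close>

lemma focused_imp_exec_block:
  assumes "focused f (P, \<Phi>, S) tr (R, \<Phi>', S')"
    and "basic \<Sigma> c P" "pfv P \<subseteq> dom l" "sym_inv \<Sigma> l \<Phi> S"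
    and "sat \<Sigma> E \<theta> m \<Psi> T" "\<Phi>' \<subseteq>\<^sub>m \<Psi>" "S' \<subseteq> T" "(\<Union>k \<in> T. cvars k) \<subseteq> dom m" "agree \<Sigma> E l m"
  shows "\<exists>Xs ws us l'. tr = map (In c) Xs @ map (Out c) ws \<and> length us = length ws \<and>
    (f = OStar \<longrightarrow> Xs = []) \<and> (f = IPlus \<longrightarrow> Xs \<noteq> []) \<and>
    (\<forall>X \<in> set Xs. the (\<theta> X) \<in> recipes \<Sigma> (dom \<Phi>)) \<and>
    distinct Xs \<and> set Xs \<inter> fvars2 S = {} \<and> fvars2 S' = fvars2 S \<union> set Xs \<and>
    distinct ws \<and> set ws \<inter> dom \<Phi> = {} \<and>
    exec_block \<Sigma> E f c (psubst l P) (map (\<lambda>X. hsubst (inst_frame l \<Phi>) (the (\<theta> X))) Xs) us (map_option (psubst l') R) \<and>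
    inst_frame l' \<Phi>' = (inst_frame l \<Phi>)(ws [\<mapsto>] us) \<and> l \<subseteq>\<^sub>m l' \<and> sym_inv \<Sigma> l' \<Phi>' S' \<and> agree \<Sigma> E l' m \<and>
    (\<forall>Q. R = Some Q \<longrightarrow> basic \<Sigma> c Q \<and> pfv Q \<subseteq> dom l')"
  using assms(1-4,9)
proof (induction f "(P, \<Phi>, S)" tr "(R, \<Phi>', S')" arbitrary: P \<Phi> S l rule: focused.induct)
  case (In d X K' tr f)
  note prems = In.prems and tail = In.hyps(2) and IH = In.hyps(3)
  from In.hyps(1) show ?case
  proof cases
    case (1 x y P')
    let ?r = "the (\<theta> X)" and ?S = "S \<union> {Ded (dom \<Phi>) X x}"
    define t where "t = hsubst (inst_frame l \<Phi>) ?r"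
    have mono: "\<Phi> \<subseteq>\<^sub>m \<Psi>" "?S \<subseteq> T"
      using focused_mono[OF tail] 1(2) assms(6,7) by (auto intro: map_le_trans)
    then have r: "?r \<in> recipes \<Sigma> (dom \<Phi>)" and
      eq: "eqE \<Sigma> E (hsubst (inst_frame m \<Psi>) ?r) (vsubst m (Atom (Var x)))"
      using assms(5) by (auto simp: sat_def)
    \<comment> \<open>\<open>agree\<close> demands that \<open>m\<close> be defined on the new
      variable; it is, because the constraint introducing \<open>x\<close> persists in
      \<open>T\<close>.\<close>
    have "Ded (dom \<Phi>) X x \<in> T" using mono by auto
    then have "x \<in> (\<Union>k \<in> T. cvars k)" by (rule UN_I) simp
    then have x: "x \<in> dom m" using assms(8) by (rule rev_subsetD)
    have t: "t \<in> ground_terms \<Sigma>"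
      unfolding t_def using r sym_inv_ground[OF prems(3)] by (intro hsubst_ground) auto
    have dc: "d = c" "basic \<Sigma> c P'" using prems(1) 1 by auto
    have P: "pfv (Input d y P') \<subseteq> dom l" using prems(2) 1 by simp
    note step = sym_inv_In[OF prems(3) P 1(3,4) t]
    \<comment> \<open>The recipe gives equal terms in the two frames modulo the theory, and the
      deducibility constraint on \<open>x\<close> identifies the second of them with the value of
      \<open>x\<close> under \<open>m\<close>.\<close>
    have "eqE \<Sigma> E t (hsubst (inst_frame m \<Psi>) ?r)"
      unfolding t_def using agree_inst_frame[OF prems(4,3) mono(1)] r by (intro agree_hsubst) auto
    then have "eqE \<Sigma> E t (vsubst m (Atom (Var x)))"
      using eq by (rule eqE.trans)
    then have agree: "agree \<Sigma> E (l(x \<mapsto> t)) m"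
      using prems(4) x by (auto simp: agree_def vsubst_def)
    have inst: "inst_frame (l(x \<mapsto> t)) \<Phi> = inst_frame l \<Phi>"
      by (rule sym_inv_inst_frame[OF prems(3) step(2)])
    from IH[OF 1(2) basic_prename[OF dc(2)] step(3,1) agree]
    obtain Xs ws us l' where *: "tr = map (In c) Xs @ map (Out c) ws" "length us = length ws"
      "\<forall>X \<in> set Xs. the (\<theta> X) \<in> recipes \<Sigma> (dom \<Phi>)"
      "distinct Xs" "set Xs \<inter> fvars2 ?S = {}" "fvars2 S' = fvars2 ?S \<union> set Xs"
      "distinct ws" "set ws \<inter> dom \<Phi> = {}"
      "exec_block \<Sigma> E IStar c (psubst (l(x \<mapsto> t)) (prename y x P')) (map (\<lambda>X. hsubst (inst_frame l \<Phi>) (the (\<theta> X))) Xs) us (map_option (psubst l') R)"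
      "inst_frame l' \<Phi>' = (inst_frame l \<Phi>)(ws [\<mapsto>] us)" "l(x \<mapsto> t) \<subseteq>\<^sub>m l'" "sym_inv \<Sigma> l' \<Phi>' S'"
      "agree \<Sigma> E l' m" "\<forall>Q. R = Some Q \<longrightarrow> basic \<Sigma> c Q \<and> pfv Q \<subseteq> dom l'"
      unfolding inst by blast
    have "exec_block \<Sigma> E f c (psubst l P) (t # map (\<lambda>X. hsubst (inst_frame l \<Phi>) (the (\<theta> X))) Xs) us (map_option (psubst l') R)"
      unfolding 1(1) dc psubst.simps
      by (rule exec_block.In) (use *(9) step(4) In.hyps(4) in auto)
    moreover have "l \<subseteq>\<^sub>m l'" using step(2) *(11) by (rule map_le_trans)
    moreover have "X \<notin> fvars2 S" "f \<noteq> OStar" using 1(4) In.hyps(4) by auto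
    ultimately show ?thesis
      using * r dc by (intro exI[of _ "X # Xs"] exI[of _ ws] exI[of _ us] exI[of _ l']) (auto simp: t_def)
  qed
next
  case (Out d w K' tr f)
  note prems = Out.prems and IH = Out.hyps(3)
  from Out.hyps(1) show ?case
  proof cases
    case (2 u P')
    have dc: "d = c" "basic \<Sigma> c P'" "u \<in> messages \<Sigma>" and fv: "tvars u \<subseteq> dom l" "pfv P' \<subseteq> dom l"
      using prems(1,2) 2 by auto
    have w: "w \<notin> dom \<Phi>" using 2 by auto
    note step = sym_inv_Out[OF prems(3) fv(1) dc(3) w]
    from IH[OF 2(2) dc(2) fv(2) step(1) prems(4)]
    obtain ws us l' where *: "tr = map (Out c) ws" "length us = length ws"
      "fvars2 S' = fvars2 S"
      "distinct ws" "set ws \<inter> dom (\<Phi>(w \<mapsto> u)) = {}"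
      "exec_block \<Sigma> E OStar c (psubst l P') [] us (map_option (psubst l') R)"
      "inst_frame l' \<Phi>' = (inst_frame l (\<Phi>(w \<mapsto> u)))(ws [\<mapsto>] us)" "l \<subseteq>\<^sub>m l'" "sym_inv \<Sigma> l' \<Phi>' S'"
      "agree \<Sigma> E l' m" "\<forall>Q. R = Some Q \<longrightarrow> basic \<Sigma> c Q \<and> pfv Q \<subseteq> dom l'"
      by auto
    have "exec_block \<Sigma> E f c (psubst l P) [] (vsubst l u # us) (map_option (psubst l') R)"
      unfolding 2(1) dc psubst.simps
      by (rule exec_block.Out) (use * Out.hyps(4) in auto)
    then show ?thesis
      using * dc w step(2) Out.hyps(4)
      by (intro exI[of _ "[]"] exI[of _ "w # ws"] exI[of _ "vsubst l u # us"] exI[of _ l']) auto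
  qed
next
  case (Tau K' f tr)
  note prems = Tau.prems and IH = Tau.hyps(3)
  from Tau.hyps(1) show ?case
  proof cases
    case (3 u v P' Q)
    have dc: "basic \<Sigma> c P'" "u \<in> messages \<Sigma>" "v \<in> messages \<Sigma>" and fv: "tvars u \<union> tvars v \<subseteq> dom l" "pfv P' \<subseteq> dom l"
      using prems(1,2) 3 by auto
    note step = sym_inv_Eq[OF prems(3) fv(1) dc(2,3)]
    \<comment> \<open>The recorded equation is satisfied by the given solution \<open>m\<close>;
      agreement carries it over to \<open>l\<close>, so the ground execution takes the branch chosen
      symbolically.\<close>
    have "eqE \<Sigma> E (vsubst m u) (vsubst m v)"
      using focused_mono[OF Tau.hyps(2)] 3 assms(5,7) by (auto simp: sat_def)
    moreover have "eqE \<Sigma> E (vsubst l u) (vsubst m u)" "eqE \<Sigma> E (vsubst l v) (vsubst m v)"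
      using agree_vsubst[OF prems(4)] dc fv by auto
    ultimately have "eqE \<Sigma> E (vsubst l u) (vsubst l v)"
      by (meson eqE.sym eqE.trans)
    then have "exec_block \<Sigma> E f c (psubst l P') ts us R' \<Longrightarrow> exec_block \<Sigma> E f c (psubst l P) ts us R'" for ts us R'
      unfolding 3 psubst.simps by (rule exec_block.Then)
    with IH[OF 3(2) dc(1) fv(2) step(1) prems(4)] show ?thesis
      by (elim exE conjE) (intro exI conjI; (assumption | force)?)
  next
    case (4 u v P' Q)
    have dc: "basic \<Sigma> c Q" "u \<in> messages \<Sigma>" "v \<in> messages \<Sigma>" and fv: "tvars u \<union> tvars v \<subseteq> dom l" "pfv Q \<subseteq> dom l"
      using prems(1,2) 4 by auto
    note step = sym_inv_Eq[OF prems(3) fv(1) dc(2,3)]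
    have "\<not> eqE \<Sigma> E (vsubst m u) (vsubst m v)"
      using focused_mono[OF Tau.hyps(2)] 4 assms(5,7) by (auto simp: sat_def)
    moreover have "eqE \<Sigma> E (vsubst l u) (vsubst m u)" "eqE \<Sigma> E (vsubst l v) (vsubst m v)"
      using agree_vsubst[OF prems(4)] dc fv by auto
    ultimately have "\<not> eqE \<Sigma> E (vsubst l u) (vsubst l v)"
      by (meson eqE.sym eqE.trans)
    then have "exec_block \<Sigma> E f c (psubst l Q) ts us R' \<Longrightarrow> exec_block \<Sigma> E f c (psubst l P) ts us R'" for ts us R'
      unfolding 4 psubst.simps by (rule exec_block.Else)
    with IH[OF 4(2) dc(1) fv(2) step(2) prems(4)] show ?thesis
      by (elim exE conjE) (intro exI conjI; (assumption | force)?)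
  qed
next
  case (Proper P\<^sub>1)
  have "exec_block \<Sigma> E OStar c (psubst l P\<^sub>1) [] [] (Some (psubst l P\<^sub>1))"
    using Proper.hyps by (intro exec_block.Proper) auto
  with Proper show ?case
    by (intro exI[of _ "[]"] exI[of _ l]) auto
next
  case Improper
  then show ?case
    by (intro exI[of _ "[]"] exI[of _ l]) (auto intro: exec_block.Improper)
qed

text \<open>The constraints of \<open>S\<close> mention only variables in \<open>dom l\<close>, and
  their recipes only handles in \<open>dom \<Phi>\<close>, so extending both maps changes no term
  that \<open>S\<close> speaks of.\<close>

lemma sat_mono:
  assumes "sat \<Sigma> E \<theta> l \<Phi> S" "sym_inv \<Sigma> l \<Phi> S" "l \<subseteq>\<^sub>m l'" "\<Phi> \<subseteq>\<^sub>m \<Phi>'"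
  shows "sat \<Sigma> E \<theta> l' \<Phi>' S"
proof -
  have l: "vsubst l' t = vsubst l t" if "tvars t \<subseteq> dom l" for t
    using assms(3) that by (intro vsubst_cong) (metis map_le_def subsetD)
  have cvars: "cvars k \<subseteq> dom l" if "k \<in> S" for k
    using that unfolding sym_inv_dom[OF assms(2)] by blast
  have h: "hsubst (inst_frame l' \<Phi>') r = hsubst (inst_frame l \<Phi>) r"
    if "r \<in> recipes \<Sigma> D" "Ded D X x \<in> S" for r D X x
  proof (rule hsubst_cong)
    fix w assume "w \<in> thandles r"
    moreover have "D \<subseteq> dom \<Phi>"
      using sym_inv_handles[OF assms(2) that(2)] by simp
    ultimately have "w \<in> dom \<Phi>" using recipes_thandles[OF that(1)] by blast
    then obtain u where u: "\<Phi> w = Some u" by auto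
    moreover have "\<Phi>' w = \<Phi> w" using \<open>w \<in> dom \<Phi>\<close> assms(4) by (auto simp: map_le_def)
    ultimately show "inst_frame l' \<Phi>' w = inst_frame l \<Phi> w"
      using l sym_inv_frame[OF assms(2) u] by (simp add: inst_frame_def)
  qed
  show ?thesis
    unfolding sat_def
  proof (intro conjI allI impI)
    fix D X x assume k: "Ded D X x \<in> S"
    show r: "the (\<theta> X) \<in> recipes \<Sigma> D"
      using assms(1) k by (auto simp: sat_def)
    show "eqE \<Sigma> E (hsubst (inst_frame l' \<Phi>') (the (\<theta> X))) (vsubst l' (Atom (Var x)))"
      unfolding h[OF r k] using l[of "Atom (Var x)"] cvars[OF k] assms(1) k by (auto simp: sat_def)
  next
    fix u v assume k: "Eq u v \<in> S"
    then show "eqE \<Sigma> E (vsubst l' u) (vsubst l' v)"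
      using assms(1) l cvars[OF k] by (simp add: sat_def)
  next
    fix u v assume k: "Neq u v \<in> S"
    then show "\<not> eqE \<Sigma> E (vsubst l' u) (vsubst l' v)"
      using assms(1) l cvars[OF k] by (simp add: sat_def)
  qed
qed

text \<open>No solution has to be given in this direction: every fresh variable is sent to the term
  computed by its recipe, so deducibility constraints hold by reflexivity, while the equations and
  disequations hold because the ground execution decided the tests that way.\<close>

lemma exec_block_imp_focused:
  fixes l :: "'x::infinite \<rightharpoonup> ('f, 'x, 'w, 'n) tm"
  assumes "exec_block \<Sigma> E f c P\<^sub>0 ts us R\<^sub>0" "P\<^sub>0 = psubst l P"
    and "basic \<Sigma> c P" "pfv P \<subseteq> dom l" "sym_inv \<Sigma> l \<Phi> S" "sat \<Sigma> E \<theta> l \<Phi> S"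
    and "ts = map (\<lambda>X. hsubst (inst_frame l \<Phi>) (the (\<theta> X))) Xs"
    and "\<forall>X \<in> set Xs. the (\<theta> X) \<in> recipes \<Sigma> (dom \<Phi>)"
    and "distinct Xs" "set Xs \<inter> fvars2 S = {}" "length us = length ws" "distinct ws" "set ws \<inter> dom \<Phi> = {}"
  shows "\<exists>R \<Phi>' S' l'. focused f (P, \<Phi>, S) (map (In c) Xs @ map (Out c) ws) (R, \<Phi>', S') \<and>
    R\<^sub>0 = map_option (psubst l') R \<and> inst_frame l' \<Phi>' = (inst_frame l \<Phi>)(ws [\<mapsto>] us) \<and> l \<subseteq>\<^sub>m l' \<and>
    sym_inv \<Sigma> l' \<Phi>' S' \<and> sat \<Sigma> E \<theta> l' \<Phi>' S' \<and> fvars2 S' = fvars2 S \<union> set Xs \<and>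
    (\<forall>Q. R = Some Q \<longrightarrow> basic \<Sigma> c Q \<and> pfv Q \<subseteq> dom l')"
  using assms
proof (induction arbitrary: l P \<Phi> S Xs ws rule: exec_block.induct)
  case (In c y t P\<^sub>1 ts us R f)
  note prems = In.prems
  obtain P' where P: "P = Input c y P'" "P\<^sub>1 = psubst (l(y := None)) P'"
    using prems(1) by (cases P) auto
  obtain X Xs' where X: "Xs = X # Xs'" "t = hsubst (inst_frame l \<Phi>) (the (\<theta> X))"
    "ts = map (\<lambda>X. hsubst (inst_frame l \<Phi>) (the (\<theta> X))) Xs'"
    using prems(6) by (cases Xs) auto
  have "finite (pvars P \<union> fvars \<Phi> S)"
    using sym_inv_finite[OF prems(4)] sym_inv_fvars[OF prems(4)] by (simp add: finite_pvars)
  from ex_new_if_finite[OF infinite_UNIV this]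
  obtain x where x: "x \<notin> pvars (Input c y P') \<union> fvars \<Phi> S"
    using P(1) by blast
  have t: "t \<in> ground_terms \<Sigma>"
    unfolding X(2) by (intro hsubst_ground sym_inv_ground[OF prems(4)]) (use prems(7) X(1) in auto)
  have P': "basic \<Sigma> c P'" and fv: "pfv (Input c y P') \<subseteq> dom l" and Xn: "X \<notin> fvars2 S"
    using prems(2,3,9) P X by auto
  let ?S = "S \<union> {Ded (dom \<Phi>) X x}"
  note step = sym_inv_In[OF prems(4) fv x Xn t]
  have inst: "inst_frame (l(x \<mapsto> t)) \<Phi> = inst_frame l \<Phi>"
    by (rule sym_inv_inst_frame[OF prems(4) step(2)])
  have "eqE \<Sigma> E t t"
    using t unfolding ground_terms_def by (blast intro: eqE.refl terms_UNIV)
  then have sat: "sat \<Sigma> E \<theta> (l(x \<mapsto> t)) \<Phi> ?S"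
    using sat_mono[OF prems(5,4) step(2) map_le_refl] prems(7) X(1) inst X(2)
    unfolding sat_def by (auto simp: vsubst_def)
  have eq: "psubst [y \<mapsto> t] P\<^sub>1 = psubst (l(x \<mapsto> t)) (prename y x P')"
    using step(4) P(2) by simp
  have rest: "ts = map (\<lambda>X. hsubst (inst_frame (l(x \<mapsto> t)) \<Phi>) (the (\<theta> X))) Xs'"
    "\<forall>X \<in> set Xs'. the (\<theta> X) \<in> recipes \<Sigma> (dom \<Phi>)" "distinct Xs'" "set Xs' \<inter> fvars2 ?S = {}"
    using X(1,3) inst prems(7-9) by auto
  from In.IH[OF eq basic_prename[OF P'] step(3,1) sat rest prems(10-12)]
  obtain R' \<Phi>' S' l' where *:
    "focused IStar (prename y x P', \<Phi>, ?S) (map (In c) Xs' @ map (Out c) ws) (R', \<Phi>', S')"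
    "R = map_option (psubst l') R'" "inst_frame l' \<Phi>' = (inst_frame l \<Phi>)(ws [\<mapsto>] us)" "l(x \<mapsto> t) \<subseteq>\<^sub>m l'"
    "sym_inv \<Sigma> l' \<Phi>' S'" "sat \<Sigma> E \<theta> l' \<Phi>' S'" "fvars2 S' = fvars2 ?S \<union> set Xs'"
    "\<forall>Q. R' = Some Q \<longrightarrow> basic \<Sigma> c Q \<and> pfv Q \<subseteq> dom l'"
    unfolding inst by blast
  have "focused f (P, \<Phi>, S) (In c X # (map (In c) Xs' @ map (Out c) ws)) (R', \<Phi>', S')"
    unfolding P(1) by (rule focused.In[OF sym_step.intros(1)[OF x Xn] *(1)]) (rule In.hyps)
  then show ?case
    using *(2-8) map_le_trans[OF step(2) *(4)] X(1)
    by (intro exI[of _ R'] exI[of _ \<Phi>'] exI[of _ S'] exI[of _ l']) auto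
next
  case (Out c P\<^sub>1 us R f u\<^sub>0)
  note prems = Out.prems
  obtain u P' where P: "P = Output c u P'" "P\<^sub>1 = psubst l P'" "u\<^sub>0 = vsubst l u"
    using prems(1) by (cases P) auto
  obtain w ws' where ws: "ws = w # ws'"
    using prems(10) by (cases ws) auto
  have P': "basic \<Sigma> c P'" "u \<in> messages \<Sigma>" and fv: "tvars u \<subseteq> dom l" "pfv P' \<subseteq> dom l"
    and w: "w \<notin> dom \<Phi>" and Xs: "Xs = []"
    using prems(2,3,6,12) P ws by auto
  note step = sym_inv_Out[OF prems(4) fv(1) P'(2) w]
  have le: "\<Phi> \<subseteq>\<^sub>m \<Phi>(w \<mapsto> u)" using w by (auto simp: map_le_def)
  have rest: "length us = length ws'" "distinct ws'" "set ws' \<inter> dom (\<Phi>(w \<mapsto> u)) = {}"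
    using prems(10-12) ws by auto
  have "[] = map (\<lambda>X. hsubst (inst_frame l (\<Phi>(w \<mapsto> u))) (the (\<theta> X))) []"
    "\<forall>X \<in> set []. the (\<theta> X) \<in> recipes \<Sigma> (dom (\<Phi>(w \<mapsto> u)))" "distinct []" "set [] \<inter> fvars2 S = {}"
    by simp_all
  from Out.IH[OF P(2) P'(1) fv(2) step(1) sat_mono[OF prems(5,4) map_le_refl le] this rest]
  obtain R' \<Phi>' S' l' where *:
    "focused OStar (P', \<Phi>(w \<mapsto> u), S) (map (Out c) ws') (R', \<Phi>', S')"
    "R = map_option (psubst l') R'" "inst_frame l' \<Phi>' = (inst_frame l (\<Phi>(w \<mapsto> u)))(ws' [\<mapsto>] us)" "l \<subseteq>\<^sub>m l'"
    "sym_inv \<Sigma> l' \<Phi>' S'" "sat \<Sigma> E \<theta> l' \<Phi>' S'" "fvars2 S' = fvars2 S"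
    "\<forall>Q. R' = Some Q \<longrightarrow> basic \<Sigma> c Q \<and> pfv Q \<subseteq> dom l'"
    unfolding list.map append_Nil list.set Un_empty_right by blast
  have wn: "w \<notin> dom \<Phi> \<union> (\<Union>k \<in> S. chandles k)"
    using w prems(4) by (auto simp: sym_inv_def)
  have "focused f (P, \<Phi>, S) (Out c w # map (Out c) ws') (R', \<Phi>', S')"
    unfolding P(1) by (rule focused.Out[OF sym_step.intros(2)[OF wn] *(1)]) (rule Out.hyps)
  then show ?case
    using *(2-8) ws Xs step(2) P(3)
    by (intro exI[of _ R'] exI[of _ \<Phi>'] exI[of _ S'] exI[of _ l']) auto
next
  case (Then u\<^sub>0 v\<^sub>0 f c P\<^sub>1 ts us R Q\<^sub>1)
  note prems = Then.prems
  obtain u v P' Q' where P: "P = Cond u v P' Q'" "P\<^sub>1 = psubst l P'" "u\<^sub>0 = vsubst l u" "v\<^sub>0 = vsubst l v"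
    using prems(1) by (cases P) auto
  have P': "basic \<Sigma> c P'" "u \<in> messages \<Sigma>" "v \<in> messages \<Sigma>"
    and fv: "tvars u \<union> tvars v \<subseteq> dom l" "pfv P' \<subseteq> dom l"
    using prems(2,3) P by auto
  let ?S = "S \<union> {Eq u v}"
  note step = sym_inv_Eq[OF prems(4) fv(1) P'(2,3)]
  have "sat \<Sigma> E \<theta> l \<Phi> ?S"
    using prems(5) Then.hyps(1) P unfolding sat_def by auto
  from Then.IH[OF P(2) P'(1) fv(2) step(1) this prems(6-8) _ prems(10-12)] prems(9)
  obtain R' \<Phi>' S' l' where *:
    "focused f (P', \<Phi>, ?S) (map (In c) Xs @ map (Out c) ws) (R', \<Phi>', S')"
    "R = map_option (psubst l') R'" "inst_frame l' \<Phi>' = (inst_frame l \<Phi>)(ws [\<mapsto>] us)" "l \<subseteq>\<^sub>m l'"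
    "sym_inv \<Sigma> l' \<Phi>' S'" "sat \<Sigma> E \<theta> l' \<Phi>' S'" "fvars2 S' = fvars2 ?S \<union> set Xs"
    "\<forall>Q. R' = Some Q \<longrightarrow> basic \<Sigma> c Q \<and> pfv Q \<subseteq> dom l'"
    by auto
  have "focused f (P, \<Phi>, S) (map (In c) Xs @ map (Out c) ws) (R', \<Phi>', S')"
    unfolding P(1) by (rule focused.Tau[OF sym_step.intros(3) *(1)])
  then show ?case
    using *(2-8) by (intro exI[of _ R'] exI[of _ \<Phi>'] exI[of _ S'] exI[of _ l']) auto
next
  case (Else u\<^sub>0 v\<^sub>0 f c Q\<^sub>1 ts us R P\<^sub>1)
  note prems = Else.prems
  obtain u v P' Q' where P: "P = Cond u v P' Q'" "Q\<^sub>1 = psubst l Q'" "u\<^sub>0 = vsubst l u" "v\<^sub>0 = vsubst l v"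
    using prems(1) by (cases P) auto
  have P': "basic \<Sigma> c Q'" "u \<in> messages \<Sigma>" "v \<in> messages \<Sigma>"
    and fv: "tvars u \<union> tvars v \<subseteq> dom l" "pfv Q' \<subseteq> dom l"
    using prems(2,3) P by auto
  let ?S = "S \<union> {Neq u v}"
  note step = sym_inv_Eq[OF prems(4) fv(1) P'(2,3)]
  have "sat \<Sigma> E \<theta> l \<Phi> ?S"
    using prems(5) Else.hyps(1) P unfolding sat_def by auto
  from Else.IH[OF P(2) P'(1) fv(2) step(2) this prems(6-8) _ prems(10-12)] prems(9)
  obtain R' \<Phi>' S' l' where *:
    "focused f (Q', \<Phi>, ?S) (map (In c) Xs @ map (Out c) ws) (R', \<Phi>', S')"
    "R = map_option (psubst l') R'" "inst_frame l' \<Phi>' = (inst_frame l \<Phi>)(ws [\<mapsto>] us)" "l \<subseteq>\<^sub>m l'"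
    "sym_inv \<Sigma> l' \<Phi>' S'" "sat \<Sigma> E \<theta> l' \<Phi>' S'" "fvars2 S' = fvars2 ?S \<union> set Xs"
    "\<forall>Q. R' = Some Q \<longrightarrow> basic \<Sigma> c Q \<and> pfv Q \<subseteq> dom l'"
    by auto
  have "focused f (P, \<Phi>, S) (map (In c) Xs @ map (Out c) ws) (R', \<Phi>', S')"
    unfolding P(1) by (rule focused.Tau[OF sym_step.intros(4) *(1)])
  then show ?case
    using *(2-8) by (intro exI[of _ R'] exI[of _ \<Phi>'] exI[of _ S'] exI[of _ l']) auto
next
  case (Proper P\<^sub>1 c)
  note prems = Proper.prems
  have "P = Null \<or> (\<exists>c x P'. P = Input c x P')"
    using Proper.hyps prems(1) by (cases P) auto
  then have "focused OStar (P, \<Phi>, S) [] (Some P, \<Phi>, S)"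
    by (rule focused.Proper)
  then show ?case
    using prems by (intro exI[of _ "Some P"] exI[of _ \<Phi>] exI[of _ S] exI[of _ l]) auto
next
  case (Improper c)
  note prems = Improper.prems
  have "P = Null" using prems(1) by (cases P) auto
  then have "focused IStar (P, \<Phi>, S) [] (None, \<Phi>, S)"
    using focused.Improper by simp
  then show ?case
    using prems by (intro exI[of _ None] exI[of _ \<Phi>] exI[of _ S] exI[of _ l]) auto
qed

section \<open>Decomposition of traces into blocks\<close>

text \<open>The end of the outputs is visible since the rest starts with an input. Without outputs,
  the inputs of a following block would be indistinguishable from those of this one, whence the
  requirement that the rest be empty then.\<close>

lemma io_append_inject:
  assumes "map (In c) Xs @ map (Out c) ws @ r = map (In c') Xs' @ map (Out c') ws' @ r'"
    and "r = [] \<or> (\<exists>d X s. r = In d X # s)" "r' = [] \<or> (\<exists>d X s. r' = In d X # s)"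
    and "ws = [] \<longrightarrow> r = []" "ws' = [] \<longrightarrow> r' = []"
  shows "Xs = Xs' \<and> ws = ws' \<and> r = r' \<and> (Xs \<noteq> [] \<longrightarrow> c = c')"
  using assms(1)
proof (induction Xs arbitrary: Xs')
  case Nil
  then have "Xs' = []"
    using assms(2,4) by (cases Xs'; cases ws) auto
  moreover have "ws = ws' \<and> r = r'" if "map (Out c) ws @ r = map (Out c') ws' @ r'"
    using that assms(2,3)
  proof (induction ws arbitrary: ws')
    case Nil
    then show ?case by (cases ws') auto
  next
    case (Cons w ws)
    obtain v vs where ws': "ws' = v # vs"
      using Cons.prems(1,3) by (cases ws') auto
    then have "w = v" and tl: "map (Out c) ws @ r = map (Out c') vs @ r'"
      using Cons.prems(1) by auto
    then show ?case using Cons.IH[OF tl assms(2,3)] ws' by simp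
  qed
  ultimately show ?case using Nil by simp
next
  case (Cons X Xs)
  obtain Y Ys where Xs': "Xs' = Y # Ys"
    using Cons.prems assms(3,5) by (cases Xs'; cases ws') auto
  then have "X = Y" "c = c'" and tl: "map (In c) Xs @ map (Out c) ws @ r = map (In c') Ys @ map (Out c') ws' @ r'"
    using Cons.prems by auto
  then show ?case using Cons.IH[OF tl] Xs' by simp
qed

lemma io_inject:
  "map (In c) Xs @ map (Out c) ws = map (In c') Xs' @ map (Out c') ws' \<Longrightarrow>
     Xs = Xs' \<and> ws = ws' \<and> (Xs \<noteq> [] \<longrightarrow> c = c')"
  using io_append_inject[of c Xs ws "[]" c' Xs' ws' "[]"] by simp

text \<open>The shape of the block lists of all executions, chosen such that
  \<open>concat (map io bs)\<close> determines \<open>bs\<close>.\<close>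

definition block_list :: "('c, 'y, 'w) block list \<Rightarrow> bool" where
  "block_list bs \<longleftrightarrow> (\<forall>b \<in> set bs. fst (snd b) \<noteq> []) \<and> (\<forall>b \<in> set (butlast bs). snd (snd b) \<noteq> [])"

lemma block_list_Cons:
  "block_list ((c, Xs, ws) # bs) \<longleftrightarrow> Xs \<noteq> [] \<and> (ws = [] \<longrightarrow> bs = []) \<and> block_list bs"
  by (cases bs) (auto simp: block_list_def)

lemma block_list_starts:
  assumes "block_list bs"
  shows "concat (map io bs) = [] \<and> bs = [] \<or> (\<exists>c X s. concat (map io bs) = In c X # s)"
proof (cases bs)
  case (Cons b bs')
  obtain c Xs ws where "b = (c, Xs, ws)" by (cases b)
  then show ?thesis using assms Cons by (cases Xs) (auto simp: block_list_Cons)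
qed simp

lemma block_list_unique:
  "block_list bs \<Longrightarrow> block_list bs' \<Longrightarrow> concat (map io bs) = concat (map io bs') \<Longrightarrow> bs = bs'"
proof (induction bs arbitrary: bs')
  case Nil
  then show ?case
    by (metis block_list_starts concat.simps(1) list.distinct(1) list.map(1))
next
  case (Cons b bs)
  obtain c Xs ws where b: "b = (c, Xs, ws)" by (cases b)
  have "bs' \<noteq> []"
    using block_list_starts[OF Cons.prems(1)] Cons.prems(3) by auto
  then obtain b' cs where bs': "bs' = b' # cs" by (cases bs') auto
  obtain c' Xs' ws' where b': "b' = (c', Xs', ws')" by (cases b')
  have vb: "Xs \<noteq> []" "ws = [] \<longrightarrow> bs = []" "block_list bs" "ws' = [] \<longrightarrow> cs = []" "block_list cs"
    using Cons.prems(1,2) unfolding b bs' b' block_list_Cons by auto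
  have "map (In c) Xs @ map (Out c) ws @ concat (map io bs) =
      map (In c') Xs' @ map (Out c') ws' @ concat (map io cs)"
    using Cons.prems(3) by (simp add: b b' bs')
  moreover have "concat (map io bs) = [] \<or> (\<exists>d X s. concat (map io bs) = In d X # s)"
    using block_list_starts[OF vb(3)] by blast
  moreover have "concat (map io cs) = [] \<or> (\<exists>d X s. concat (map io cs) = In d X # s)"
    using block_list_starts[OF vb(5)] by blast
  moreover have "ws = [] \<longrightarrow> concat (map io bs) = []" "ws' = [] \<longrightarrow> concat (map io cs) = []"
    using vb(2,4) by auto
  ultimately have "Xs = Xs' \<and> ws = ws' \<and> concat (map io bs) = concat (map io cs) \<and> (Xs \<noteq> [] \<longrightarrow> c = c')"
    by (rule io_append_inject)
  then show ?case using Cons.IH[OF vb(3,5)] vb(1) b b' bs' by simp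
qed

text \<open>A single generating step of \<open>compressed\<close>, with the proper and the improper
  case merged and the labels already grouped into a block.\<close>

inductive sym_block :: "(('f, 'x, 'w, 'n, 'c) proc multiset, 'f, 'x, 'w, 'n, 'y) sym \<Rightarrow>
    ('c, 'y, 'w) block \<Rightarrow> (('f, 'x, 'w, 'n, 'c) proc multiset, 'f, 'x, 'w, 'n, 'y) sym \<Rightarrow> bool" where
  "focused IPlus (Q, \<Phi>, S) (io (c, Xs, ws)) (R, \<Phi>', S') \<Longrightarrow>
     sym_block ({#Q#} + \<P>, \<Phi>, S) (c, Xs, ws)
       (case R of None \<Rightarrow> {#} | Some Q' \<Rightarrow> (if Q' = Null then {#} else {#Q'#}) + \<P>, \<Phi>', S')"

text \<open>For \<open>d = False\<close> this is the compressed semantics, for \<open>d = True\<close> the reduced one.\<close>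

inductive sym_run :: "bool \<Rightarrow> (('f, 'x, 'w, 'n, 'c::linorder) proc multiset, 'f, 'x, 'w, 'n, 'y) sym \<Rightarrow>
    ('c, 'y, 'w) block list \<Rightarrow> (('f, 'x, 'w, 'n, 'c) proc multiset, 'f, 'x, 'w, 'n, 'y) sym \<Rightarrow> bool"
  for d K where
  refl: "sym_run d K [] K"
| step: "sym_run d K bs (\<P>, \<Phi>, S) \<Longrightarrow> sym_block (\<P>, \<Phi>, S) (c, Xs, ws) (\<P>', \<Phi>', S') \<Longrightarrow>
     sym_run d K (bs @ [(c, Xs, ws)]) (\<P>', \<Phi>', if d then insert (Dep Xs (dep bs c)) S' else S')"

lemma sym_step_basic:
  "sym_step K a K' \<Longrightarrow> basic \<Sigma> c (fst K) \<Longrightarrow>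
     basic \<Sigma> c (fst K') \<and> (\<forall>d X. a = In d X \<longrightarrow> d = c) \<and> (\<forall>d w. a = Out d w \<longrightarrow> d = c)"
  by (induction rule: sym_step.induct) (auto intro: basic_prename)

text \<open>A basic process acts on one channel only and the focus never returns from outputs to
  inputs, so the labels form one block; it is improper exactly if the output phase is never
  entered.\<close>

lemma focused_io:
  assumes "focused f K tr K'" "basic \<Sigma> c (fst K)"
  shows "\<exists>Xs ws. tr = map (In c) Xs @ map (Out c) ws \<and> (f = OStar \<longrightarrow> Xs = []) \<and> (f = IPlus \<longrightarrow> Xs \<noteq> []) \<and>
    (fst K' = None \<longleftrightarrow> f \<noteq> OStar \<and> ws = []) \<and> (\<forall>Q. fst K' = Some Q \<longrightarrow> basic \<Sigma> c Q)"
  using assms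
proof (induction rule: focused.induct)
  case (In K d X K' tr K'' f)
  have *: "d = c" "basic \<Sigma> c (fst K')"
    using sym_step_basic[OF In.hyps(1) In.prems] by auto
  from In.IH[OF *(2)] obtain Xs ws where
    "tr = map (In c) Xs @ map (Out c) ws"
    "fst K'' = None \<longleftrightarrow> ws = []" "\<forall>Q. fst K'' = Some Q \<longrightarrow> basic \<Sigma> c Q"
    by auto
  then show ?case
    using * In.hyps(3) by (intro exI[of _ "X # Xs"] exI[of _ ws]) auto
next
  case (Out K d w K' tr K'' f)
  have *: "d = c" "basic \<Sigma> c (fst K')"
    using sym_step_basic[OF Out.hyps(1) Out.prems] by auto
  from Out.IH[OF *(2)] obtain ws where
    "tr = map (Out c) ws" "fst K'' \<noteq> None" "\<forall>Q. fst K'' = Some Q \<longrightarrow> basic \<Sigma> c Q"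
    by auto
  then show ?case
    using * Out.hyps(3) by (intro exI[of _ "[]"] exI[of _ "w # ws"]) auto
next
  case (Tau K K' f tr K'')
  show ?case
    by (rule Tau.IH) (use sym_step_basic[OF Tau.hyps(1) Tau.prems] in simp)
qed auto

text \<open>Weaker than \<open>simple_process\<close>: distinctness of the channels is forgotten,
  and what remains suffices to group labels into blocks.\<close>

definition all_basic :: "('f \<times> nat) set \<Rightarrow> ('f, 'x, 'w, 'n, 'c) proc multiset \<Rightarrow> bool" where
  "all_basic \<Sigma> \<P> \<longleftrightarrow> (\<forall>Q \<in># \<P>. \<exists>c. basic \<Sigma> c Q)"

lemma sym_block_basic:
  assumes "sym_block K (c, Xs, ws) K'" "all_basic \<Sigma> (fst K)"
  shows "all_basic \<Sigma> (fst K') \<and> Xs \<noteq> [] \<and> (ws = [] \<longrightarrow> fst K' = {#})"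
  using assms(1)
proof cases
  case (1 Q \<Phi> S R \<Phi>' S' \<P>)
  obtain e where "basic \<Sigma> e Q"
    using assms(2) 1 by (auto simp: all_basic_def)
  from focused_io[OF 1(3), of \<Sigma> e] this obtain Ys vs where
    *: "io (c, Xs, ws) = map (In e) Ys @ map (Out e) vs" "Ys \<noteq> []"
      "R = None \<longleftrightarrow> vs = []" "\<forall>Q. R = Some Q \<longrightarrow> basic \<Sigma> e Q"
    by auto
  then have "Xs = Ys" "ws = vs"
    using io_inject[of c Xs ws e Ys vs] by auto
  then show ?thesis
    using * 1 assms(2) by (auto simp: all_basic_def split: option.splits if_splits)
qed

lemma sym_run_append:
  "sym_run False K' bs' K'' \<Longrightarrow> sym_run False K bs K' \<Longrightarrow> sym_run False K (bs @ bs') K''"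
proof (induction rule: sym_run.induct)
  case (step bs' \<P> \<Phi> S c Xs ws \<P>' \<Phi>' S')
  then have "sym_run False K (bs @ bs') (\<P>, \<Phi>, S)" by simp
  from sym_run.step[OF this step.hyps(2)] show ?case by simp
qed simp

lemma sym_run_block_list:
  "sym_run d K bs K' \<Longrightarrow> all_basic \<Sigma> (fst K) \<Longrightarrow>
     all_basic \<Sigma> (fst K') \<and> block_list bs \<and> (bs \<noteq> [] \<and> snd (snd (last bs)) = [] \<longrightarrow> fst K' = {#})"
proof (induction rule: sym_run.induct)
  case (step bs \<P> \<Phi> S c Xs ws \<P>' \<Phi>' S')
  have IH: "all_basic \<Sigma> \<P>" "block_list bs" "bs \<noteq> [] \<and> snd (snd (last bs)) = [] \<longrightarrow> \<P> = {#}"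
    using step.IH[OF step.prems] by auto
  have "\<P> \<noteq> {#}"
    using step.hyps(2) by cases auto
  then have last: "bs \<noteq> [] \<longrightarrow> snd (snd (last bs)) \<noteq> []"
    using IH(3) by blast
  have "snd (snd b) \<noteq> []" if "b \<in> set bs" for b
  proof -
    have "bs \<noteq> []" using that by auto
    then have "set bs = insert (last bs) (set (butlast bs))"
      using append_butlast_last_id[of bs] by (metis list.simps(15) rotate1.simps(2) set_rotate1)
    then show ?thesis
      using that IH(2) last \<open>bs \<noteq> []\<close> by (auto simp: block_list_def)
  qed
  then have "block_list (bs @ [(c, Xs, ws)])"
    using IH(2) sym_block_basic[OF step.hyps(2), of \<Sigma>] IH(1) by (auto simp: block_list_def)
  then show ?case
    using sym_block_basic[OF step.hyps(2), of \<Sigma>] IH(1) by auto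
qed (auto simp: block_list_def)

lemma compressed_sym_run:
  fixes K :: "(('f, 'x, 'w, 'n, 'c::linorder) proc multiset, 'f, 'x, 'w, 'n, 'y) sym"
  shows "compressed K tr K' \<Longrightarrow> all_basic \<Sigma> (fst K) \<Longrightarrow> \<exists>bs. tr = concat (map io bs) \<and> sym_run False K bs K'"
proof (induction rule: compressed.induct)
  case (refl K)
  show ?case by (intro exI[of _ "[]"]) (auto intro: sym_run.refl)
next
  case (trans K tr K' tr' K'')
  from trans.IH(1)[OF trans.prems] obtain bs where bs: "tr = concat (map io bs)" "sym_run False K bs K'"
    by blast
  then have "all_basic \<Sigma> (fst K')"
    using sym_run_block_list trans.prems by blast
  from trans.IH(2)[OF this] obtain bs' where "tr' = concat (map io bs')" "sym_run False K' bs' K''"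
    by blast
  with bs show ?case
    by (intro exI[of _ "bs @ bs'"]) (auto intro: sym_run_append)
next
  case (proper Q \<Phi> S tr Q' \<Phi>' S' \<P>)
  obtain c where "basic \<Sigma> c Q" using proper.prems by (auto simp: all_basic_def)
  with focused_io[OF proper.hyps] obtain Xs ws where tr: "tr = io (c, Xs, ws)"
    by fastforce
  have "sym_run False ({#Q#} + \<P>, \<Phi>, S) ([] @ [(c, Xs, ws)])
      ((if Q' = Null then {#} else {#Q'#}) + \<P>, \<Phi>', S')"
    using sym_run.step[OF sym_run.refl sym_block.intros[OF proper.hyps[unfolded tr], of \<P>], of False] by simp
  then show ?case
    using tr by (intro exI[of _ "[(c, Xs, ws)]"]) simp
next
  case (improper Q \<Phi> S tr \<Phi>' S' \<P>)
  obtain c where "basic \<Sigma> c Q" using improper.prems by (auto simp: all_basic_def)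
  with focused_io[OF improper.hyps] obtain Xs ws where tr: "tr = io (c, Xs, ws)"
    by fastforce
  have "sym_run False ({#Q#} + \<P>, \<Phi>, S) ([] @ [(c, Xs, ws)]) ({#}, \<Phi>', S')"
    using sym_run.step[OF sym_run.refl sym_block.intros[OF improper.hyps[unfolded tr], of \<P>], of False] by simp
  then show ?case
    using tr by (intro exI[of _ "[(c, Xs, ws)]"]) simp
qed

lemma sym_block_compressed: "sym_block K b K' \<Longrightarrow> compressed K (io b) K'"
proof (induction rule: sym_block.induct)
  case (1 Q \<Phi> S c Xs ws R \<Phi>' S' \<P>)
  show ?case
  proof (cases R)
    case None
    show ?thesis using compressed.improper[OF 1[unfolded None], of \<P>] None by simp
  next
    case (Some Q')
    show ?thesis using compressed.proper[OF 1[unfolded Some], of \<P>] Some by simp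
  qed
qed

lemma sym_run_compressed: "sym_run False K bs K' \<Longrightarrow> compressed K (concat (map io bs)) K'"
proof (induction rule: sym_run.induct)
  case (step bs \<P> \<Phi> S c Xs ws \<P>' \<Phi>' S')
  then show ?case
    using compressed.trans[OF step.IH sym_block_compressed[OF step.hyps(2)]] by simp
qed (simp add: compressed.refl)

lemma compressed_iff_sym_run:
  fixes K :: "(('f, 'x, 'w, 'n, 'c::linorder) proc multiset, 'f, 'x, 'w, 'n, 'y) sym"
  assumes "all_basic \<Sigma> (fst K)"
  shows "compressed K tr K' \<longleftrightarrow> (\<exists>bs. tr = concat (map io bs) \<and> sym_run False K bs K')"
  using compressed_sym_run[OF _ assms] sym_run_compressed by blast

text \<open>A priori the closure \<open>compressed\<close> could produce the labels of one block in
  several steps; uniqueness of the decomposition into blocks excludes this.\<close>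

lemma compressed_sym_block:
  fixes K :: "(('f, 'x, 'w, 'n, 'c::linorder) proc multiset, 'f, 'x, 'w, 'n, 'y) sym"
  assumes "compressed K (io (c, Xs, ws)) K'" "Xs \<noteq> []" "all_basic \<Sigma> (fst K)"
  shows "sym_block K (c, Xs, ws) K'"
proof -
  obtain bs where bs: "io (c, Xs, ws) = concat (map io bs)" "sym_run False K bs K'"
    using compressed_sym_run[OF assms(1,3)] by blast
  have "block_list [(c, Xs, ws)]"
    using assms(2) by (simp add: block_list_def)
  moreover have "block_list bs"
    using sym_run_block_list[OF bs(2) assms(3)] by blast
  ultimately have "[(c, Xs, ws)] = bs"
    using bs(1) by (intro block_list_unique) auto
  with bs(2) have "sym_run False K [(c, Xs, ws)] K'" by simp
  then show ?thesis
  proof cases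
    case (step bs' \<P> \<Phi> S d Ys vs \<P>' \<Phi>' S')
    then have "bs' = []" "(d, Ys, vs) = (c, Xs, ws)" by (auto simp: Cons_eq_append_conv)
    with step(3) have "K = (\<P>, \<Phi>, S)"
      by (auto elim: sym_run.cases)
    with step \<open>(d, Ys, vs) = (c, Xs, ws)\<close> show ?thesis by simp
  qed
qed

lemma reduced_blocks_iff_sym_run:
  assumes "all_basic \<Sigma> \<P>"
  shows "reduced_blocks (\<P>, \<Phi>, {}) bs K' \<longleftrightarrow> sym_run True (\<P>, \<Phi>, {}) bs K'"
proof
  assume "reduced_blocks (\<P>, \<Phi>, {}) bs K'"
  then show "sym_run True (\<P>, \<Phi>, {}) bs K'"
    using assms
  proof (induction "(\<P>, \<Phi>, {} :: ('a, 'b, 'c, 'd, 'f) constr set)" bs K' rule: reduced_blocks.induct)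
    case (step bs \<P>' \<Phi>' S' c Xs ws \<P>'' \<Phi>'' S'')
    then have run: "sym_run True (\<P>, \<Phi>, {}) bs (\<P>', \<Phi>', S')" by simp
    with step have "all_basic \<Sigma> \<P>'"
      using sym_run_block_list[OF run, of \<Sigma>] by simp
    then have "sym_block (\<P>', \<Phi>', S') (c, Xs, ws) (\<P>'', \<Phi>'', S'')"
      using step.hyps by (intro compressed_sym_block) auto
    from sym_run.step[OF run this] show ?case by simp
  qed (rule sym_run.refl)
next
  assume "sym_run True (\<P>, \<Phi>, {}) bs K'"
  then show "reduced_blocks (\<P>, \<Phi>, {}) bs K'"
  proof (induction rule: sym_run.induct)
    case (step bs \<P>' \<Phi>' S' c Xs ws \<P>'' \<Phi>'' S'')
    have "all_basic \<Sigma> \<P>'"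
      using sym_run_block_list[OF step.hyps(1), of \<Sigma>] assms by simp
    then have "Xs \<noteq> []"
      using sym_block_basic[OF step.hyps(2)] by simp
    from reduced_blocks.step[OF step.IH sym_block_compressed[OF step.hyps(2)] this] show ?case by simp
  qed (rule reduced_blocks.refl)
qed

section \<open>Ground executions\<close>

text \<open>In a ground configuration every channel carries at most one basic process, and \<open>Null\<close> stands
  for its absence.\<close>

inductive ground_block :: "('f \<times> nat) set \<Rightarrow> ('f, 'x, 'w, 'n) equations \<Rightarrow> ('y \<rightharpoonup> ('f, 'x, 'w, 'n) tm) \<Rightarrow>
    ('c \<Rightarrow> ('f, 'x, 'w, 'n, 'c) proc) \<times> ('f, 'x, 'w, 'n) frame \<Rightarrow> ('c, 'y, 'w) block \<Rightarrow>
    ('c \<Rightarrow> ('f, 'x, 'w, 'n, 'c) proc) \<times> ('f, 'x, 'w, 'n) frame \<Rightarrow> bool"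
  for \<Sigma> E \<theta> where
  "Xs \<noteq> [] \<Longrightarrow> \<forall>X \<in> set Xs. the (\<theta> X) \<in> recipes \<Sigma> (dom \<Phi>) \<Longrightarrow> distinct ws \<Longrightarrow>
     set ws \<inter> dom \<Phi> = {} \<Longrightarrow> length us = length ws \<Longrightarrow>
     exec_block \<Sigma> E IPlus c (C c) (map (\<lambda>X. hsubst \<Phi> (the (\<theta> X))) Xs) us R \<Longrightarrow>
     ground_block \<Sigma> E \<theta> (C, \<Phi>) (c, Xs, ws)
       (case R of None \<Rightarrow> (\<lambda>_. Null) | Some Q \<Rightarrow> C(c := Q), \<Phi>(ws [\<mapsto>] us))"

primrec ground_run :: "('f \<times> nat) set \<Rightarrow> ('f, 'x, 'w, 'n) equations \<Rightarrow> ('y \<rightharpoonup> ('f, 'x, 'w, 'n) tm) \<Rightarrow>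
    ('c \<Rightarrow> ('f, 'x, 'w, 'n, 'c) proc) \<times> ('f, 'x, 'w, 'n) frame \<Rightarrow> ('c, 'y, 'w) block list \<Rightarrow>
    ('c \<Rightarrow> ('f, 'x, 'w, 'n, 'c) proc) \<times> ('f, 'x, 'w, 'n) frame \<Rightarrow> bool" where
  "ground_run \<Sigma> E \<theta> K [] K' \<longleftrightarrow> K' = K"
| "ground_run \<Sigma> E \<theta> K (b # bs) K' \<longleftrightarrow> (\<exists>K\<^sub>1. ground_block \<Sigma> E \<theta> K b K\<^sub>1 \<and> ground_run \<Sigma> E \<theta> K\<^sub>1 bs K')"

lemma ground_run_append:
  "ground_run \<Sigma> E \<theta> K (bs @ bs') K' \<longleftrightarrow> (\<exists>K\<^sub>1. ground_run \<Sigma> E \<theta> K bs K\<^sub>1 \<and> ground_run \<Sigma> E \<theta> K\<^sub>1 bs' K')"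
  by (induction bs arbitrary: K) auto

lemma ground_run_snoc:
  "ground_run \<Sigma> E \<theta> K (bs @ [b]) K' \<longleftrightarrow> (\<exists>K\<^sub>1. ground_run \<Sigma> E \<theta> K bs K\<^sub>1 \<and> ground_block \<Sigma> E \<theta> K\<^sub>1 b K')"
  by (simp add: ground_run_append del: split_paired_Ex)

lemma ground_block_deterministic:
  assumes "ground_block \<Sigma> E \<theta> K b K\<^sub>1" "ground_block \<Sigma> E \<theta> K b K\<^sub>2"
  shows "K\<^sub>1 = K\<^sub>2"
  using assms(1)
proof cases
  case (1 Xs \<Phi> ws us c C R)
  note a = 1
  from assms(2) show ?thesis
  proof cases
    case (1 Xs' \<Phi>' ws' us' c' C' R')
    then have "exec_block \<Sigma> E IPlus c (C c) (map (\<lambda>X. hsubst \<Phi> (the (\<theta> X))) Xs) us' R'" "length us = length us'"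
      using a by auto
    from exec_block_deterministic[OF a(9) this] show ?thesis
      using a 1 by auto
  qed
qed

lemma ground_run_deterministic:
  "ground_run \<Sigma> E \<theta> K bs K\<^sub>1 \<Longrightarrow> ground_run \<Sigma> E \<theta> K bs K\<^sub>2 \<Longrightarrow> K\<^sub>1 = K\<^sub>2"
  by (induction bs arbitrary: K) (auto dest: ground_block_deterministic)

lemma ground_block_nonnull: "ground_block \<Sigma> E \<theta> K b K' \<Longrightarrow> fst K (fst b) \<noteq> Null"
  by (auto elim!: ground_block.cases elim: exec_block.cases)

lemma ground_run_block_list: "ground_run \<Sigma> E \<theta> K bs K' \<Longrightarrow> block_list bs"
proof (induction bs arbitrary: K)
  case Nil
  then show ?case by (simp add: block_list_def)
next
  case (Cons b bs)
  obtain c Xs ws where b: "b = (c, Xs, ws)" by (cases b)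
  from Cons.prems obtain K\<^sub>1 where K: "ground_block \<Sigma> E \<theta> K (c, Xs, ws) K\<^sub>1" "ground_run \<Sigma> E \<theta> K\<^sub>1 bs K'"
    unfolding b by auto
  have "Xs \<noteq> []" using K(1) by cases auto
  moreover have "bs = []" if "ws = []"
  proof (rule ccontr)
    assume "bs \<noteq> []"
    then obtain b' bs' where "bs = b' # bs'" by (cases bs) auto
    then obtain K\<^sub>2 where *: "ground_block \<Sigma> E \<theta> K\<^sub>1 b' K\<^sub>2" using K(2) by auto
    have "fst K\<^sub>1 = (\<lambda>_. Null)"
      using K(1)
    proof cases
      case (1 \<Phi> us C R)
      then have "R = None" using that exec_block_no_output[OF 1(8)] by simp
      then show ?thesis using 1 by simp
    qed
    then show False
      using ground_block_nonnull[OF *] by simp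
  qed
  ultimately show ?case
    using Cons.IH[OF K(2)] by (simp add: b block_list_Cons)
qed

section \<open>Variables, handles and dependency constraints of block lists\<close>

abbreviation bvars :: "('c, 'y, 'w) block list \<Rightarrow> 'y list" where
  "bvars bs \<equiv> concat (map (\<lambda>b. fst (snd b)) bs)"

abbreviation bhandles :: "('c, 'y, 'w) block list \<Rightarrow> 'w set" where
  "bhandles bs \<equiv> (\<Union>b \<in> set bs. set (snd (snd b)))"

text \<open>All dependency constraints of a reduced run, read off from the blocks without reference
  to any process; hence they coincide for \<open>A\<close> and \<open>B\<close> on equal
  blocks.\<close>

definition deps_sat :: "('y \<rightharpoonup> ('f, 'x, 'w, 'n) tm) \<Rightarrow> ('c::linorder, 'y, 'w) block list \<Rightarrow> bool" where
  "deps_sat \<theta> bs \<longleftrightarrow> (\<forall>i < length bs. sat_dep \<theta> (fst (snd (bs ! i))) (dep (take i bs) (fst (bs ! i))))"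

lemma deps_sat_snoc:
  "deps_sat \<theta> (bs @ [b]) \<longleftrightarrow> deps_sat \<theta> bs \<and> sat_dep \<theta> (fst (snd b)) (dep bs (fst b))"
  unfolding deps_sat_def by (auto simp: nth_append less_Suc_eq)

lemma dep_bhandles: "dep bs c \<subseteq> bhandles bs"
  by (force simp: dep_def in_set_conv_nth)

section \<open>Multisets of processes as processes indexed by channels\<close>

definition support :: "('c \<Rightarrow> ('f, 'x, 'w, 'n, 'c) proc) \<Rightarrow> 'c set" where
  "support C = {c. C c \<noteq> Null}"

definition proc_mset :: "('c \<Rightarrow> ('f, 'x, 'w, 'n, 'c) proc) \<Rightarrow> ('f, 'x, 'w, 'n, 'c) proc multiset" where
  "proc_mset C = image_mset C (mset_set (support C))"

lemma proc_mset_remove: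
  assumes "finite (support C)" "C c \<noteq> Null"
  shows "proc_mset C = {#C c#} + image_mset C (mset_set (support C - {c}))"
proof -
  have "c \<in> support C" using assms(2) by (simp add: support_def)
  then have "mset_set (support C) = {#c#} + mset_set (support C - {c})"
    using assms(1) by (simp add: mset_set.remove)
  then show ?thesis by (simp add: proc_mset_def)
qed

lemma proc_mset_upd:
  assumes "finite (support C)"
  shows "finite (support (C(c := Q)))"
    "proc_mset (C(c := Q)) = (if Q = Null then {#} else {#Q#}) + image_mset C (mset_set (support C - {c}))"
proof -
  have supp: "support (C(c := Q)) = (if Q = Null then support C - {c} else insert c (support C - {c}))"
    by (auto simp: support_def)
  then show "finite (support (C(c := Q)))" using assms by simp
  have img: "image_mset (C(c := Q)) (mset_set (support C - {c})) = image_mset C (mset_set (support C - {c}))"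
    using assms by (intro image_mset_cong) auto
  have "mset_set (insert c (support C - {c})) = add_mset c (mset_set (support C - {c}))"
    using assms by (intro mset_set.insert) auto
  then show "proc_mset (C(c := Q)) = (if Q = Null then {#} else {#Q#}) + image_mset C (mset_set (support C - {c}))"
    using img supp unfolding proc_mset_def by (cases "Q = Null") (simp_all del: insert_Diff_single)
qed

text \<open>\<open>D\<close> distributes the symbolic processes over channels, and \<open>G\<close>
  is its instance under \<open>l\<close>. The multiset \<open>\<P>\<close> does not record which
  process sits on which channel; the index makes the process executing a block a function of the
  block.\<close>

definition instance_of :: "('f \<times> nat) set \<Rightarrow> ('x \<rightharpoonup> ('f, 'x, 'w, 'n) tm) \<Rightarrow>
    (('f, 'x, 'w, 'n, 'c) proc multiset, 'f, 'x, 'w, 'n, 'y) sym \<Rightarrow>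
    ('c \<Rightarrow> ('f, 'x, 'w, 'n, 'c) proc) \<times> ('f, 'x, 'w, 'n) frame \<Rightarrow> bool" where
  "instance_of \<Sigma> l K G \<longleftrightarrow> (case (K, G) of ((\<P>, \<Phi>, S), (C, \<Phi>\<^sub>g)) \<Rightarrow>
     \<exists>D. finite (support D) \<and> \<P> = proc_mset D \<and> (\<forall>c. basic \<Sigma> c (D c) \<and> pfv (D c) \<subseteq> dom l) \<and>
       C = (\<lambda>c. psubst l (D c)) \<and> \<Phi>\<^sub>g = inst_frame l \<Phi> \<and> sym_inv \<Sigma> l \<Phi> S)"

lemma psubst_mono:
  assumes "l \<subseteq>\<^sub>m l'" "pfv P \<subseteq> dom l"
  shows "psubst l' P = psubst l P"
  using assms by (intro psubst_cong) (metis map_le_def subsetD)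

lemma instance_of_step:
  assumes "finite (support D)" "\<forall>c. basic \<Sigma> c (D c) \<and> pfv (D c) \<subseteq> dom l" "l \<subseteq>\<^sub>m l'"
    and "\<forall>Q. R = Some Q \<longrightarrow> basic \<Sigma> c Q \<and> pfv Q \<subseteq> dom l'" "sym_inv \<Sigma> l' \<Phi>' S'"
  shows "instance_of \<Sigma> l' (case R of None \<Rightarrow> {#} | Some Q' \<Rightarrow>
        (if Q' = Null then {#} else {#Q'#}) + image_mset D (mset_set (support D - {c})), \<Phi>', S')
      (case map_option (psubst l') R of None \<Rightarrow> (\<lambda>_. Null) | Some Q \<Rightarrow> (\<lambda>c. psubst l (D c))(c := Q), inst_frame l' \<Phi>')"
proof (cases R)
  case None
  have "support (\<lambda>_. Null :: ('b, 'c, 'd, 'e, 'a) proc) = ({} :: 'a set)"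
    by (simp add: support_def)
  with None show ?thesis
    using assms(5) by (auto simp: instance_of_def proc_mset_def intro!: exI[of _ "\<lambda>_. Null"])
next
  case (Some Q)
  have "pfv (D d) \<subseteq> dom l'" for d
    using assms(2) map_le_implies_dom_le[OF assms(3)] by (meson order_trans)
  moreover have "psubst l' (D d) = psubst l (D d)" for d
    using assms(2,3) by (intro psubst_mono) auto
  ultimately show ?thesis
    unfolding instance_of_def prod.case using assms(2,4,5) proc_mset_upd[OF assms(1), of c Q] Some
    by (intro exI[of _ "D(c := Q)"]) (simp add: fun_eq_iff)
qed

lemma sym_block_mono: "sym_block (\<P>, \<Phi>, S) b (\<P>', \<Phi>', S') \<Longrightarrow> \<Phi> \<subseteq>\<^sub>m \<Phi>' \<and> S \<subseteq> S'"
  by (auto elim!: sym_block.cases dest!: focused_mono)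

lemma sym_block_imp_ground_block:
  assumes "instance_of \<Sigma> l (\<P>, \<Phi>, S) G" "sym_block (\<P>, \<Phi>, S) (c, Xs, ws) (\<P>', \<Phi>', S')"
    and "sat \<Sigma> E \<theta> m \<Psi> T" "\<Phi>' \<subseteq>\<^sub>m \<Psi>" "S' \<subseteq> T" "(\<Union>k \<in> T. cvars k) \<subseteq> dom m" "agree \<Sigma> E l m"
  shows "\<exists>l' G'. ground_block \<Sigma> E \<theta> G (c, Xs, ws) G' \<and> instance_of \<Sigma> l' (\<P>', \<Phi>', S') G' \<and> agree \<Sigma> E l' m \<and>
    distinct Xs \<and> set Xs \<inter> fvars2 S = {} \<and> fvars2 S' = fvars2 S \<union> set Xs \<and>
    set ws \<subseteq> dom \<Phi>'"
proof -
  obtain D where D: "finite (support D)" "\<P> = proc_mset D" "\<forall>c. basic \<Sigma> c (D c) \<and> pfv (D c) \<subseteq> dom l"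
    and G: "G = (\<lambda>c. psubst l (D c), inst_frame l \<Phi>)" and inv: "sym_inv \<Sigma> l \<Phi> S"
    using assms(1) by (cases G) (auto simp: instance_of_def)
  from assms(2) show ?thesis
  proof cases
    case (1 Q R \<P>\<^sub>0)
    have "Q \<in># proc_mset D" using 1(1) D(2) by simp
    then obtain e where e: "Q = D e" "D e \<noteq> Null"
      using D(1) by (auto simp: proc_mset_def support_def)
    obtain Xs' ws' us l' where *: "io (c, Xs, ws) = map (In e) Xs' @ map (Out e) ws'" "length us = length ws'"
      "Xs' \<noteq> []" "\<forall>X \<in> set Xs'. the (\<theta> X) \<in> recipes \<Sigma> (dom \<Phi>)"
      "distinct Xs'" "set Xs' \<inter> fvars2 S = {}" "fvars2 S' = fvars2 S \<union> set Xs'"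
      "distinct ws'" "set ws' \<inter> dom \<Phi> = {}"
      "exec_block \<Sigma> E IPlus e (psubst l Q) (map (\<lambda>X. hsubst (inst_frame l \<Phi>) (the (\<theta> X))) Xs') us (map_option (psubst l') R)"
      "inst_frame l' \<Phi>' = (inst_frame l \<Phi>)(ws' [\<mapsto>] us)" "l \<subseteq>\<^sub>m l'" "sym_inv \<Sigma> l' \<Phi>' S'"
      "agree \<Sigma> E l' m" "\<forall>Q. R = Some Q \<longrightarrow> basic \<Sigma> e Q \<and> pfv Q \<subseteq> dom l'"
      using focused_imp_exec_block[OF 1(3) _ _ inv assms(3-7), of e] D(3) e by auto
    \<comment> \<open>Since there is at least one input, the labels reveal the channel: the process
      taken from the multiset is the one stored at channel \<open>c\<close> of the block.\<close>
    have eq: "Xs' = Xs" "ws' = ws" "e = c"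
      using io_inject[of c Xs ws e Xs' ws'] *(1,3) by auto
    have \<P>\<^sub>0: "\<P>\<^sub>0 = image_mset D (mset_set (support D - {c}))"
      using 1(1) D(2) proc_mset_remove[OF D(1) e(2)] e eq by simp
    have exec_block: "exec_block \<Sigma> E IPlus c ((\<lambda>c. psubst l (D c)) c) (map (\<lambda>X. hsubst (inst_frame l \<Phi>) (the (\<theta> X))) Xs) us (map_option (psubst l') R)"
      using *(10) e eq by simp
    have "ground_block \<Sigma> E \<theta> G (c, Xs, ws) (case map_option (psubst l') R of None \<Rightarrow> (\<lambda>_. Null) |
        Some Q \<Rightarrow> (\<lambda>c. psubst l (D c))(c := Q), (inst_frame l \<Phi>)(ws [\<mapsto>] us))"
      unfolding G by (rule ground_block.intros[where C = "\<lambda>c. psubst l (D c)"]) (use * eq exec_block in auto)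
    moreover have "instance_of \<Sigma> l' (\<P>', \<Phi>', S') (case map_option (psubst l') R of None \<Rightarrow> (\<lambda>_. Null) |
        Some Q \<Rightarrow> (\<lambda>c. psubst l (D c))(c := Q), inst_frame l' \<Phi>')"
      unfolding 1(2) \<P>\<^sub>0 by (rule instance_of_step[OF D(1,3) *(12) _ *(13)]) (use *(15) eq in auto)
    moreover have "set ws \<subseteq> dom \<Phi>'"
    proof -
      have "dom \<Phi>' = dom ((inst_frame l \<Phi>)(ws [\<mapsto>] us))"
        using *(11) eq by (metis inst_frame_dom)
      then show ?thesis using *(2) eq by simp
    qed
    ultimately show ?thesis
      using * eq by (intro exI conjI) auto
  qed
qed

lemma ground_block_imp_sym_block:
  fixes l :: "'x::infinite \<rightharpoonup> ('f, 'x, 'w, 'n) tm"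
  assumes "instance_of \<Sigma> l (\<P>, \<Phi>, S) G" "sat \<Sigma> E \<theta> l \<Phi> S" "ground_block \<Sigma> E \<theta> G (c, Xs, ws) G'"
    and "distinct Xs" "set Xs \<inter> fvars2 S = {}"
  shows "\<exists>l' \<P>' \<Phi>' S'. sym_block (\<P>, \<Phi>, S) (c, Xs, ws) (\<P>', \<Phi>', S') \<and> instance_of \<Sigma> l' (\<P>', \<Phi>', S') G' \<and>
    sat \<Sigma> E \<theta> l' \<Phi>' S' \<and> fvars2 S' = fvars2 S \<union> set Xs \<and> \<Phi> \<subseteq>\<^sub>m \<Phi>' \<and> set ws \<subseteq> dom \<Phi>'"
proof -
  obtain D where D: "finite (support D)" "\<P> = proc_mset D" "\<forall>c. basic \<Sigma> c (D c) \<and> pfv (D c) \<subseteq> dom l"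
    and G: "G = (\<lambda>c. psubst l (D c), inst_frame l \<Phi>)" and inv: "sym_inv \<Sigma> l \<Phi> S"
    using assms(1) by (cases G) (auto simp: instance_of_def)
  have "D c \<noteq> Null"
    using ground_block_nonnull[OF assms(3)] unfolding G by simp
  from assms(3)[unfolded G] show ?thesis
  proof cases
    case (1 us R)
    obtain R' \<Phi>' S' l' where *: "focused IPlus (D c, \<Phi>, S) (map (In c) Xs @ map (Out c) ws) (R', \<Phi>', S')"
      "R = map_option (psubst l') R'" "inst_frame l' \<Phi>' = (inst_frame l \<Phi>)(ws [\<mapsto>] us)" "l \<subseteq>\<^sub>m l'"
      "sym_inv \<Sigma> l' \<Phi>' S'" "sat \<Sigma> E \<theta> l' \<Phi>' S'" "fvars2 S' = fvars2 S \<union> set Xs"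
      "\<forall>Q. R' = Some Q \<longrightarrow> basic \<Sigma> c Q \<and> pfv Q \<subseteq> dom l'"
      using exec_block_imp_focused[OF 1(7) HOL.refl _ _ inv assms(2) HOL.refl _ assms(4,5) 1(6)] 1 D(3) by auto
    have "sym_block ({#D c#} + image_mset D (mset_set (support D - {c})), \<Phi>, S) (c, Xs, ws)
      (case R' of None \<Rightarrow> {#} | Some Q' \<Rightarrow>
        (if Q' = Null then {#} else {#Q'#}) + image_mset D (mset_set (support D - {c})), \<Phi>', S')"
      by (rule sym_block.intros) (use *(1) in simp)
    then have blk: "sym_block (\<P>, \<Phi>, S) (c, Xs, ws)
      (case R' of None \<Rightarrow> {#} | Some Q' \<Rightarrow>
        (if Q' = Null then {#} else {#Q'#}) + image_mset D (mset_set (support D - {c})), \<Phi>', S')"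
      using D(2) proc_mset_remove[OF D(1) \<open>D c \<noteq> Null\<close>] by simp
    have instance_of: "instance_of \<Sigma> l' (case R' of None \<Rightarrow> {#} | Some Q' \<Rightarrow>
        (if Q' = Null then {#} else {#Q'#}) + image_mset D (mset_set (support D - {c})), \<Phi>', S') G'"
      unfolding 1(1) *(2) *(3)[symmetric] by (rule instance_of_step[OF D(1,3) *(4) *(8,5)])
    have "dom \<Phi>' = dom ((inst_frame l \<Phi>)(ws [\<mapsto>] us))"
      using *(3) by (metis inst_frame_dom)
    then have "set ws \<subseteq> dom \<Phi>'" using 1(6) by simp
    then show ?thesis
      using blk instance_of * sym_block_mono[OF blk] by blast
  qed
qed

text \<open>At the moment a dependency constraint is added, its recipe variables and handles have
  already been introduced, so the invariant survives.\<close>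

lemma instance_of_Dep:
  assumes "instance_of \<Sigma> l (\<P>, \<Phi>, S) G" "set Xs \<subseteq> fvars2 S" "W \<subseteq> dom \<Phi>"
  shows "instance_of \<Sigma> l (\<P>, \<Phi>, insert (Dep Xs W) S) G"
proof -
  have "sym_inv \<Sigma> l \<Phi> (insert (Dep Xs W) S)" if "sym_inv \<Sigma> l \<Phi> S"
    using that assms(2,3) unfolding sym_inv_def by auto
  then show ?thesis
    using assms(1) by (cases G) (auto simp: instance_of_def)
qed

lemma sat_Dep [simp]: "sat \<Sigma> E \<theta> l \<Phi> (insert (Dep Xs W) S) \<longleftrightarrow> sat \<Sigma> E \<theta> l \<Phi> S"
  by (simp add: sat_def)

lemma focused_Dep: "focused f K tr K' \<Longrightarrow> Dep Xs W \<in> snd (snd K') \<longleftrightarrow> Dep Xs W \<in> snd (snd K)"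
proof (induction rule: focused.induct)
  case (In K c X K' tr K'' f)
  from In.hyps(1) In.IH show ?case by cases auto
next
  case (Out K c w K' tr K'' f)
  from Out.hyps(1) Out.IH show ?case by cases auto
next
  case (Tau K K' f tr K'')
  from Tau.hyps(1) Tau.IH show ?case by cases auto
qed auto

text \<open>Focused steps create no dependency constraints, and the one added after a block of the
  reduced run is precisely the conjunct of \<open>deps_sat\<close> for that block.\<close>

lemma sym_run_deps:
  "sym_run d (\<P>\<^sub>0, \<Phi>\<^sub>0, {}) bs K \<Longrightarrow>
     if d then (\<forall>Xs W. Dep Xs W \<in> snd (snd K) \<longrightarrow> sat_dep \<theta> Xs W) \<longleftrightarrow> deps_sat \<theta> bs
     else \<forall>Xs W. Dep Xs W \<notin> snd (snd K)"
proof (induction rule: sym_run.induct)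
  case refl
  show ?case by (simp add: deps_sat_def)
next
  case (step bs \<P> \<Phi> S c Xs ws \<P>' \<Phi>' S')
  have "Dep Ys W \<in> S' \<longleftrightarrow> Dep Ys W \<in> S" for Ys W
    using step.hyps(2) by cases (auto dest: focused_Dep)
  then show ?case using step.IH by (auto simp: deps_sat_snoc)
qed

text \<open>The solution belongs to the last system of a complete run. It is therefore given for
  arbitrary \<open>\<Psi>\<close> and \<open>T\<close> extending the current system, which lets the
  induction pass to prefixes of the run.\<close>

lemma sym_run_imp_ground_run:
  fixes S :: "('f, 'x, 'w, 'n, 'y) constr set"
  assumes "sym_run d (\<P>\<^sub>0, \<Phi>\<^sub>0, {}) bs (\<P>, \<Phi>, S)"
    and "instance_of \<Sigma> Map.empty (\<P>\<^sub>0, \<Phi>\<^sub>0, {} :: ('f, 'x, 'w, 'n, 'y) constr set) G\<^sub>0"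
    and "sat \<Sigma> E \<theta> m \<Psi> T" "\<Phi> \<subseteq>\<^sub>m \<Psi>" "S \<subseteq> T" "(\<Union>k \<in> T. cvars k) \<subseteq> dom m"
  shows "\<exists>l G. ground_run \<Sigma> E \<theta> G\<^sub>0 bs G \<and> instance_of \<Sigma> l (\<P>, \<Phi>, S) G \<and> agree \<Sigma> E l m \<and>
    distinct (bvars bs) \<and> fvars2 S = set (bvars bs) \<and> bhandles bs \<subseteq> dom \<Phi>"
  using assms(1,4,5)
proof (induction bs "(\<P>, \<Phi>, S)" arbitrary: \<P> \<Phi> S rule: sym_run.induct)
  case refl
  have "agree \<Sigma> E Map.empty m" by (simp add: agree_def)
  then show ?case using assms(2)
    by (intro exI[of _ Map.empty] exI[of _ G\<^sub>0]) (auto simp: fvars2_def)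
next
  case (step bs \<P> \<Phi> S c Xs ws \<P>' \<Phi>' S')
  have sub: "S' \<subseteq> T" using step.prems(2) by (auto split: if_splits)
  have "\<Phi> \<subseteq>\<^sub>m \<Psi>" "S \<subseteq> T"
    using sym_block_mono[OF step.hyps(3)] step.prems(1) sub by (auto intro: map_le_trans)
  from step.hyps(2)[OF this] obtain l G where
    IH: "ground_run \<Sigma> E \<theta> G\<^sub>0 bs G" "instance_of \<Sigma> l (\<P>, \<Phi>, S) G" "agree \<Sigma> E l m"
      "distinct (bvars bs)" "fvars2 S = set (bvars bs)" "bhandles bs \<subseteq> dom \<Phi>"
    by blast
  from sym_block_imp_ground_block[OF IH(2) step.hyps(3) assms(3) step.prems(1) sub assms(6) IH(3)] obtain l' G' where
    *: "ground_block \<Sigma> E \<theta> G (c, Xs, ws) G'" "instance_of \<Sigma> l' (\<P>', \<Phi>', S') G'" "agree \<Sigma> E l' m"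
      "distinct Xs" "set Xs \<inter> fvars2 S = {}" "fvars2 S' = fvars2 S \<union> set Xs"
      "set ws \<subseteq> dom \<Phi>'"
    by blast
  let ?S = "if d then insert (Dep Xs (dep bs c)) S' else S'"
  have h: "bhandles bs \<subseteq> dom \<Phi>'"
    using IH(6) map_le_implies_dom_le[OF conjunct1[OF sym_block_mono[OF step.hyps(3)]]] by blast
  have "instance_of \<Sigma> l' (\<P>', \<Phi>', ?S) G'"
    using *(2) instance_of_Dep[OF *(2), of Xs "dep bs c"] *(6) h dep_bhandles[of bs c] by auto
  moreover have "ground_run \<Sigma> E \<theta> G\<^sub>0 (bs @ [(c, Xs, ws)]) G'"
    using IH(1) *(1) unfolding ground_run_snoc by blast
  moreover have "fvars2 ?S = set (bvars (bs @ [(c, Xs, ws)]))"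
    using *(6) IH(5) by auto
  moreover have "distinct (bvars (bs @ [(c, Xs, ws)]))"
    using *(4,5) IH(4,5) by auto
  moreover have "bhandles (bs @ [(c, Xs, ws)]) \<subseteq> dom \<Phi>'"
    using h *(7) by auto
  ultimately show ?case
    using *(3) by blast
qed

text \<open>The run exists for either value of \<open>d\<close>, since dependency constraints
  restrict solutions and never transitions. Distinct recipe variables are what the freshness
  conditions of the inputs require.\<close>

lemma ground_run_imp_sym_run:
  fixes G\<^sub>0 :: "('c::linorder \<Rightarrow> ('f, 'x::infinite, 'w, 'n, 'c) proc) \<times> ('f, 'x, 'w, 'n) frame"
    and bs :: "('c, 'y, 'w) block list"
  assumes "ground_run \<Sigma> E \<theta> G\<^sub>0 bs G" "instance_of \<Sigma> Map.empty (\<P>\<^sub>0, \<Phi>\<^sub>0, {} :: ('f, 'x, 'w, 'n, 'y) constr set) G\<^sub>0" "distinct (bvars bs)"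
  shows "\<exists>l \<P> \<Phi> S. sym_run d (\<P>\<^sub>0, \<Phi>\<^sub>0, {}) bs (\<P>, \<Phi>, S) \<and> instance_of \<Sigma> l (\<P>, \<Phi>, S) G \<and> sat \<Sigma> E \<theta> l \<Phi> S \<and>
    fvars2 S = set (bvars bs) \<and> bhandles bs \<subseteq> dom \<Phi>"
  using assms(1,3)
proof (induction bs arbitrary: G rule: rev_induct)
  case Nil
  have "sat \<Sigma> E \<theta> Map.empty \<Phi>\<^sub>0 {}" by (simp add: sat_def)
  then show ?case
    using assms(2) Nil by (intro exI[of _ Map.empty] exI[of _ \<P>\<^sub>0] exI[of _ \<Phi>\<^sub>0] exI[of _ "{}"])
      (auto simp: fvars2_def intro: sym_run.refl)
next
  case (snoc b bs)
  obtain c Xs ws where b: "b = (c, Xs, ws)" by (cases b)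
  obtain G\<^sub>1 where G\<^sub>1: "ground_run \<Sigma> E \<theta> G\<^sub>0 bs G\<^sub>1" "ground_block \<Sigma> E \<theta> G\<^sub>1 (c, Xs, ws) G"
    using snoc.prems(1) unfolding ground_run_snoc b by blast
  from snoc.IH[OF G\<^sub>1(1)] snoc.prems(2) obtain l \<P> \<Phi> S where
    IH: "sym_run d (\<P>\<^sub>0, \<Phi>\<^sub>0, {}) bs (\<P>, \<Phi>, S)" "instance_of \<Sigma> l (\<P>, \<Phi>, S) G\<^sub>1" "sat \<Sigma> E \<theta> l \<Phi> S"
      "fvars2 S = set (bvars bs)" "bhandles bs \<subseteq> dom \<Phi>"
    by auto
  have "distinct Xs" "set Xs \<inter> fvars2 S = {}"
    using snoc.prems(2) IH(4) by (auto simp: b)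
  from ground_block_imp_sym_block[OF IH(2,3) G\<^sub>1(2) this] obtain l' \<P>' \<Phi>' S' where
    *: "sym_block (\<P>, \<Phi>, S) (c, Xs, ws) (\<P>', \<Phi>', S')" "instance_of \<Sigma> l' (\<P>', \<Phi>', S') G"
      "sat \<Sigma> E \<theta> l' \<Phi>' S'" "fvars2 S' = fvars2 S \<union> set Xs" "\<Phi> \<subseteq>\<^sub>m \<Phi>'" "set ws \<subseteq> dom \<Phi>'"
    by blast
  let ?S = "if d then insert (Dep Xs (dep bs c)) S' else S'"
  have h: "bhandles bs \<subseteq> dom \<Phi>'"
    using IH(5) map_le_implies_dom_le[OF *(5)] by blast
  have "instance_of \<Sigma> l' (\<P>', \<Phi>', ?S) G"
    using *(2) instance_of_Dep[OF *(2), of Xs "dep bs c"] *(4) h dep_bhandles[of bs c] by auto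
  moreover have "fvars2 ?S = set (bvars (bs @ [b]))"
    using *(4) IH(4) b by auto
  moreover have "bhandles (bs @ [b]) \<subseteq> dom \<Phi>'"
    using h *(6) b by auto
  moreover have "sat \<Sigma> E \<theta> l' \<Phi>' ?S" using *(3) by simp
  ultimately show ?case
    using sym_run.step[OF IH(1) *(1)] unfolding b by blast
qed

section \<open>Solutions and ground executions\<close>

lemma strip_iff [simp]:
  "Ded D X x \<in> strip S \<longleftrightarrow> Ded D X x \<in> S" "Eq u v \<in> strip S \<longleftrightarrow> Eq u v \<in> S"
  "Neq u v \<in> strip S \<longleftrightarrow> Neq u v \<in> S"
  by (simp_all add: strip_def)

lemma cvars_strip: "(\<Union>k \<in> strip S. cvars k) = (\<Union>k \<in> S. cvars k)"
proof -
  have "k \<in> strip S" if "k \<in> S" "x \<in> cvars k" for k x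
    using that by (cases k) (auto simp: strip_def)
  then show ?thesis by (auto simp: strip_def)
qed

lemma sat_imp_Sol:
  assumes "dom \<theta> = fvars2 (strip S)" "dom l = fvars \<Phi> (strip S)" "ran l \<subseteq> ground_terms \<Sigma>"
    and "sat \<Sigma> E \<theta> l \<Phi> S"
  shows "\<theta> \<in> Sol \<Sigma> E \<Phi> (strip S)"
proof -
  have "first_order_sol \<Sigma> E \<Phi> (strip S) \<theta> l"
    using assms(2-4) by (simp add: first_order_sol_def sat_def)
  moreover have "\<forall>D X x. Ded D X x \<in> strip S \<longrightarrow> the (\<theta> X) \<in> recipes \<Sigma> D"
    using assms(4) by (simp add: sat_def)
  ultimately show ?thesis
    using assms(1) unfolding Sol_def by blast
qed

lemma lambda_of_sat:
  assumes "\<theta> \<in> Sol \<Sigma> E \<Phi> (strip S)"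
  shows "dom (lambda_of \<Sigma> E \<Phi> (strip S) \<theta>) = fvars \<Phi> (strip S)"
    "sat \<Sigma> E \<theta> (lambda_of \<Sigma> E \<Phi> (strip S) \<theta>) \<Phi> S"
proof -
  have "\<exists>l. first_order_sol \<Sigma> E \<Phi> (strip S) \<theta> l"
    using assms by (simp add: Sol_def)
  then have "first_order_sol \<Sigma> E \<Phi> (strip S) \<theta> (lambda_of \<Sigma> E \<Phi> (strip S) \<theta>)"
    unfolding lambda_of_def by (rule someI_ex)
  then show "dom (lambda_of \<Sigma> E \<Phi> (strip S) \<theta>) = fvars \<Phi> (strip S)"
    "sat \<Sigma> E \<theta> (lambda_of \<Sigma> E \<Phi> (strip S) \<theta>) \<Phi> S"
    using assms by (simp_all add: first_order_sol_def sat_def Sol_def)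
qed

text \<open>\<open>lambda_of\<close> is an arbitrary choice among substitutions equal modulo the
  theory, so the frame of the ground execution can only be expected to agree with the symbolic one
  modulo the theory.\<close>

lemma sol_imp_ground_run:
  fixes S :: "('f, 'x, 'w, 'n, 'y) constr set"
  assumes "sym_run d (\<P>\<^sub>0, \<Phi>\<^sub>0, {}) bs (\<P>, \<Phi>, S)"
    and "instance_of \<Sigma> Map.empty (\<P>\<^sub>0, \<Phi>\<^sub>0, {} :: ('f, 'x, 'w, 'n, 'y) constr set) G\<^sub>0"
    and "\<theta> \<in> Sol \<Sigma> E \<Phi> (strip S)"
  shows "\<exists>G. ground_run \<Sigma> E \<theta> G\<^sub>0 bs G \<and> distinct (bvars bs) \<and> dom \<theta> = set (bvars bs) \<and>
    agree \<Sigma> E (snd G) (inst_frame (lambda_of \<Sigma> E \<Phi> (strip S) \<theta>) \<Phi>) \<and> dom (snd G) = dom \<Phi>"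
proof -
  let ?m = "lambda_of \<Sigma> E \<Phi> (strip S) \<theta>"
  note m = lambda_of_sat[OF assms(3)]
  have "(\<Union>k \<in> S. cvars k) \<subseteq> dom ?m"
    unfolding m(1) fvars_def cvars_strip by blast
  from sym_run_imp_ground_run[OF assms(1,2) m(2) map_le_refl subset_refl this] obtain l G where
    *: "ground_run \<Sigma> E \<theta> G\<^sub>0 bs G" "instance_of \<Sigma> l (\<P>, \<Phi>, S) G" "agree \<Sigma> E l ?m"
      "distinct (bvars bs)" "fvars2 S = set (bvars bs)"
    by blast
  then have inv: "sym_inv \<Sigma> l \<Phi> S" and G: "snd G = inst_frame l \<Phi>"
    by (cases G; auto simp: instance_of_def)+
  have "dom \<theta> = fvars2 S"
    using assms(3) inv by (simp add: Sol_def sym_inv_def)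
  moreover have "agree \<Sigma> E (snd G) (inst_frame ?m \<Phi>)"
    unfolding G by (rule agree_inst_frame[OF *(3) inv map_le_refl])
  moreover have "dom (snd G) = dom \<Phi>"
    unfolding G by simp
  ultimately show ?thesis
    using *(1,4,5) by metis
qed

lemma ground_run_imp_sol:
  fixes G\<^sub>0 :: "('c::linorder \<Rightarrow> ('f, 'x::infinite, 'w, 'n, 'c) proc) \<times> ('f, 'x, 'w, 'n) frame"
    and bs :: "('c, 'y, 'w) block list"
  assumes "ground_run \<Sigma> E \<theta> G\<^sub>0 bs G"
    and "instance_of \<Sigma> Map.empty (\<P>\<^sub>0, \<Phi>\<^sub>0, {} :: ('f, 'x, 'w, 'n, 'y) constr set) G\<^sub>0"
    and "distinct (bvars bs)" "dom \<theta> = set (bvars bs)"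
  shows "\<exists>\<P> \<Phi> S. sym_run d (\<P>\<^sub>0, \<Phi>\<^sub>0, {}) bs (\<P>, \<Phi>, S) \<and> \<theta> \<in> Sol \<Sigma> E \<Phi> (strip S)"
proof -
  obtain l \<P> \<Phi> S where *: "sym_run d (\<P>\<^sub>0, \<Phi>\<^sub>0, {}) bs (\<P>, \<Phi>, S)" "instance_of \<Sigma> l (\<P>, \<Phi>, S) G"
    "sat \<Sigma> E \<theta> l \<Phi> S" "fvars2 S = set (bvars bs)"
    using ground_run_imp_sym_run[OF assms(1-3)] by blast
  then have inv: "sym_inv \<Sigma> l \<Phi> S"
    by (cases G) (auto simp: instance_of_def)
  have "dom l = fvars \<Phi> (strip S)"
    using sym_inv_fvars[OF inv] by (simp add: fvars_def cvars_strip)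
  moreover have "dom \<theta> = fvars2 (strip S)"
    using inv *(4) assms(4) by (simp add: sym_inv_def)
  ultimately show ?thesis
    using * sym_inv_ran[OF inv] sat_imp_Sol by blast
qed

lemma agree_eqE_iff:
  assumes "agree \<Sigma> E \<Phi> \<Phi>'" "M \<in> recipes \<Sigma> (dom \<Phi>)" "N \<in> recipes \<Sigma> (dom \<Phi>)"
  shows "eqE \<Sigma> E (hsubst \<Phi> M) (hsubst \<Phi> N) \<longleftrightarrow> eqE \<Sigma> E (hsubst \<Phi>' M) (hsubst \<Phi>' N)"
  using agree_hsubst[OF assms(1,2)] agree_hsubst[OF assms(1,3)] by (meson eqE.sym eqE.trans)

text \<open>Replacing the entries of a frame by equal ones modulo the theory changes the value of
  every recipe only modulo the theory, so the same pairs of recipes are identified.\<close>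

lemma static_equiv_agree:
  assumes "agree \<Sigma> E \<Phi> \<Phi>'" "dom \<Phi> = dom \<Phi>'" "agree \<Sigma> E \<Psi> \<Psi>'" "dom \<Psi> = dom \<Psi>'"
  shows "static_equiv \<Sigma> E \<Phi> \<Psi> \<longleftrightarrow> static_equiv \<Sigma> E \<Phi>' \<Psi>'"
proof (cases "dom \<Phi> = dom \<Psi>")
  case True
  then show ?thesis
    unfolding static_equiv_def
    using assms(2,4) agree_eqE_iff[OF assms(1)] agree_eqE_iff[OF assms(3)] by auto
qed (use assms in \<open>simp add: static_equiv_def\<close>)

lemma simple_process_all_basic:
  assumes "simple_process \<Sigma> \<P>"
  shows "all_basic \<Sigma> \<P>"
  unfolding all_basic_def
proof
  obtain cs Ps where Ps: "\<P> = mset Ps" "list_all2 (basic \<Sigma>) cs Ps"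
    using assms by (auto simp: simple_process_def)
  fix Q assume "Q \<in># \<P>"
  then obtain i where "i < length Ps" "Q = Ps ! i"
    using Ps(1) by (auto simp: in_set_conv_nth)
  then show "\<exists>c. basic \<Sigma> c Q"
    using Ps(2) by (auto simp: list_all2_conv_all_nth)
qed

text \<open>The pairwise distinct channels of a simple process allow to store each process at its
  own channel; all other channels carry \<open>Null\<close>.\<close>

lemma instance_of_initial:
  assumes "ext_simple_process \<Sigma> (\<P>, \<Phi>)"
  shows "\<exists>G. instance_of \<Sigma> Map.empty (\<P>, \<Phi>, {}) G"
proof -
  have sp: "simple_process \<Sigma> \<P>" and fr: "frame \<Sigma> \<Phi>" "\<forall>P \<in># \<P>. pfv P = {}" "ran \<Phi> \<subseteq> ground_terms \<Sigma>"
    using assms by (auto simp: ext_simple_process_def)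
  from sp obtain cs Ps where Ps: "Null \<notin># \<P>" "\<P> = mset Ps" "distinct cs" "list_all2 (basic \<Sigma>) cs Ps"
    by (auto simp: simple_process_def)
  then have len: "length cs = length Ps" by (simp add: list_all2_lengthD)
  define D where "D c = (case map_of (zip cs Ps) c of Some P \<Rightarrow> P | None \<Rightarrow> Null)" for c
  have nth: "D (cs ! i) = Ps ! i" if "i < length cs" for i
    using Ps(3) len that by (simp add: D_def map_of_zip_nth)
  have out: "D c = Null" if "c \<notin> set cs" for c
    using that map_of_zip_is_None[OF len, of c] by (simp add: D_def)
  have nonnull: "Ps ! i \<noteq> Null" if "i < length Ps" for i
    using Ps(1,2) nth_mem[OF that] by (metis set_mset_mset)
  have "c \<in> support D \<longleftrightarrow> c \<in> set cs" for c
  proof (cases "c \<in> set cs")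
    case True
    then obtain i where "i < length cs" "c = cs ! i" by (auto simp: in_set_conv_nth)
    then have "D c \<noteq> Null" using nth[of i] nonnull[of i] len by simp
    then show ?thesis using True by (simp add: support_def)
  next
    case False
    then show ?thesis using out[of c] by (simp add: support_def)
  qed
  then have supp: "support D = set cs" by blast
  have "map D cs = Ps"
    using nth len by (auto intro: nth_equalityI)
  then have "proc_mset D = \<P>"
    unfolding proc_mset_def supp mset_set_set[OF Ps(3)] mset_map[symmetric] by (simp add: Ps(2))
  moreover have "basic \<Sigma> c (D c) \<and> pfv (D c) = {}" for c
  proof (cases "c \<in> set cs")
    case True
    then obtain i where i: "i < length cs" "c = cs ! i" by (auto simp: in_set_conv_nth)
    then have "basic \<Sigma> c (Ps ! i)" "Ps ! i \<in># \<P>"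
      using Ps(2,4) len by (auto simp: list_all2_conv_all_nth)
    then show ?thesis using nth i fr(2) by simp
  qed (simp add: out)
  moreover have "sym_inv \<Sigma> Map.empty \<Phi> {}"
  proof -
    have "u \<in> messages \<Sigma> \<and> tvars u = {}" if "\<Phi> w = Some u" for w u
      using fr that ground_tvars ground_messages ranI[of \<Phi> w u] by blast
    then show ?thesis
      using fr(1) by (simp add: sym_inv_def frame_def)
  qed
  moreover have "inst_frame Map.empty \<Phi> = \<Phi>"
  proof
    show "inst_frame Map.empty \<Phi> w = \<Phi> w" for w
      by (cases "\<Phi> w") (simp_all add: inst_frame_def)
  qed
  ultimately have "instance_of \<Sigma> Map.empty (\<P>, \<Phi>, {}) (D, \<Phi>)"
    unfolding instance_of_def by (auto simp: supp intro!: exI[of _ D])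
  then show ?thesis by blast
qed

text \<open>\<open>deps_sat\<close> is demanded of the given execution only: the matching one has
  the same blocks and the same \<open>\<theta>\<close>, so its dependency constraints are the same.
  The flag \<open>d\<close> distinguishes the reduced from the compressed case.\<close>

definition ground_inclusion :: "bool \<Rightarrow> 'y itself \<Rightarrow> ('f \<times> nat) set \<Rightarrow> ('f, 'x, 'w, 'n) equations \<Rightarrow>
    ('c::linorder \<Rightarrow> ('f, 'x, 'w, 'n, 'c) proc) \<times> ('f, 'x, 'w, 'n) frame \<Rightarrow>
    ('c \<Rightarrow> ('f, 'x, 'w, 'n, 'c) proc) \<times> ('f, 'x, 'w, 'n) frame \<Rightarrow> bool" where
  "ground_inclusion d _ \<Sigma> E G H \<longleftrightarrow> (\<forall>bs (\<theta> :: 'y \<rightharpoonup> ('f, 'x, 'w, 'n) tm) G'.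
     ground_run \<Sigma> E \<theta> G bs G' \<and> distinct (bvars bs) \<and> dom \<theta> = set (bvars bs) \<and> (d \<longrightarrow> deps_sat \<theta> bs) \<longrightarrow>
       (\<exists>H'. ground_run \<Sigma> E \<theta> H bs H' \<and> static_equiv \<Sigma> E (snd G') (snd H')))"

text \<open>The executions of both processes decompose into the same blocks, as the decomposition of a
  trace into blocks is unique.\<close>

lemma trace_inclusion_iff_ground:
  fixes \<P> \<Q> :: "('f, 'x::infinite, 'w, 'n, 'c::linorder) proc multiset"
    and step :: "(('f, 'x, 'w, 'n, 'c) proc multiset, 'f, 'x, 'w, 'n, 'y) sym \<Rightarrow> _"
  assumes instG: "instance_of \<Sigma> Map.empty (\<P>, \<Phi>, {} :: ('f, 'x, 'w, 'n, 'y) constr set) G"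
    and instH: "instance_of \<Sigma> Map.empty (\<Q>, \<Psi>, {} :: ('f, 'x, 'w, 'n, 'y) constr set) H"
    and step: "\<And>tr K. step (\<P>, \<Phi>, {}) tr K \<longleftrightarrow> (\<exists>bs. tr = concat (map io bs) \<and> sym_run d (\<P>, \<Phi>, {}) bs K)"
      "\<And>tr K. step (\<Q>, \<Psi>, {}) tr K \<longleftrightarrow> (\<exists>bs. tr = concat (map io bs) \<and> sym_run d (\<Q>, \<Psi>, {}) bs K)"
    and sol: "sol = (if d then Sol2 \<Sigma> E else Sol \<Sigma> E)"
  shows "trace_inclusion \<Sigma> E step sol (\<P>, \<Phi>) (\<Q>, \<Psi>) \<longleftrightarrow> ground_inclusion d TYPE('y) \<Sigma> E G H"
proof -
  \<comment> \<open>Unified description of \<open>Sol\<close> and \<open>Sol2\<close>: in the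
    compressed case \<open>S\<close> contains no dependency constraints and \<open>strip\<close>
    does nothing; in the reduced case they amount to \<open>deps_sat\<close> of the blocks.\<close>
  have sol_iff: "\<theta> \<in> sol \<Phi>' S \<longleftrightarrow> \<theta> \<in> Sol \<Sigma> E \<Phi>' (strip S) \<and> (d \<longrightarrow> deps_sat \<theta> bs)"
    if "sym_run d (\<P>\<^sub>0, \<Phi>\<^sub>0, {}) bs (\<P>', \<Phi>', S)"
    for \<theta> bs and \<P>\<^sub>0 \<P>' :: "('f, 'x, 'w, 'n, 'c) proc multiset" and \<Phi>\<^sub>0 \<Phi>' and S :: "('f, 'x, 'w, 'n, 'y) constr set"
  proof (cases d)
    case True
    then show ?thesis using sym_run_deps[OF that, of \<theta>] sol by (simp add: Sol2_def)
  next
    case False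
    then have "strip S = S" using sym_run_deps[OF that] by (auto simp: strip_def)
    then show ?thesis using False sol by simp
  qed
  show ?thesis
  proof
    assume L: "trace_inclusion \<Sigma> E step sol (\<P>, \<Phi>) (\<Q>, \<Psi>)"
    show "ground_inclusion d TYPE('y) \<Sigma> E G H"
      unfolding ground_inclusion_def
    proof (intro allI impI, elim conjE)
      fix bs and \<theta> :: "'y \<rightharpoonup> ('f, 'x, 'w, 'n) tm" and G'
      assume a: "ground_run \<Sigma> E \<theta> G bs G'" "distinct (bvars bs)" "dom \<theta> = set (bvars bs)" "d \<longrightarrow> deps_sat \<theta> bs"
      obtain \<P>' \<Phi>' S where A: "sym_run d (\<P>, \<Phi>, {}) bs (\<P>', \<Phi>', S)" "\<theta> \<in> Sol \<Sigma> E \<Phi>' (strip S)"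
        using ground_run_imp_sol[OF a(1) instG a(2,3)] by blast
      have "step (\<P>, \<Phi>, {}) (concat (map io bs)) (\<P>', \<Phi>', S)" "\<theta> \<in> sol \<Phi>' S"
        using A a(4) step(1) sol_iff[OF A(1)] by blast+
      then obtain \<Q>' \<Psi>' T where B: "step (\<Q>, \<Psi>, {}) (concat (map io bs)) (\<Q>', \<Psi>', T)" "\<theta> \<in> sol \<Psi>' T"
        "static_equiv \<Sigma> E (inst_frame (lambda_of \<Sigma> E \<Phi>' (strip S) \<theta>) \<Phi>')
          (inst_frame (lambda_of \<Sigma> E \<Psi>' (strip T) \<theta>) \<Psi>')"
        using L unfolding trace_inclusion_def prod.case by blast
      obtain bs' where bs': "concat (map io bs) = concat (map io bs')" "sym_run d (\<Q>, \<Psi>, {}) bs' (\<Q>', \<Psi>', T)"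
        using B(1) step(2) by blast
      obtain H' where H': "ground_run \<Sigma> E \<theta> H bs' H'"
        "agree \<Sigma> E (snd H') (inst_frame (lambda_of \<Sigma> E \<Psi>' (strip T) \<theta>) \<Psi>')" "dom (snd H') = dom \<Psi>'"
        using sol_imp_ground_run[OF bs'(2) instH] B(2) sol_iff[OF bs'(2)] by blast
      \<comment> \<open>The static equivalence obtained from the symbolic inclusion concerns the
        frame under \<open>lambda_of\<close>. Returning from there to a ground execution and using
        determinism relates it to the given \<open>G'\<close>.\<close>
      obtain G'' where G'': "ground_run \<Sigma> E \<theta> G bs G''"
        "agree \<Sigma> E (snd G'') (inst_frame (lambda_of \<Sigma> E \<Phi>' (strip S) \<theta>) \<Phi>')" "dom (snd G'') = dom \<Phi>'"
        using sol_imp_ground_run[OF A(1) instG A(2)] by blast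
      have static: "static_equiv \<Sigma> E (snd G'') (snd H')"
        using B(3) static_equiv_agree[OF G''(2) _ H'(2)] G''(3) H'(3) by simp
      have "G'' = G'" using ground_run_deterministic[OF G''(1) a(1)] .
      moreover have "bs' = bs"
        using block_list_unique[OF ground_run_block_list[OF a(1)] ground_run_block_list[OF H'(1)] bs'(1)] by simp
      ultimately show "\<exists>H'. ground_run \<Sigma> E \<theta> H bs H' \<and> static_equiv \<Sigma> E (snd G') (snd H')"
        using H'(1) static by blast
    qed
  next
    assume R: "ground_inclusion d TYPE('y) \<Sigma> E G H"
    show "trace_inclusion \<Sigma> E step sol (\<P>, \<Phi>) (\<Q>, \<Psi>)"
      unfolding trace_inclusion_def prod.case
    proof (intro allI impI, elim conjE)
      fix tr \<P>' \<Phi>' S \<theta>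
      assume a: "step (\<P>, \<Phi>, {}) tr (\<P>', \<Phi>', S)" "\<theta> \<in> sol \<Phi>' S"
      obtain bs where bs: "tr = concat (map io bs)" "sym_run d (\<P>, \<Phi>, {}) bs (\<P>', \<Phi>', S)"
        using a(1) step(1) by blast
      have \<theta>: "\<theta> \<in> Sol \<Sigma> E \<Phi>' (strip S)" "d \<longrightarrow> deps_sat \<theta> bs"
        using a(2) sol_iff[OF bs(2)] by auto
      obtain G' where G': "ground_run \<Sigma> E \<theta> G bs G'" "distinct (bvars bs)" "dom \<theta> = set (bvars bs)"
        "agree \<Sigma> E (snd G') (inst_frame (lambda_of \<Sigma> E \<Phi>' (strip S) \<theta>) \<Phi>')" "dom (snd G') = dom \<Phi>'"
        using sol_imp_ground_run[OF bs(2) instG \<theta>(1)] by blast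
      obtain H' where H': "ground_run \<Sigma> E \<theta> H bs H'" "static_equiv \<Sigma> E (snd G') (snd H')"
        using R G'(1-3) \<theta>(2) unfolding ground_inclusion_def by blast
      obtain \<Q>' \<Psi>' T where B: "sym_run d (\<Q>, \<Psi>, {}) bs (\<Q>', \<Psi>', T)" "\<theta> \<in> Sol \<Sigma> E \<Psi>' (strip T)"
        using ground_run_imp_sol[OF H'(1) instH G'(2,3)] by blast
      obtain H'' where H'': "ground_run \<Sigma> E \<theta> H bs H''"
        "agree \<Sigma> E (snd H'') (inst_frame (lambda_of \<Sigma> E \<Psi>' (strip T) \<theta>) \<Psi>')" "dom (snd H'') = dom \<Psi>'"
        using sol_imp_ground_run[OF B(1) instH B(2)] by blast
      have eq: "H'' = H'" using ground_run_deterministic[OF H''(1) H'(1)] .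
      have "static_equiv \<Sigma> E (inst_frame (lambda_of \<Sigma> E \<Phi>' (strip S) \<theta>) \<Phi>')
          (inst_frame (lambda_of \<Sigma> E \<Psi>' (strip T) \<theta>) \<Psi>')"
        using H'(2) static_equiv_agree[OF G'(4) _ H''(2)] G'(5) H''(3) eq by simp
      moreover have "step (\<Q>, \<Psi>, {}) tr (\<Q>', \<Psi>', T)"
        using B(1) bs(1) step(2) by blast
      moreover have "\<theta> \<in> sol \<Psi>' T"
        using sol_iff[OF B(1)] B(2) \<theta>(2) by blast
      ultimately show "\<exists>\<Q>' \<Psi>' S\<^sub>B. step (\<Q>, \<Psi>, {}) tr (\<Q>', \<Psi>', S\<^sub>B) \<and> \<theta> \<in> sol \<Psi>' S\<^sub>B \<and>
          static_equiv \<Sigma> E (inst_frame (lambda_of \<Sigma> E \<Phi>' (strip S) \<theta>) \<Phi>')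
            (inst_frame (lambda_of \<Sigma> E \<Psi>' (strip S\<^sub>B) \<theta>) \<Psi>')"
        by blast
    qed
  qed
qed


section \<open>Permutation of independent blocks\<close>

text \<open>Both directions of handle use are excluded, so the relation is symmetric and swaps can
  be undone; this is needed to permute the execution of \<open>B\<close> back.\<close>

definition indep :: "('y \<rightharpoonup> ('f, 'x, 'w, 'n) tm) \<Rightarrow> ('c, 'y, 'w) block \<Rightarrow> ('c, 'y, 'w) block \<Rightarrow> bool" where
  "indep \<theta> b b' \<longleftrightarrow> fst b \<noteq> fst b' \<and>
     (\<forall>X \<in> set (fst (snd b')). thandles (the (\<theta> X)) \<inter> set (snd (snd b)) = {}) \<and>
     (\<forall>X \<in> set (fst (snd b)). thandles (the (\<theta> X)) \<inter> set (snd (snd b')) = {})"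

inductive swap :: "('y \<rightharpoonup> ('f, 'x, 'w, 'n) tm) \<Rightarrow> ('c, 'y, 'w) block list \<Rightarrow> ('c, 'y, 'w) block list \<Rightarrow> bool"
  for \<theta> where
  "indep \<theta> b b' \<Longrightarrow> swap \<theta> (p @ b # b' # r) (p @ b' # b # r)"

lemma swap_sym: "swap \<theta> bs bs' \<Longrightarrow> swap \<theta> bs' bs"
  by (induction rule: swap.induct) (auto simp: indep_def intro: swap.intros)

lemma swaps_sym: "(swap \<theta>)\<^sup>*\<^sup>* bs bs' \<Longrightarrow> (swap \<theta>)\<^sup>*\<^sup>* bs' bs"
  by (induction rule: rtranclp_induct) (auto intro: converse_rtranclp_into_rtranclp swap_sym)

lemma swaps_mset: "(swap \<theta>)\<^sup>*\<^sup>* bs bs' \<Longrightarrow> mset bs' = mset bs"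
proof (induction rule: rtranclp_induct)
  case (step bs' bs'')
  from step.hyps(2) have "mset bs'' = mset bs'" by cases simp
  with step.IH show ?case by simp
qed simp

lemma recipes_disjoint_iff:
  assumes "thandles r \<inter> W = {}"
  shows "r \<in> recipes \<Sigma> (D \<union> W) \<longleftrightarrow> r \<in> recipes \<Sigma> D"
proof
  assume r: "r \<in> recipes \<Sigma> (D \<union> W)"
  show "r \<in> recipes \<Sigma> D"
    by (rule recipes_change[OF r]) (use recipes_thandles[OF r] assms in blast)
next
  assume r: "r \<in> recipes \<Sigma> D"
  show "r \<in> recipes \<Sigma> (D \<union> W)"
    by (rule recipes_change[OF r]) (use recipes_thandles[OF r] in blast)
qed

lemma hsubst_map_upds:
  assumes "thandles r \<inter> set ws = {}"
  shows "hsubst (\<Phi>(ws [\<mapsto>] us)) r = hsubst \<Phi> r"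
  using assms by (intro hsubst_cong) (auto intro: map_upds_apply_nontin)

lemma map_upds_commute:
  assumes "set ws \<inter> set vs = {}"
  shows "\<Phi>(ws [\<mapsto>] us, vs [\<mapsto>] ts) = \<Phi>(vs [\<mapsto>] ts, ws [\<mapsto>] us)"
proof -
  have "dom (map_of (rev (zip ws us))) \<inter> dom (map_of (rev (zip vs ts))) = {}"
    using assms set_zip_leftD[of _ _ ws us] set_zip_leftD[of _ _ vs ts]
    unfolding dom_map_of_conv_image_fst by fastforce
  then show ?thesis
    unfolding map_upds_def by (metis map_add_assoc map_add_comm)
qed

text \<open>Having outputs, both blocks are proper and update only their own channel. Executing one
  first extends the frame of the other only by handles absent from its recipes, so the input terms
  and hence the effects are unchanged.\<close>

lemma ground_block_swap:
  assumes "ground_block \<Sigma> E \<theta> K b K\<^sub>1" "ground_block \<Sigma> E \<theta> K\<^sub>1 b' K\<^sub>2" "indep \<theta> b b'"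
    and "snd (snd b) \<noteq> []" "snd (snd b') \<noteq> []"
  shows "\<exists>K\<^sub>1'. ground_block \<Sigma> E \<theta> K b' K\<^sub>1' \<and> ground_block \<Sigma> E \<theta> K\<^sub>1' b K\<^sub>2"
  using assms(1)
proof cases
  case (1 Xs \<Phi> ws us c C R)
  note B = 1
  have "R \<noteq> None" using exec_block_no_output[OF B(9)] B(2,8) assms(4) by auto
  then obtain Q where Q: "R = Some Q" by blast
  from assms(2) show ?thesis
  proof cases
    case (1 Xs' \<Phi>' ws' us' c' C' R')
    have "R' \<noteq> None" using exec_block_no_output[OF 1(9)] 1(2,8) assms(5) by auto
    then obtain Q' where Q': "R' = Some Q'" by blast
    have C': "C' = C(c := Q)" and \<Phi>': "\<Phi>' = \<Phi>(ws [\<mapsto>] us)"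
      using 1(1) B(3) Q by auto
    have ind: "c \<noteq> c'" "\<forall>X \<in> set Xs'. thandles (the (\<theta> X)) \<inter> set ws = {}"
      "\<forall>X \<in> set Xs. thandles (the (\<theta> X)) \<inter> set ws' = {}"
      using assms(3) B(2) 1(2) by (auto simp: indep_def)
    have dom: "dom \<Phi>' = dom \<Phi> \<union> set ws" using \<Phi>' B(8) by auto
    let ?\<Phi>\<^sub>1 = "\<Phi>(ws' [\<mapsto>] us')"
    have dom1: "dom ?\<Phi>\<^sub>1 = dom \<Phi> \<union> set ws'" using 1(8) by auto
    have in': "map (\<lambda>X. hsubst \<Phi>' (the (\<theta> X))) Xs' = map (\<lambda>X. hsubst \<Phi> (the (\<theta> X))) Xs'"
      using ind(2) unfolding \<Phi>' by (auto intro: hsubst_map_upds)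
    have "in": "map (\<lambda>X. hsubst ?\<Phi>\<^sub>1 (the (\<theta> X))) Xs = map (\<lambda>X. hsubst \<Phi> (the (\<theta> X))) Xs"
      using ind(3) by (auto intro: hsubst_map_upds)
    have "ground_block \<Sigma> E \<theta> (C, \<Phi>) (c', Xs', ws')
        (case R' of None \<Rightarrow> (\<lambda>_. Null) | Some Q \<Rightarrow> C(c' := Q), ?\<Phi>\<^sub>1)"
    proof (rule ground_block.intros)
      show "\<forall>X \<in> set Xs'. the (\<theta> X) \<in> recipes \<Sigma> (dom \<Phi>)"
      proof
        fix X assume X: "X \<in> set Xs'"
        then show "the (\<theta> X) \<in> recipes \<Sigma> (dom \<Phi>)"
          using 1(5) recipes_disjoint_iff[OF bspec[OF ind(2) X], of \<Sigma> "dom \<Phi>"] unfolding dom by simp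
      qed
      show "exec_block \<Sigma> E IPlus c' (C c') (map (\<lambda>X. hsubst \<Phi> (the (\<theta> X))) Xs') us' R'"
        using 1(9) ind(1) unfolding in' C' by simp
    qed (use 1 dom in auto)
    moreover have "ground_block \<Sigma> E \<theta> (C(c' := Q'), ?\<Phi>\<^sub>1) (c, Xs, ws)
        (case R of None \<Rightarrow> (\<lambda>_. Null) | Some Q \<Rightarrow> C(c' := Q', c := Q), ?\<Phi>\<^sub>1(ws [\<mapsto>] us))"
    proof (rule ground_block.intros)
      show "\<forall>X \<in> set Xs. the (\<theta> X) \<in> recipes \<Sigma> (dom ?\<Phi>\<^sub>1)"
      proof
        fix X assume X: "X \<in> set Xs"
        then show "the (\<theta> X) \<in> recipes \<Sigma> (dom ?\<Phi>\<^sub>1)"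
          using B(5) recipes_disjoint_iff[OF bspec[OF ind(3) X], of \<Sigma> "dom \<Phi>"] unfolding dom1 by simp
      qed
      show "exec_block \<Sigma> E IPlus c ((C(c' := Q')) c) (map (\<lambda>X. hsubst ?\<Phi>\<^sub>1 (the (\<theta> X))) Xs) us R"
        using B(9) ind(1) unfolding "in" by simp
      show "set ws \<inter> dom ?\<Phi>\<^sub>1 = {}"
        using B(7) 1(7) dom dom1 by auto
    qed (use B in auto)
    moreover have "K\<^sub>2 = (C(c' := Q', c := Q), ?\<Phi>\<^sub>1(ws [\<mapsto>] us))"
    proof -
      have "set ws \<inter> set ws' = {}" using 1(7) dom by auto
      then have "\<Phi>'(ws' [\<mapsto>] us') = ?\<Phi>\<^sub>1(ws [\<mapsto>] us)"
        unfolding \<Phi>' by (rule map_upds_commute)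
      moreover have "C'(c' := Q') = C(c' := Q', c := Q)"
        unfolding C' using ind(1) by (rule fun_upd_twist)
      ultimately show ?thesis using 1(3) Q' by simp
    qed
    ultimately show ?thesis
      using B(1,2) 1(2) Q Q' by auto
  qed
qed

lemma ground_run_swap:
  assumes "swap \<theta> bs bs'" "ground_run \<Sigma> E \<theta> K bs K'" "\<forall>b \<in> set bs. snd (snd b) \<noteq> []"
  shows "ground_run \<Sigma> E \<theta> K bs' K'"
  using assms(1)
proof cases
  case (1 b b' p r)
  then obtain K\<^sub>1 K\<^sub>2 K\<^sub>3 where *: "ground_run \<Sigma> E \<theta> K p K\<^sub>1" "ground_block \<Sigma> E \<theta> K\<^sub>1 b K\<^sub>2" "ground_block \<Sigma> E \<theta> K\<^sub>2 b' K\<^sub>3"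
    "ground_run \<Sigma> E \<theta> K\<^sub>3 r K'"
    using assms(2) unfolding 1 ground_run_append ground_run.simps by blast
  obtain K\<^sub>2' where "ground_block \<Sigma> E \<theta> K\<^sub>1 b' K\<^sub>2'" "ground_block \<Sigma> E \<theta> K\<^sub>2' b K\<^sub>3"
    using ground_block_swap[OF *(2,3) 1(3)] assms(3) unfolding 1 by auto
  then show ?thesis
    using * unfolding 1 ground_run_append ground_run.simps by blast
qed

lemma ground_run_swaps:
  assumes "(swap \<theta>)\<^sup>*\<^sup>* bs bs'" "ground_run \<Sigma> E \<theta> K bs K'" "\<forall>b \<in> set bs. snd (snd b) \<noteq> []"
  shows "ground_run \<Sigma> E \<theta> K bs' K'"
  using assms(1)
proof (induction rule: rtranclp_induct)
  case (step bs' bs'')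
  have "set bs' = set bs"
    using swaps_mset[OF step.hyps(1)] by (rule mset_eq_setD)
  then show ?case
    using ground_run_swap[OF step.hyps(2) step.IH] assms(3) by simp
qed (rule assms(2))

lemma swaps_move_left:
  "\<forall>b' \<in> set s. indep \<theta> b' b \<Longrightarrow> (swap \<theta>)\<^sup>*\<^sup>* (p @ s @ b # r) (p @ b # s @ r)"
proof (induction s arbitrary: r rule: rev_induct)
  case (snoc x s)
  have "swap \<theta> ((p @ s) @ x # b # r) ((p @ s) @ b # x # r)"
    using snoc.prems by (intro swap.intros) simp
  moreover have "(swap \<theta>)\<^sup>*\<^sup>* (p @ s @ b # x # r) (p @ b # s @ x # r)"
    using snoc.prems by (intro snoc.IH) simp
  ultimately show ?case
    by (simp add: converse_rtranclp_into_rtranclp)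
qed simp

lemma ground_block_dom:
  assumes "ground_block \<Sigma> E \<theta> K b K'"
  shows "dom (snd K') = dom (snd K) \<union> set (snd (snd b))" "set (snd (snd b)) \<inter> dom (snd K) = {}"
    "X \<in> set (fst (snd b)) \<Longrightarrow> thandles (the (\<theta> X)) \<subseteq> dom (snd K)"
  using assms by (cases; auto dest: recipes_thandles)+

lemma ground_run_dom:
  "ground_run \<Sigma> E \<theta> K bs K' \<Longrightarrow> dom (snd K') = dom (snd K) \<union> bhandles bs"
proof (induction bs arbitrary: K)
  case (Cons b bs)
  then obtain K\<^sub>1 where "ground_block \<Sigma> E \<theta> K b K\<^sub>1" "ground_run \<Sigma> E \<theta> K\<^sub>1 bs K'"
    unfolding ground_run.simps by blast
  then show ?case using Cons.IH[of K\<^sub>1] ground_block_dom(1)[of \<Sigma> E \<theta> K b K\<^sub>1] by (simp add: Un_assoc)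
qed simp

lemma ground_run_recipes:
  "ground_run \<Sigma> E \<theta> K bs K' \<Longrightarrow> b \<in> set bs \<Longrightarrow> X \<in> set (fst (snd b)) \<Longrightarrow> thandles (the (\<theta> X)) \<subseteq> dom (snd K')"
proof (induction bs arbitrary: K)
  case (Cons b' bs)
  then obtain K\<^sub>1 where *: "ground_block \<Sigma> E \<theta> K b' K\<^sub>1" "ground_run \<Sigma> E \<theta> K\<^sub>1 bs K'"
    unfolding ground_run.simps by blast
  show ?case
  proof (cases "b = b'")
    case True
    have "dom (snd K) \<subseteq> dom (snd K')"
      using ground_block_dom(1)[OF *(1)] ground_run_dom[OF *(2)] by blast
    then show ?thesis
      using ground_block_dom(3)[OF *(1)] Cons.prems(3) True by blast
  next
    case False
    then show ?thesis using Cons.IH[OF *(2)] Cons.prems by simp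
  qed
qed simp

text \<open>The index in the definition of \<open>dep\<close> yields the segment
  \<open>b # q\<close> across which a block on \<open>c\<close> that ignores these handles can be
  moved: it begins on a larger channel, and every channel in it differs from
  \<open>c\<close>.\<close>

lemma dep_nonempty:
  assumes "dep bs c \<noteq> {}"
  obtains p b q where "bs = p @ b # q" "c < fst b" "\<forall>b' \<in> set q. fst b' < c" "bhandles (b # q) \<subseteq> dep bs c"
proof -
  obtain k where k: "k < length bs" "c < fst (bs ! k)" "\<forall>i. k < i \<and> i < length bs \<longrightarrow> fst (bs ! i) < c"
    using assms unfolding dep_def by blast
  have "fst b' < c" if b': "b' \<in> set (drop (Suc k) bs)" for b'
  proof -
    obtain j where "j < length (drop (Suc k) bs)" "b' = drop (Suc k) bs ! j"
      using b' by (auto simp: in_set_conv_nth)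
    then show ?thesis using k(3) by simp
  qed
  moreover have "bhandles (bs ! k # drop (Suc k) bs) \<subseteq> dep bs c"
  proof
    fix w assume "w \<in> bhandles (bs ! k # drop (Suc k) bs)"
    then have "w \<in> bhandles (drop k bs)"
      using k(1) by (simp add: Cons_nth_drop_Suc)
    then obtain b where "b \<in> set (drop k bs)" "w \<in> set (snd (snd b))" by blast
    then obtain j where "j < length (drop k bs)" "w \<in> set (snd (snd (drop k bs ! j)))"
      unfolding in_set_conv_nth[of b] by blast
    then have "k \<le> k + j \<and> k + j < length bs \<and> w \<in> set (snd (snd (bs ! (k + j))))"
      using k(1) by simp
    then show "w \<in> dep bs c"
      unfolding dep_def using k by blast
  qed
  ultimately show ?thesis
    using that[OF id_take_nth_drop[OF k(1)] k(2)] by blast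
qed

text \<open>A violated dependency constraint allows to move the block to the left of a block on a larger channel,
  which makes the list of channels lexicographically smaller.\<close>

lemma ex_swaps_deps_sat:
  assumes "ground_run \<Sigma> E \<theta> K bs K'" "\<forall>b \<in> set bs. snd (snd b) \<noteq> []"
  shows "\<exists>bs'. (swap \<theta>)\<^sup>*\<^sup>* bs bs' \<and> deps_sat \<theta> bs'"
proof -
  let ?R = "{bs'. (swap \<theta>)\<^sup>*\<^sup>* bs bs'}"
  \<comment> \<open>The order on channels need not be well-founded; a minimal element exists because
    there are only finitely many permutations.\<close>
  have "?R \<subseteq> {bs'. set bs' \<subseteq> set bs \<and> length bs' = length bs}"
    using swaps_mset mset_eq_setD mset_eq_length by blast
  then have "finite ?R"
    by (rule finite_subset) (simp add: finite_lists_length_eq)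
  then obtain bs' where R: "(swap \<theta>)\<^sup>*\<^sup>* bs bs'"
    and min: "\<And>bs''. (swap \<theta>)\<^sup>*\<^sup>* bs bs'' \<Longrightarrow> \<not> map fst bs'' < map fst bs'"
    using ex_is_arg_min_if_finite[of ?R "map fst"] by (auto simp: is_arg_min_def)
  have "sat_dep \<theta> (fst (snd (bs' ! i))) (dep (take i bs') (fst (bs' ! i)))" if i: "i < length bs'" for i
  proof (rule ccontr)
    assume "\<not> sat_dep \<theta> (fst (snd (bs' ! i))) (dep (take i bs') (fst (bs' ! i)))"
    then have ne: "dep (take i bs') (fst (bs' ! i)) \<noteq> {}"
      and disj: "\<forall>X \<in> set (fst (snd (bs' ! i))). thandles (the (\<theta> X)) \<inter> dep (take i bs') (fst (bs' ! i)) = {}"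
      by (auto simp: sat_dep_def)
    from ne obtain p b q where pq: "take i bs' = p @ b # q" "fst (bs' ! i) < fst b"
      "\<forall>b' \<in> set q. fst b' < fst (bs' ! i)" "bhandles (b # q) \<subseteq> dep (take i bs') (fst (bs' ! i))"
      by (rule dep_nonempty)
    let ?r = "drop (Suc i) bs'"
    have bs': "bs' = p @ (b # q) @ bs' ! i # ?r"
      using id_take_nth_drop[OF i] pq(1) by simp
    have "ground_run \<Sigma> E \<theta> K bs' K'"
      using ground_run_swaps[OF R assms] .
    then have "ground_run \<Sigma> E \<theta> K (p @ (b # q) @ bs' ! i # ?r) K'"
      using bs' by simp
    then obtain K\<^sub>1 K\<^sub>2 K\<^sub>3 where *: "ground_run \<Sigma> E \<theta> K\<^sub>1 (b # q) K\<^sub>2" "ground_block \<Sigma> E \<theta> K\<^sub>2 (bs' ! i) K\<^sub>3"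
      unfolding ground_run_append ground_run.simps by blast
    have "indep \<theta> b' (bs' ! i)" if "b' \<in> set (b # q)" for b'
      unfolding indep_def
    proof (intro conjI ballI)
      show "fst b' \<noteq> fst (bs' ! i)" using that pq(2,3) by auto
      show "thandles (the (\<theta> X)) \<inter> set (snd (snd b')) = {}" if "X \<in> set (fst (snd (bs' ! i)))" for X
        using disj that pq(4) \<open>b' \<in> set (b # q)\<close> by blast
      \<comment> \<open>Recipes of earlier blocks use handles already in the frame, whereas the
        outputs of the later block are fresh for it.\<close>
      show "thandles (the (\<theta> X)) \<inter> set (snd (snd (bs' ! i))) = {}" if "X \<in> set (fst (snd b'))" for X
        using ground_run_recipes[OF *(1) \<open>b' \<in> set (b # q)\<close> that] ground_block_dom(2)[OF *(2)] by blast
    qed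
    then have "(swap \<theta>)\<^sup>*\<^sup>* (p @ (b # q) @ bs' ! i # ?r) (p @ bs' ! i # (b # q) @ ?r)"
      by (intro swaps_move_left) blast
    then have "(swap \<theta>)\<^sup>*\<^sup>* bs (p @ bs' ! i # (b # q) @ ?r)"
      using R bs' by simp
    \<comment> \<open>The lists share the prefix \<open>p\<close>, and at the next position the
      moved block has a smaller channel than \<open>b\<close>.\<close>
    moreover have "map fst (p @ bs' ! i # (b # q) @ ?r) < map fst (p @ (b # q) @ bs' ! i # ?r)"
      using pq(2) by (induction p) auto
    ultimately show False
      using min bs' by metis
  qed
  then show ?thesis
    using R by (auto simp: deps_sat_def)
qed

section \<open>Anticipating a final improper block\<close>

lemma ground_block_cong:
  assumes "ground_block \<Sigma> E \<theta> K b K'" "\<And>X. X \<in> set (fst (snd b)) \<Longrightarrow> \<theta> X = \<theta>' X"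
  shows "ground_block \<Sigma> E \<theta>' K b K'"
  using assms(1)
proof cases
  case (1 Xs \<Phi> ws us c C R)
  have eq: "map (\<lambda>X. hsubst \<Phi> (the (\<theta>' X))) Xs = map (\<lambda>X. hsubst \<Phi> (the (\<theta> X))) Xs"
    using assms(2) 1(2) by simp
  have "\<forall>X \<in> set Xs. the (\<theta>' X) \<in> recipes \<Sigma> (dom \<Phi>)"
    using assms(2) 1(2,5) by simp
  moreover have "exec_block \<Sigma> E IPlus c (C c) (map (\<lambda>X. hsubst \<Phi> (the (\<theta>' X))) Xs) us R"
    unfolding eq by (rule 1(9))
  ultimately show ?thesis
    unfolding 1(1-3) using 1(4-8) by (intro ground_block.intros)
qed

lemma ground_run_cong_imp:
  "ground_run \<Sigma> E \<theta> K bs K' \<Longrightarrow> (\<And>X. X \<in> set (bvars bs) \<Longrightarrow> \<theta> X = \<theta>' X) \<Longrightarrow> ground_run \<Sigma> E \<theta>' K bs K'"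
proof (induction bs arbitrary: K)
  case (Cons b bs)
  obtain K\<^sub>1 where *: "ground_block \<Sigma> E \<theta> K b K\<^sub>1" "ground_run \<Sigma> E \<theta> K\<^sub>1 bs K'"
    using Cons.prems(1) unfolding ground_run.simps by blast
  have "ground_block \<Sigma> E \<theta>' K b K\<^sub>1"
    by (rule ground_block_cong[OF *(1)]) (simp add: Cons.prems(2))
  moreover have "ground_run \<Sigma> E \<theta>' K\<^sub>1 bs K'"
    by (rule Cons.IH[OF *(2)]) (simp add: Cons.prems(2))
  ultimately show ?case unfolding ground_run.simps by blast
qed simp

text \<open>\<open>ground_inclusion\<close> fixes \<open>dom \<theta>\<close> to be the variables of
  the blocks; applying it to a shorter execution thus requires restricting \<open>\<theta>\<close>,
  which this congruence permits.\<close>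

lemma ground_run_cong:
  assumes "\<And>X. X \<in> set (bvars bs) \<Longrightarrow> \<theta> X = \<theta>' X"
  shows "ground_run \<Sigma> E \<theta> K bs K' \<longleftrightarrow> ground_run \<Sigma> E \<theta>' K bs K'"
  using ground_run_cong_imp[of \<Sigma> E \<theta> K bs K' \<theta>'] ground_run_cong_imp[of \<Sigma> E \<theta>' K bs K' \<theta>] assms by metis

lemma deps_sat_append: "deps_sat \<theta> (bs @ bs') \<Longrightarrow> deps_sat \<theta> bs"
  by (induction bs' rule: rev_induct) (auto simp: deps_sat_snoc simp flip: append_assoc)

lemma deps_sat_cong:
  assumes "\<And>X. X \<in> set (bvars bs) \<Longrightarrow> \<theta> X = \<theta>' X" "deps_sat \<theta> bs"
  shows "deps_sat \<theta>' bs"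
  using assms
proof (induction bs rule: rev_induct)
  case (snoc b bs)
  then show ?case by (auto simp: deps_sat_snoc sat_dep_def)
qed (simp add: deps_sat_def)

text \<open>A proper block on another channel leaves the process on \<open>c\<close> alone, and its
  only effect on the frame is to define its own handles.\<close>

lemma ground_run_skip:
  "ground_run \<Sigma> E \<theta> K bs K' \<Longrightarrow> \<forall>b \<in> set bs. fst b \<noteq> c \<and> snd (snd b) \<noteq> [] \<Longrightarrow>
     fst K' c = fst K c \<and> (\<forall>w. w \<notin> bhandles bs \<longrightarrow> snd K' w = snd K w)"
proof (induction bs arbitrary: K)
  case (Cons b bs)
  then obtain K\<^sub>1 where *: "ground_block \<Sigma> E \<theta> K b K\<^sub>1" "ground_run \<Sigma> E \<theta> K\<^sub>1 bs K'"
    unfolding ground_run.simps by blast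
  have "fst K\<^sub>1 c = fst K c \<and> (\<forall>w. w \<notin> set (snd (snd b)) \<longrightarrow> snd K\<^sub>1 w = snd K w)"
    using *(1)
  proof cases
    case (1 Xs \<Phi> ws us d C R)
    have "R \<noteq> None" "d \<noteq> c" using exec_block_no_output[OF 1(9)] 1(2,8) Cons.prems(2) by auto
    then show ?thesis using 1 by (auto intro: map_upds_apply_nontin)
  qed
  then show ?case using Cons.IH[OF *(2)] Cons.prems(2) by auto
qed simp

lemma ground_block_no_outputs:
  assumes "ground_block \<Sigma> E \<theta> K (c, Xs, []) K'"
  shows "snd K' = snd K"
  using assms by cases auto

text \<open>Whether an improper block can be executed depends only on the process on its channel and
  on the frame entries used by its recipes; as it has no outputs, no freshness of handles is at
  stake.\<close>

lemma ground_block_transfer: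
  assumes "ground_block \<Sigma> E \<theta> K (c, Xs, []) K'" "fst L c = fst K c"
    and "\<forall>X \<in> set Xs. thandles (the (\<theta> X)) \<subseteq> dom (snd L) \<and> (\<forall>w \<in> thandles (the (\<theta> X)). snd L w = snd K w)"
  shows "\<exists>L'. ground_block \<Sigma> E \<theta> L (c, Xs, []) L'"
  using assms(1)
proof cases
  case (1 \<Phi> us C R)
  have eq: "map (\<lambda>X. hsubst (snd L) (the (\<theta> X))) Xs = map (\<lambda>X. hsubst \<Phi> (the (\<theta> X))) Xs"
    using assms(3) 1(1) by (auto intro: hsubst_cong)
  have "exec_block \<Sigma> E IPlus c (fst L c) (map (\<lambda>X. hsubst (snd L) (the (\<theta> X))) Xs) us R"
    unfolding eq using 1 assms(2) by simp
  moreover have "\<forall>X \<in> set Xs. the (\<theta> X) \<in> recipes \<Sigma> (dom (snd L))"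
    using assms(3) 1(4) recipes_change by blast
  ultimately have "ground_block \<Sigma> E \<theta> (fst L, snd L) (c, Xs, [])
      (case R of None \<Rightarrow> (\<lambda>_. Null) | Some Q \<Rightarrow> (fst L)(c := Q), (snd L)([] [\<mapsto>] us))"
    using 1 by (intro ground_block.intros) auto
  then show ?thesis by auto
qed

text \<open>The final block \<open>b = (c, Xs, [])\<close> kills all processes and cannot be permuted with the others. It is
  anticipated as far as possible, to the end of a prefix \<open>p\<close> of the normal form \<open>p @ s\<close> of the other
  blocks. As ground executions are deterministic, those of \<open>p @ [b]\<close> and \<open>p @ s\<close> combine.\<close>

lemma ground_inclusion_improper:
  fixes \<theta> :: "'y \<rightharpoonup> ('f, 'x, 'w, 'n) tm"
  assumes incl: "ground_inclusion True TYPE('y) \<Sigma> E G H"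
    and run: "ground_run \<Sigma> E \<theta> G bs G\<^sub>1" "ground_block \<Sigma> E \<theta> G\<^sub>1 (c, Xs, []) G'"
    and deps: "deps_sat \<theta> bs" and proper: "\<forall>b \<in> set bs. snd (snd b) \<noteq> []"
    and dist: "distinct (bvars (bs @ [(c, Xs, [])]))" and dom: "dom \<theta> = set (bvars (bs @ [(c, Xs, [])]))"
  shows "\<exists>H\<^sub>1 H'. ground_run \<Sigma> E \<theta> H bs H\<^sub>1 \<and> ground_block \<Sigma> E \<theta> H\<^sub>1 (c, Xs, []) H' \<and>
    static_equiv \<Sigma> E (snd G') (snd H')"
proof -
  let ?b = "(c, Xs, [])"
  \<comment> \<open>The inclusion for executions that use only part of the variables in
    \<open>dom \<theta>\<close>; it is applied below to \<open>p @ [?b]\<close> and to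
    \<open>bs\<close>.\<close>
  have restr: "\<exists>H'. ground_run \<Sigma> E \<theta> H bs' H' \<and> static_equiv \<Sigma> E (snd G'') (snd H')"
    if asm: "ground_run \<Sigma> E \<theta> G bs' G''" "distinct (bvars bs')" "set (bvars bs') \<subseteq> dom \<theta>" "deps_sat \<theta> bs'" for bs' G''
  proof -
    let ?\<theta> = "\<theta> |` set (bvars bs')"
    have "\<theta> X = ?\<theta> X" if "X \<in> set (bvars bs')" for X using that by simp
    note cong = ground_run_cong[of bs' \<theta> ?\<theta>, OF this] and deps_cong = deps_sat_cong[of bs' \<theta> ?\<theta>, OF this]
    have "ground_run \<Sigma> E ?\<theta> G bs' G''" using asm(1) cong by blast
    moreover have "deps_sat ?\<theta> bs'" using deps_cong asm(4) by blast
    moreover have "dom ?\<theta> = set (bvars bs')" using asm(3) by (simp add: dom_restrict Int_absorb1)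
    ultimately obtain H' where "ground_run \<Sigma> E ?\<theta> H bs' H'" "static_equiv \<Sigma> E (snd G'') (snd H')"
      using incl asm(2) unfolding ground_inclusion_def by blast
    then show ?thesis using cong by blast
  qed
  \<comment> \<open>The blocks across which \<open>?b\<close> can be moved: the counterpart of
    \<open>indep\<close> for a block that has no outputs.\<close>
  define free where "free s \<longleftrightarrow> (\<forall>b \<in> set s. fst b \<noteq> c \<and>
      (\<forall>X \<in> set Xs. thandles (the (\<theta> X)) \<inter> set (snd (snd b)) = {}))" for s :: "('a, 'y, 'w) block list"
  have "\<exists>n p s. bs = p @ s \<and> free s \<and> length p = n"
    by (intro exI[of _ "length bs"] exI[of _ bs] exI[of _ "[]"]) (simp add: free_def)
  \<comment> \<open>\<open>n\<close> is the leftmost position that \<open>?b\<close> can reach; the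
    end of \<open>bs\<close> is always one of the candidates.\<close>
  then obtain n where n: "\<exists>p s. bs = p @ s \<and> free s \<and> length p = n"
    and least: "\<And>m. m < n \<Longrightarrow> \<not> (\<exists>p s. bs = p @ s \<and> free s \<and> length p = m)"
    using exists_least_iff[of "\<lambda>n. \<exists>p s. bs = p @ s \<and> free s \<and> length p = n"] by blast
  then obtain p s where bs: "bs = p @ s" "free s" "length p = n" by blast
  \<comment> \<open>Were the constraint violated, \<open>?b\<close> could also be moved across the
    segment \<open>b # q\<close> defining \<open>dep p c\<close>, against the minimality of
    \<open>n\<close>.\<close>
  have "sat_dep \<theta> Xs (dep p c)"
  proof (rule ccontr)
    assume "\<not> sat_dep \<theta> Xs (dep p c)"
    then have ne: "dep p c \<noteq> {}" and disj: "\<forall>X \<in> set Xs. thandles (the (\<theta> X)) \<inter> dep p c = {}"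
      by (auto simp: sat_dep_def)
    from ne obtain p' b q where p: "p = p' @ b # q" "c < fst b" "\<forall>b' \<in> set q. fst b' < c"
      "bhandles (b # q) \<subseteq> dep p c"
      by (rule dep_nonempty)
    have "fst b' \<noteq> c \<and> (\<forall>X \<in> set Xs. thandles (the (\<theta> X)) \<inter> set (snd (snd b')) = {})"
      if "b' \<in> set (b # q)" for b'
      using that p(2-4) disj by (intro conjI ballI) (auto, blast)
    then have "free ((b # q) @ s)"
      using bs(2) unfolding free_def set_append by blast
    moreover have "bs = p' @ ((b # q) @ s)" "length p' < n"
      using bs p(1) by auto
    ultimately show False using least by blast
  qed
  then have "deps_sat \<theta> (p @ [?b])"
    using deps deps_sat_append[of \<theta> p s] bs(1) by (simp add: deps_sat_snoc)
  have skip: "\<forall>b \<in> set s. fst b \<noteq> c \<and> snd (snd b) \<noteq> []"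
    using bs proper by (auto simp: free_def)
  have unused: "thandles (the (\<theta> X)) \<inter> bhandles s = {}" if "X \<in> set Xs" for X
    using bs(2) that unfolding free_def by blast
  obtain G\<^sub>2 where G\<^sub>2: "ground_run \<Sigma> E \<theta> G p G\<^sub>2" "ground_run \<Sigma> E \<theta> G\<^sub>2 s G\<^sub>1"
    using run(1) unfolding bs(1) ground_run_append by blast
  have "\<exists>G\<^sub>3. ground_block \<Sigma> E \<theta> G\<^sub>2 ?b G\<^sub>3"
  \<comment> \<open>Transfer backwards in \<open>A\<close>, from the end of \<open>s\<close> to its
    beginning: the recipes use no handle output in \<open>s\<close>, so all their handles are
    already defined after \<open>p\<close>.\<close>
  proof (rule ground_block_transfer[OF run(2)])
    note sk = ground_run_skip[OF G\<^sub>2(2) skip]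
    show "fst G\<^sub>2 c = fst G\<^sub>1 c" using sk by simp
    show "\<forall>X \<in> set Xs. thandles (the (\<theta> X)) \<subseteq> dom (snd G\<^sub>2) \<and> (\<forall>w \<in> thandles (the (\<theta> X)). snd G\<^sub>2 w = snd G\<^sub>1 w)"
    proof
      fix X assume X: "X \<in> set Xs"
      have "thandles (the (\<theta> X)) \<subseteq> dom (snd G\<^sub>2) \<union> bhandles s"
        using ground_block_dom(3)[OF run(2), of X] X ground_run_dom[OF G\<^sub>2(2)] by simp
      then have "thandles (the (\<theta> X)) \<subseteq> dom (snd G\<^sub>2)"
        using unused[OF X] by blast
      moreover have "snd G\<^sub>2 w = snd G\<^sub>1 w" if "w \<in> thandles (the (\<theta> X))" for w
      proof -
        have "w \<notin> bhandles s" using that unused[OF X] by blast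
        then show ?thesis using sk by simp
      qed
      ultimately show "thandles (the (\<theta> X)) \<subseteq> dom (snd G\<^sub>2) \<and>
          (\<forall>w \<in> thandles (the (\<theta> X)). snd G\<^sub>2 w = snd G\<^sub>1 w)"
        by blast
    qed
  qed
  then obtain G\<^sub>3 where "ground_run \<Sigma> E \<theta> G (p @ [?b]) G\<^sub>3"
    using G\<^sub>2(1) unfolding ground_run_snoc by blast
  moreover have "distinct (bvars (p @ [?b]))" "set (bvars (p @ [?b])) \<subseteq> dom \<theta>"
    using dist unfolding dom bs(1) by auto
  ultimately obtain H\<^sub>3 where "ground_run \<Sigma> E \<theta> H (p @ [?b]) H\<^sub>3"
    using restr \<open>deps_sat \<theta> (p @ [?b])\<close> by blast
  then obtain H\<^sub>2 where H\<^sub>2: "ground_run \<Sigma> E \<theta> H p H\<^sub>2" "ground_block \<Sigma> E \<theta> H\<^sub>2 ?b H\<^sub>3"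
    unfolding ground_run_snoc by blast
  have "distinct (bvars bs)" "set (bvars bs) \<subseteq> dom \<theta>"
    using dist unfolding dom by auto
  then obtain H\<^sub>1 where H\<^sub>1: "ground_run \<Sigma> E \<theta> H bs H\<^sub>1" "static_equiv \<Sigma> E (snd G\<^sub>1) (snd H\<^sub>1)"
    using restr[OF run(1)] deps by blast
  \<comment> \<open>Both executions of \<open>B\<close> begin with \<open>p\<close> and therefore
    pass through the same configuration. This lets \<open>?b\<close> be transferred forwards, from
    the beginning of \<open>s\<close> to its end.\<close>
  then have "ground_run \<Sigma> E \<theta> H\<^sub>2 s H\<^sub>1"
    unfolding bs(1) ground_run_append using ground_run_deterministic[OF H\<^sub>2(1)] by blast
  note sk = ground_run_skip[OF this skip]
  have "\<exists>H'. ground_block \<Sigma> E \<theta> H\<^sub>1 ?b H'"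
  proof (rule ground_block_transfer[OF H\<^sub>2(2)])
    show "fst H\<^sub>1 c = fst H\<^sub>2 c" using sk by simp
    show "\<forall>X \<in> set Xs. thandles (the (\<theta> X)) \<subseteq> dom (snd H\<^sub>1) \<and> (\<forall>w \<in> thandles (the (\<theta> X)). snd H\<^sub>1 w = snd H\<^sub>2 w)"
    proof
      fix X assume X: "X \<in> set Xs"
      have "thandles (the (\<theta> X)) \<subseteq> dom (snd H\<^sub>2)"
        using ground_block_dom(3)[OF H\<^sub>2(2), of X] X by simp
      then have "thandles (the (\<theta> X)) \<subseteq> dom (snd H\<^sub>1)"
        using ground_run_dom[OF \<open>ground_run \<Sigma> E \<theta> H\<^sub>2 s H\<^sub>1\<close>] by blast
      moreover have "snd H\<^sub>1 w = snd H\<^sub>2 w" if "w \<in> thandles (the (\<theta> X))" for w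
      proof -
        have "w \<notin> bhandles s" using that unused[OF X] by blast
        then show ?thesis using sk by simp
      qed
      ultimately show "thandles (the (\<theta> X)) \<subseteq> dom (snd H\<^sub>1) \<and>
          (\<forall>w \<in> thandles (the (\<theta> X)). snd H\<^sub>1 w = snd H\<^sub>2 w)"
        by blast
    qed
  qed
  then obtain H' where "ground_block \<Sigma> E \<theta> H\<^sub>1 ?b H'" by blast
  \<comment> \<open>The block has no outputs, so the final frames are those reached by
    \<open>bs\<close>, whose static equivalence is known.\<close>
  then show ?thesis
    using H\<^sub>1 ground_block_no_outputs[OF run(2)] ground_block_no_outputs by metis
qed

section \<open>Equivalence of the two inclusions\<close>

lemma bvars_permute:
  assumes "mset cs = mset cs'"
  shows "distinct (bvars cs) \<longleftrightarrow> distinct (bvars cs')" "set (bvars cs) = set (bvars cs')"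
proof -
  have "mset (bvars bs) = sum_mset (image_mset (\<lambda>b. mset (fst (snd b))) (mset bs))" for bs :: "('a, 'b, 'c) block list"
    by (induction bs) auto
  then have "mset (bvars cs) = mset (bvars cs')"
    by (simp only: assms)
  then show "distinct (bvars cs) \<longleftrightarrow> distinct (bvars cs')" "set (bvars cs) = set (bvars cs')"
    by (rule mset_eq_imp_distinct_iff, rule mset_eq_setD)
qed

lemma ground_inclusion_iff: "ground_inclusion False TYPE('y) \<Sigma> E G H \<longleftrightarrow> ground_inclusion True TYPE('y) \<Sigma> E G H"
proof
  assume incl: "ground_inclusion True TYPE('y) \<Sigma> E G H"
  show "ground_inclusion False TYPE('y) \<Sigma> E G H"
    unfolding ground_inclusion_def
  proof (intro allI impI, elim conjE)
    fix bs and \<theta> :: "'y \<rightharpoonup> ('a, 'b, 'c, 'd) tm" and G'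
    assume run: "ground_run \<Sigma> E \<theta> G bs G'" and dist: "distinct (bvars bs)" and dom: "dom \<theta> = set (bvars bs)"
    have vb: "block_list bs" using ground_run_block_list[OF run] .
    show "\<exists>H'. ground_run \<Sigma> E \<theta> H bs H' \<and> static_equiv \<Sigma> E (snd G') (snd H')"
    proof (cases "\<forall>b \<in> set bs. snd (snd b) \<noteq> []")
      case True
      obtain bs' where bs': "(swap \<theta>)\<^sup>*\<^sup>* bs bs'" "deps_sat \<theta> bs'"
        using ex_swaps_deps_sat[OF run True] by blast
      note m = swaps_mset[OF bs'(1)]
      have "ground_run \<Sigma> E \<theta> G bs' G'" "distinct (bvars bs')" "dom \<theta> = set (bvars bs')"
        using ground_run_swaps[OF bs'(1) run True] dist dom bvars_permute[OF m] by simp_all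
      then obtain H' where "ground_run \<Sigma> E \<theta> H bs' H'" "static_equiv \<Sigma> E (snd G') (snd H')"
        using incl bs'(2) unfolding ground_inclusion_def by blast
      then show ?thesis
        using ground_run_swaps[OF swaps_sym[OF bs'(1)]] True mset_eq_setD[OF m] by metis
    next
      case False
      then have "bs \<noteq> []" by auto
      then obtain cs b where bs: "bs = cs @ [b]" by (metis rev_exhaust)
      obtain c Xs ws where b: "b = (c, Xs, ws)" by (cases b)
      have proper: "\<forall>b \<in> set cs. snd (snd b) \<noteq> []"
        using vb bs by (simp add: block_list_def)
      then have ws: "ws = []" using False bs b by auto
      obtain G\<^sub>1 where G\<^sub>1: "ground_run \<Sigma> E \<theta> G cs G\<^sub>1" "ground_block \<Sigma> E \<theta> G\<^sub>1 (c, Xs, []) G'"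
        using run unfolding bs b ws ground_run_snoc by blast
      obtain cs' where cs': "(swap \<theta>)\<^sup>*\<^sup>* cs cs'" "deps_sat \<theta> cs'"
        using ex_swaps_deps_sat[OF G\<^sub>1(1) proper] by blast
      note m = swaps_mset[OF cs'(1)]
      have proper': "\<forall>b \<in> set cs'. snd (snd b) \<noteq> []"
        using proper mset_eq_setD[OF m] by simp
      have m': "mset (cs' @ [(c, Xs, [])]) = mset bs"
        using m bs b ws by simp
      have "ground_run \<Sigma> E \<theta> G cs' G\<^sub>1" "distinct (bvars (cs' @ [(c, Xs, [])]))" "dom \<theta> = set (bvars (cs' @ [(c, Xs, [])]))"
        using ground_run_swaps[OF cs'(1) G\<^sub>1(1) proper] dist dom bvars_permute[OF m'] by simp_all
      then obtain H\<^sub>1 H' where H: "ground_run \<Sigma> E \<theta> H cs' H\<^sub>1" "ground_block \<Sigma> E \<theta> H\<^sub>1 (c, Xs, []) H'"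
        "static_equiv \<Sigma> E (snd G') (snd H')"
        using ground_inclusion_improper[OF incl _ G\<^sub>1(2) cs'(2) proper'] by blast
      have "ground_run \<Sigma> E \<theta> H cs H\<^sub>1"
        by (rule ground_run_swaps[OF swaps_sym[OF cs'(1)] H(1) proper'])
      then show ?thesis
        using H(2,3) unfolding bs b ws ground_run_snoc by blast
    qed
  qed
\<comment> \<open>The remaining implication is a weakening: the reduced inclusion asks to match only
  those executions that satisfy \<open>deps_sat\<close>.\<close>
qed (unfold ground_inclusion_def, blast)

theorem theorem3:
  fixes \<Sigma> :: "('f \<times> nat) set"
    and E :: "('f, 'x::infinite, 'w::infinite, 'n) equations"
    and A B :: "('f, 'x, 'w, 'n, 'c::linorder) ext_proc"
  assumes "finite \<Sigma>" and "equational_theory \<Sigma> E"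
    and "ext_simple_process \<Sigma> A" and "ext_simple_process \<Sigma> B"
  shows "symbolic_inclusion TYPE('y) \<Sigma> E A B \<longleftrightarrow> reduced_inclusion TYPE('y) \<Sigma> E A B"
proof -
  obtain \<P> \<Phi> where A: "A = (\<P>, \<Phi>)" by (cases A)
  obtain \<Q> \<Psi> where B: "B = (\<Q>, \<Psi>)" by (cases B)
  obtain G where G: "instance_of \<Sigma> Map.empty (\<P>, \<Phi>, {} :: ('f, 'x, 'w, 'n, 'y) constr set) G"
    using instance_of_initial assms(3) unfolding A by blast
  obtain H where H: "instance_of \<Sigma> Map.empty (\<Q>, \<Psi>, {} :: ('f, 'x, 'w, 'n, 'y) constr set) H"
    using instance_of_initial assms(4) unfolding B by blast
  have basic: "all_basic \<Sigma> \<P>" "all_basic \<Sigma> \<Q>"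
    using assms(3,4) unfolding A B by (auto simp: ext_simple_process_def simple_process_all_basic)
  have "symbolic_inclusion TYPE('y) \<Sigma> E A B \<longleftrightarrow> ground_inclusion False TYPE('y) \<Sigma> E G H"
    unfolding symbolic_inclusion_def A B
    by (rule trace_inclusion_iff_ground[OF G H]) (simp_all add: compressed_iff_sym_run[of \<Sigma>] basic)
  also have "\<dots> \<longleftrightarrow> ground_inclusion True TYPE('y) \<Sigma> E G H"
    by (rule ground_inclusion_iff)
  also have "\<dots> \<longleftrightarrow> reduced_inclusion TYPE('y) \<Sigma> E A B"
    unfolding reduced_inclusion_def A B
    by (rule trace_inclusion_iff_ground[OF G H, symmetric])
      (simp_all add: reduced_def reduced_blocks_iff_sym_run[of \<Sigma>] basic)
  finally show ?thesis .
qed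

end
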